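(* Let $L>0$, $\xi_+,\xi_-\in\mathbb R$, $\Xi=(\xi_-,\xi_+)$, and assume that $\mu\in(0,\mu_c(\Xi))$. Consider on $\Omega=2\pi L\mathbb T\times(-1,1)$ the problem $$\begin{cases}\partial_tu+u\cdot\nabla u+\nabla q-\mu\Delta u=0,\quad \operatorname{div}u=0&\text{in }\Omega,\\ u_2=0&\text{on }\Sigma_+\cup\Sigma_-,\\ \mu\,\partial_2u_1=\xi_+u_1&\text{on }\Sigma_+,\\ \mu\,\partial_2u_1=-\xi_-u_1&\text{on }\Sigma_-.\end{cases}$$ The trivial state of this problem is nonlinearly unstable in the following sense: there exist two sufficiently small positive constants $\delta_0$ and $\varepsilon_0$, and a constant $m_0>0$ independent of $\delta$, such that for every $\delta\in(0,\delta_0)$ the problem admits two solutions $u^{1,\delta}$ and $u^{2,\delta}$ satisfying $$\|u^{1,\delta}(0)\|_{H^2}+\|u^{2,\delta}(0)\|_{H^2}\le\delta$$ and $$\|u^{1,\delta}(T^\delta)-u^{2,\delta}(T^\delta)\|_{L^2}\ge m_0\varepsilon_0>0$$ for some positive time $T^\delta=O(|\log\delta|)$.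
   Context: $\mathbb T$ is the usual 1D torus, so that $\Omega=2\pi L\mathbb T\times(-1,1)$ is a horizontally periodic slab of period $2\pi L$ in $x_1$, and $\Sigma_\pm=2\pi L\mathbb T\times\{x_2=\pm1\}$. The unknowns are the velocity $u=(u_1,u_2)(t,x_1,x_2)\in\mathbb R^2$ and the (perturbation) pressure $q(t,x_1,x_2)\in\mathbb R$; the trivial state is $u=0$ with constant pressure. $L^2$ and $H^2$ norms are over $\Omega$. A solution means a local-in-time strong solution: a pair $(u,q)\in C([0,T^{\max}),H^2(\Omega)\times H^1(\Omega))$ satisfying the equations and boundary conditions on its time interval of existence $[0,T^{\max})$, and $T^\delta$ lies in the interval of existence of both solutions. The critical viscosity is $$\mu_c(\Xi)=\sup_{k\in L^{-1}\mathbb Z\setminus\{0\}}\mu_c(k,\Xi),$$ where, with $\tilde H^2((-1,1))=\{\phi\in H^2((-1,1)):\phi(\pm1)=0\}$, $$\mu_c(k,\Xi)=\max_{\phi\in\tilde H^2((-1,1)),\ \phi\neq0}\frac{\xi_-(\phi'(-1))^2+\xi_+(\phi'(1))^2}{\int_{-1}^1\big((\phi'')^2+2k^2(\phi')^2+k^4\phi^2\big)\,dx_2}.$$ *)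

theory Defs
  imports "HOL-Analysis.Analysis" "HOL-Library.Landau_Symbols" "HOL-Library.Extended_Real"
begin

text \<open>
  An element of a Lebesgue or Sobolev space is represented by a Borel function, and only its values
  almost everywhere on the domain \<open>D\<close> matter. The spaces are parametrised by the domain of
  integration \<open>D\<close> and by the class \<open>T\<close> of test functions, so that the interval \<open>(-1,1)\<close> and the
  periodic slab (a period cell together with horizontally periodic test functions) are both instances.
\<close>

definition partial :: "'a::euclidean_space \<Rightarrow> ('a \<Rightarrow> real) \<Rightarrow> 'a \<Rightarrow> real" where
  "partial b f x = frechet_derivative f (at x) b"

definition smooth :: "('a::euclidean_space \<Rightarrow> real) \<Rightarrow> bool" where
  "smooth f \<longleftrightarrow> (\<forall>bs. set bs \<subseteq> Basis \<longrightarrow> (\<forall>x. fold partial bs f differentiable (at x)))"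

definition L2 :: "'a::euclidean_space set \<Rightarrow> ('a \<Rightarrow> real) set" where
  "L2 D = {f. set_borel_measurable lborel D f \<and> set_integrable lborel D (\<lambda>x. (f x)\<^sup>2)}"

definition weak_partial ::
  "'a::euclidean_space set \<Rightarrow> ('a \<Rightarrow> real) set \<Rightarrow> 'a \<Rightarrow> ('a \<Rightarrow> real) \<Rightarrow> ('a \<Rightarrow> real) \<Rightarrow> bool" where
  "weak_partial D T b f g \<longleftrightarrow>
     (\<forall>\<phi>\<in>T. (LINT x:D|lborel. f x * partial b \<phi> x) = - (LINT x:D|lborel. g x * \<phi> x))"

primrec sobolev ::
  "'a::euclidean_space set \<Rightarrow> ('a \<Rightarrow> real) set \<Rightarrow> nat \<Rightarrow> ('a \<Rightarrow> real) set" where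
  "sobolev D T 0 = L2 D"
| "sobolev D T (Suc k) =
     {f \<in> L2 D. \<forall>b\<in>Basis. \<exists>g\<in>sobolev D T k. weak_partial D T b f g}"

text \<open>The weak derivative, which is unique up to a null set of \<open>D\<close> when it exists.\<close>

definition wpartial ::
  "'a::euclidean_space set \<Rightarrow> ('a \<Rightarrow> real) set \<Rightarrow> 'a \<Rightarrow> ('a \<Rightarrow> real) \<Rightarrow> 'a \<Rightarrow> real" where
  "wpartial D T b f = (SOME g. g \<in> L2 D \<and> weak_partial D T b f g)"

text \<open>
  The squared norm is \<open>\<parallel>f\<parallel>\<^sup>2 + \<parallel>\<nabla>f\<parallel>\<^sup>2 + \<parallel>\<nabla>\<^sup>2f\<parallel>\<^sup>2 + \<dots>\<close> with full derivative tensors, so a mixed second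
  derivative counts twice. It is meaningful only on \<open>sobolev D T k\<close>.
\<close>

primrec sobolev_sq ::
  "'a::euclidean_space set \<Rightarrow> ('a \<Rightarrow> real) set \<Rightarrow> nat \<Rightarrow> ('a \<Rightarrow> real) \<Rightarrow> real" where
  "sobolev_sq D T 0 f = (LINT x:D|lborel. (f x)\<^sup>2)"
| "sobolev_sq D T (Suc k) f =
     (LINT x:D|lborel. (f x)\<^sup>2) + (\<Sum>b\<in>Basis. sobolev_sq D T k (wpartial D T b f))"

definition sobolev_norm ::
  "'a::euclidean_space set \<Rightarrow> ('a \<Rightarrow> real) set \<Rightarrow> nat \<Rightarrow> ('a \<Rightarrow> real) \<Rightarrow> real" where
  "sobolev_norm D T k f = sqrt (sobolev_sq D T k f)"

definition test_interval :: "(real \<Rightarrow> real) set" where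
  "test_interval = {\<phi>. smooth \<phi> \<and> (\<exists>\<eta>>0. \<forall>x. \<bar>x\<bar> > 1 - \<eta> \<longrightarrow> \<phi> x = 0)}"

definition D1 :: "(real \<Rightarrow> real) \<Rightarrow> real \<Rightarrow> real" where
  "D1 \<phi> x = vector_derivative \<phi> (at x within {-1..1})"

definition D2 :: "(real \<Rightarrow> real) \<Rightarrow> real \<Rightarrow> real" where
  "D2 \<phi> = wpartial {-1<..<1} test_interval 1 (D1 \<phi>)"

text \<open>
  The boundary values of \<open>\<phi> \<in> H\<^sup>2((-1,1))\<close> and of its derivative are those of its \<open>C\<^sup>1([-1,1])\<close>
  representative, so the space consists of these representatives.
\<close>

definition H2_tilde :: "(real \<Rightarrow> real) set" where
  "H2_tilde = {\<phi>. \<phi> \<in> sobolev {-1<..<1} test_interval 2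
      \<and> \<phi> differentiable_on {-1..1} \<and> continuous_on {-1..1} (D1 \<phi>)
      \<and> \<phi> (-1) = 0 \<and> \<phi> 1 = 0}"

definition rayleigh :: "real \<Rightarrow> real \<Rightarrow> real \<Rightarrow> (real \<Rightarrow> real) \<Rightarrow> real" where
  "rayleigh \<xi>m \<xi>p k \<phi> =
     (\<xi>m * (D1 \<phi> (-1))\<^sup>2 + \<xi>p * (D1 \<phi> 1)\<^sup>2) /
     (LINT x:{-1<..<1}|lborel. (D2 \<phi> x)\<^sup>2 + 2 * k\<^sup>2 * (D1 \<phi> x)\<^sup>2 + k ^ 4 * (\<phi> x)\<^sup>2)"

text \<open>
  The maximum in \<open>mu_c_at\<close> is attained for \<open>k \<noteq> 0\<close>, because \<open>\<phi>'(\<plusminus>1)\<close> depends compactly on \<open>\<phi> \<in> H\<^sup>2\<close> and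
  the value \<open>0\<close> is taken on \<open>H\<^sup>2\<^sub>0\<close>; the supremum in \<open>mu_c\<close> is over a set that is bounded above.
\<close>

definition mu_c_at :: "real \<Rightarrow> real \<Rightarrow> real \<Rightarrow> real" where
  "mu_c_at \<xi>m \<xi>p k =
     (GREATEST m. m \<in> rayleigh \<xi>m \<xi>p k ` {\<phi> \<in> H2_tilde. \<exists>x\<in>{-1..1}. \<phi> x \<noteq> 0})"

definition mu_c :: "real \<Rightarrow> real \<Rightarrow> real \<Rightarrow> real" where
  "mu_c L \<xi>m \<xi>p = (SUP k\<in>{of_int n / L | n :: int. n \<noteq> 0}. mu_c_at \<xi>m \<xi>p k)"

text \<open>
  A function on \<open>\<Omega> = 2 \<pi> L \<T> \<times> (-1,1)\<close> is a function on the plane that is \<open>2 \<pi> L\<close>-periodic in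
  \<open>x\<^sub>1\<close>; integrals over \<open>\<Omega>\<close> are integrals over one period cell. Since the test functions are periodic
  and need not vanish on the vertical sides of the cell, weak derivatives are those on the
  slab: a jump across these sides is not allowed.
\<close>

definition periodic1 :: "real \<Rightarrow> (real ^ 2 \<Rightarrow> 'b) \<Rightarrow> bool" where
  "periodic1 L f \<longleftrightarrow> (\<forall>x. f (x + axis 1 (2 * pi * L)) = f x)"

definition cell :: "real \<Rightarrow> (real ^ 2) set" where
  "cell L = {x. 0 < x $ 1 \<and> x $ 1 < 2 * pi * L \<and> -1 < x $ 2 \<and> x $ 2 < 1}"

definition test_slab :: "real \<Rightarrow> (real ^ 2 \<Rightarrow> real) set" where
  "test_slab L = {\<phi>. smooth \<phi> \<and> periodic1 L \<phi> \<and>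
     (\<exists>\<eta>>0. \<forall>x. \<bar>x $ 2\<bar> > 1 - \<eta> \<longrightarrow> \<phi> x = 0)}"

definition H_slab :: "real \<Rightarrow> nat \<Rightarrow> (real ^ 2 \<Rightarrow> real) set" where
  "H_slab L k = sobolev (cell L) (test_slab L) k"

definition Hnorm :: "real \<Rightarrow> nat \<Rightarrow> (real ^ 2 \<Rightarrow> real) \<Rightarrow> real" where
  "Hnorm L k f = sobolev_norm (cell L) (test_slab L) k f"

definition vHnorm :: "real \<Rightarrow> nat \<Rightarrow> (real ^ 2 \<Rightarrow> real ^ 2) \<Rightarrow> real" where
  "vHnorm L k v = sqrt (\<Sum>i\<in>UNIV. (Hnorm L k (\<lambda>x. v x $ i))\<^sup>2)"

definition pd :: "real \<Rightarrow> 2 \<Rightarrow> (real ^ 2 \<Rightarrow> real) \<Rightarrow> real ^ 2 \<Rightarrow> real" where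
  "pd L j f = wpartial (cell L) (test_slab L) (axis j 1) f"

text \<open>
  The trace on \<open>x\<^sub>2 = s\<close> (for \<open>s = 1\<close> or \<open>s = -1\<close>), as a function of \<open>x\<^sub>1\<close>: the continuous
  extension to \<open>H\<^sup>1(\<Omega>)\<close> of the restriction of functions that are smooth up to the boundary.
\<close>

definition has_trace :: "real \<Rightarrow> real \<Rightarrow> (real ^ 2 \<Rightarrow> real) \<Rightarrow> (real \<Rightarrow> real) \<Rightarrow> bool" where
  "has_trace L s f g \<longleftrightarrow> f \<in> H_slab L 1 \<and> g \<in> L2 {0<..<2 * pi * L} \<and>
     (\<exists>\<Phi> :: nat \<Rightarrow> real ^ 2 \<Rightarrow> real.
        (\<forall>n. smooth (\<Phi> n) \<and> periodic1 L (\<Phi> n)) \<and>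
        (\<lambda>n. Hnorm L 1 (\<lambda>x. \<Phi> n x - f x)) \<longlonglongrightarrow> 0 \<and>
        (\<lambda>n. LINT y:{0<..<2 * pi * L}|lborel. (\<Phi> n (vector [y, s]) - g y)\<^sup>2) \<longlonglongrightarrow> 0)"

definition slab_trace :: "real \<Rightarrow> real \<Rightarrow> (real ^ 2 \<Rightarrow> real) \<Rightarrow> real \<Rightarrow> real" where
  "slab_trace L s f = (SOME g. has_trace L s f g)"

definition existence_interval :: "ereal \<Rightarrow> real set" where
  "existence_interval Tmax = {t. 0 \<le> t \<and> ereal t < Tmax}"

definition continuous_in_H ::
  "real \<Rightarrow> nat \<Rightarrow> ereal \<Rightarrow> (real \<Rightarrow> real ^ 2 \<Rightarrow> real) \<Rightarrow> bool" where
  "continuous_in_H L k Tmax f \<longleftrightarrow>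
     (\<forall>t\<in>existence_interval Tmax. f t \<in> H_slab L k \<and>
        ((\<lambda>s. Hnorm L k (\<lambda>x. f s x - f t x)) \<longlongrightarrow> 0) (at t within existence_interval Tmax))"

text \<open>The time derivative is that of a curve in \<open>L\<^sup>2(\<Omega>)\<close> (one-sided at time \<open>0\<close>).\<close>

definition has_time_derivative ::
  "real \<Rightarrow> ereal \<Rightarrow> (real \<Rightarrow> real ^ 2 \<Rightarrow> real) \<Rightarrow> real \<Rightarrow> (real ^ 2 \<Rightarrow> real) \<Rightarrow> bool" where
  "has_time_derivative L Tmax f t g \<longleftrightarrow> g \<in> L2 (cell L) \<and>
     ((\<lambda>s. Hnorm L 0 (\<lambda>x. (f s x - f t x) / (s - t) - g x)) \<longlongrightarrow> 0)
       (at t within existence_interval Tmax)"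

definition momentum_equation ::
  "real \<Rightarrow> real \<Rightarrow> ereal \<Rightarrow> (real \<Rightarrow> real ^ 2 \<Rightarrow> real ^ 2) \<Rightarrow> (real \<Rightarrow> real ^ 2 \<Rightarrow> real) \<Rightarrow> real \<Rightarrow> bool"
where
  "momentum_equation L \<mu> Tmax u q t \<longleftrightarrow>
     (\<exists>v :: real ^ 2 \<Rightarrow> real ^ 2. \<forall>i.
        has_time_derivative L Tmax (\<lambda>s x. u s x $ i) t (\<lambda>x. v x $ i) \<and>
        (AE x in lborel. x \<in> cell L \<longrightarrow>
           v x $ i + (\<Sum>j\<in>UNIV. u t x $ j * pd L j (\<lambda>y. u t y $ i) x) + pd L i (q t) x
             - \<mu> * (\<Sum>j\<in>UNIV. pd L j (pd L j (\<lambda>y. u t y $ i)) x) = 0))"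

definition divergence_free :: "real \<Rightarrow> (real ^ 2 \<Rightarrow> real ^ 2) \<Rightarrow> bool" where
  "divergence_free L w \<longleftrightarrow>
     (AE x in lborel. x \<in> cell L \<longrightarrow> (\<Sum>j\<in>UNIV. pd L j (\<lambda>y. w y $ j) x) = 0)"

definition boundary_conditions ::
  "real \<Rightarrow> real \<Rightarrow> real \<Rightarrow> real \<Rightarrow> (real ^ 2 \<Rightarrow> real ^ 2) \<Rightarrow> bool" where
  "boundary_conditions L \<xi>m \<xi>p \<mu> w \<longleftrightarrow>
     (AE y in lborel. y \<in> {0<..<2 * pi * L} \<longrightarrow>
        slab_trace L 1 (\<lambda>x. w x $ 2) y = 0 \<and>
        slab_trace L (-1) (\<lambda>x. w x $ 2) y = 0 \<and>
        \<mu> * slab_trace L 1 (pd L 2 (\<lambda>x. w x $ 1)) y = \<xi>p * slab_trace L 1 (\<lambda>x. w x $ 1) y \<and>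
        \<mu> * slab_trace L (-1) (pd L 2 (\<lambda>x. w x $ 1)) y = - \<xi>m * slab_trace L (-1) (\<lambda>x. w x $ 1) y)"

definition strong_solution ::
  "real \<Rightarrow> real \<Rightarrow> real \<Rightarrow> real \<Rightarrow> ereal \<Rightarrow>
     (real \<Rightarrow> real ^ 2 \<Rightarrow> real ^ 2) \<Rightarrow> (real \<Rightarrow> real ^ 2 \<Rightarrow> real) \<Rightarrow> bool" where
  "strong_solution L \<xi>m \<xi>p \<mu> Tmax u q \<longleftrightarrow> 0 < Tmax \<and>
     (\<forall>i. continuous_in_H L 2 Tmax (\<lambda>t x. u t x $ i)) \<and> continuous_in_H L 1 Tmax q \<and>
     (\<forall>t\<in>existence_interval Tmax.
        periodic1 L (u t) \<and> periodic1 L (q t) \<and>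
        momentum_equation L \<mu> Tmax u q t \<and> divergence_free L (u t) \<and>
        boundary_conditions L \<xi>m \<xi>p \<mu> (u t))"

end

theory Submission
  imports Defs "HOL-Computational_Algebra.Polynomial" "HOL-Analysis.Radon_Nikodym"
    "HOL-Real_Asymp.Real_Asymp"
begin

text \<open>
  The instability is carried by shear flows. A horizontal velocity \<open>u = (c e\<^sup>r\<^sup>t U(x\<^sub>2), 0)\<close> is
  divergence free and has \<open>u \<cdot> \<nabla>u = 0\<close>, so with zero pressure it solves the full nonlinear problem for
  all times as soon as \<open>\<mu> U'' = r U\<close> and \<open>U\<close> satisfies the two slip conditions. If \<open>r > 0\<close>, such a
  solution with amplitude \<open>c\<close> of order \<open>\<delta>\<close> has size independent of \<open>\<delta>\<close> at the time
  \<open>\<bar>ln \<delta>\<bar> / r\<close>, and the second solution is the trivial one.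

  It remains to find a growing profile. By \<open>\<mu> < \<mu>\<^sub>c\<close> some \<open>\<phi>\<close> and some wave number \<open>k\<close> satisfy
  \<open>\<xi>\<^sub>- \<phi>'(-1)\<^sup>2 + \<xi>\<^sub>+ \<phi>'(1)\<^sup>2 > \<mu> \<integral> (\<phi>''\<^sup>2 + 2k\<^sup>2\<phi>'\<^sup>2 + k\<^sup>4\<phi>\<^sup>2) \<ge> \<mu> \<integral> \<phi>''\<^sup>2\<close>, so \<open>\<phi>'\<close> is an unstable
  trial function for the shear problem: with \<open>p = \<phi>'(1)\<close> and \<open>m = \<phi>'(-1)\<close> this leaves
  \<open>\<xi>\<^sub>+ p\<^sup>2 + \<xi>\<^sub>- m\<^sup>2 > \<mu> (p - m)\<^sup>2 / 2\<close> (lemma \<open>below_mu_c\<close>). The profiles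
  \<open>U = A cosh (\<kappa> x\<^sub>2) + B sinh (\<kappa> x\<^sub>2)\<close> grow with \<open>r = \<mu> \<kappa>\<^sup>2\<close>; the slip conditions have a solution
  \<open>(A, B) \<noteq> 0\<close> when a determinant in \<open>\<kappa>\<close> vanishes, and the inequality for \<open>p\<close> and \<open>m\<close> forces it
  to vanish for some \<open>\<kappa> > 0\<close> (lemma \<open>unstable_profile\<close>).

  Three groups of facts connect this with the function spaces. Weak derivatives are unique up to null
  sets (\<open>fundamental_lemma\<close>, with explicit test functions built from \<open>e\<^sup>-\<^sup>1\<^sup>/\<^sup>t\<close>) and traces are unique
  (\<open>trace_inequality\<close>), so all derivatives, norms and boundary values of a smooth flow are the
  classical ones. An element of \<open>H\<^sup>2\<close> on the interval can be integrated by parts up to the boundary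
  (\<open>weak_integration_by_parts\<close>). Finally the maximum that defines \<open>\<mu>\<^sub>c(k)\<close> is attained, because the
  energy is minimised under given boundary derivatives by an explicit biharmonic function
  (\<open>rayleigh_attains_maximum\<close>).
\<close>

section \<open>Smooth functions closed under differentiation\<close>

text \<open>
  The derivatives of \<open>e\<^sup>-\<^sup>1\<^sup>/\<^sup>t\<close>, extended by zero, have this form: carrying a polynomial in \<open>1/t\<close>
  as a parameter makes the family closed under differentiation.
\<close>

definition flat :: "real poly \<Rightarrow> real \<Rightarrow> real" where
  "flat p t = (if t > 0 then poly p (inverse t) * exp (- inverse t) else 0)"

text \<open>
  In the variable \<open>z = 1/t\<close> the derivative is \<open>-z\<^sup>2 d/dz\<close>, which sends \<open>p(z) e\<^sup>-\<^sup>z\<close> to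
  \<open>z\<^sup>2 (p(z) - p'(z)) e\<^sup>-\<^sup>z\<close>.
\<close>

definition flat_poly_deriv :: "real poly \<Rightarrow> real poly" where
  "flat_poly_deriv p = [:0, 0, 1:] * (p - pderiv p)"

lemma poly_times_exp_minus_tendsto_0:
  "((\<lambda>x. poly p x * exp (- x :: real)) \<longlongrightarrow> 0) at_top"
proof -
  have "((\<lambda>x. \<Sum>i\<le>degree p. coeff p i * (x ^ i / exp x)) \<longlongrightarrow> (\<Sum>i\<le>degree p. coeff p i * 0)) at_top"
    by (intro tendsto_sum tendsto_mult tendsto_const tendsto_power_div_exp_0)
  then show ?thesis
    by (simp add: poly_altdef sum_distrib_right exp_minus divide_inverse mult.assoc)
qed

lemma flat_tendsto_0: "(flat p \<longlongrightarrow> 0) (at 0)"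
proof -
  have "((\<lambda>t. poly p (inverse t) * exp (- inverse t)) \<longlongrightarrow> 0) (at_right 0)"
    by (rule filterlim_compose[OF poly_times_exp_minus_tendsto_0 filterlim_inverse_at_top_right])
  moreover have "eventually (\<lambda>t. flat p t = poly p (inverse t) * exp (- inverse t)) (at_right 0)"
    by (auto simp: flat_def eventually_at_right_field intro!: exI[of _ 1])
  ultimately have r: "(flat p \<longlongrightarrow> 0) (at_right 0)"
    by (simp cong: filterlim_cong)
  have "eventually (\<lambda>t. flat p t = 0) (at_left 0)"
    by (auto simp: flat_def eventually_at_left_field intro!: exI[of _ "-1"])
  then have "(flat p \<longlongrightarrow> 0) (at_left 0)"
    by (simp cong: filterlim_cong)
  with r show ?thesis by (simp add: filterlim_split_at_real)
qed

lemma has_real_derivative_flat: "(flat p has_real_derivative flat (flat_poly_deriv p) t) (at t)"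
proof -
  consider "t > 0" | "t < 0" | "t = 0" by linarith
  then show ?thesis
  proof cases
    case 1
    have "((\<lambda>t. poly p (inverse t) * exp (- inverse t)) has_real_derivative flat (flat_poly_deriv p) t) (at t)"
      using 1 by (auto intro!: derivative_eq_intros
          simp: flat_def flat_poly_deriv_def field_simps power2_eq_square)
    then show ?thesis
      by (rule DERIV_cong_ev[THEN iffD1, rotated -1])
        (use 1 in \<open>auto simp: flat_def eventually_nhds intro!: exI[of _ "{0<..}"]\<close>)
  next
    case 2
    have "((\<lambda>t. 0) has_real_derivative flat (flat_poly_deriv p) t) (at t)"
      using 2 by (auto simp: flat_def)
    then show ?thesis
      by (rule DERIV_cong_ev[THEN iffD1, rotated -1])
        (use 2 in \<open>auto simp: flat_def eventually_nhds intro!: exI[of _ "{..<0}"]\<close>)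
  next
    case 3
    \<comment> \<open>The difference quotient at the origin is again a flat function, for the polynomial \<open>z p(z)\<close>.\<close>
    have "(\<lambda>h. flat p h / h) = flat ([:0, 1:] * p)"
      by (auto simp: flat_def field_simps)
    then show ?thesis
      using flat_tendsto_0[of "[:0, 1:] * p"] 3
      by (simp add: DERIV_def) (simp add: flat_def)
  qed
qed

inductive_set outer_fun :: "(real \<Rightarrow> real) set" where
  "sin \<in> outer_fun" | "cos \<in> outer_fun" | "sinh \<in> outer_fun" | "cosh \<in> outer_fun"
| "flat p \<in> outer_fun"

lemma outer_fun_deriv:
  assumes "g \<in> outer_fun"
  shows "\<exists>c. \<exists>g'\<in>outer_fun. \<forall>t. (g has_real_derivative c * g' t) (at t)"
  using assms
proof cases
  case 1
  then show ?thesis using outer_fun.intros(2) by (intro exI[of _ 1] bexI[of _ cos]) auto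
next
  case 2
  then show ?thesis using outer_fun.intros(1)
    by (intro exI[of _ "-1"] bexI[of _ sin]) (auto intro!: derivative_eq_intros)
next
  case 3
  then show ?thesis using outer_fun.intros(4)
    by (intro exI[of _ 1] bexI[of _ cosh]) (auto intro!: derivative_eq_intros)
next
  case 4
  then show ?thesis using outer_fun.intros(3)
    by (intro exI[of _ 1] bexI[of _ sinh]) (auto intro!: derivative_eq_intros)
next
  case (5 p)
  then show ?thesis using outer_fun.intros(5)
    by (intro exI[of _ 1] bexI[of _ "flat (flat_poly_deriv p)"]) (auto simp: has_real_derivative_flat)
qed

text \<open>
  Smoothness speaks of all iterated partial derivatives, so it is obtained for a whole class that is
  closed under them. The class has to contain the cutoff functions, their horizontally periodic
  variants and the profiles of shear flows; closure under composition with \<open>outer_fun\<close> gives the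
  chain rule without leaving the class.
\<close>

inductive_set elementary :: "('a::euclidean_space \<Rightarrow> real) set" where
  elementary_const: "(\<lambda>x. c) \<in> elementary"
| elementary_inner: "(\<lambda>x. x \<bullet> b) \<in> elementary"
| elementary_add: "f \<in> elementary \<Longrightarrow> g \<in> elementary \<Longrightarrow> (\<lambda>x. f x + g x) \<in> elementary"
| elementary_mult: "f \<in> elementary \<Longrightarrow> g \<in> elementary \<Longrightarrow> (\<lambda>x. f x * g x) \<in> elementary"
| elementary_comp: "g \<in> outer_fun \<Longrightarrow> f \<in> elementary \<Longrightarrow> (\<lambda>x. g (f x)) \<in> elementary"

lemma elementary_minus: "f \<in> elementary \<Longrightarrow> (\<lambda>x. - f x) \<in> elementary"
  using elementary_mult[OF elementary_const[of "-1"]] by simp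

lemma elementary_diff: "f \<in> elementary \<Longrightarrow> g \<in> elementary \<Longrightarrow> (\<lambda>x. f x - g x) \<in> elementary"
  using elementary_add[OF _ elementary_minus] by fastforce

lemma elementary_derivative:
  assumes "f \<in> elementary"
  shows "\<exists>f'. (\<forall>x. (f has_derivative f' x) (at x)) \<and> (\<forall>b. (\<lambda>x. f' x b) \<in> elementary)"
  using assms
proof induction
  case (elementary_const c)
  then show ?case by (intro exI[of _ "\<lambda>x h. 0"]) (auto intro: elementary.elementary_const)
next
  case (elementary_inner b)
  then show ?case
    by (intro exI[of _ "\<lambda>x h. h \<bullet> b"]) (auto intro: elementary.elementary_const intro!: derivative_eq_intros)
next
  case (elementary_add f g)
  then obtain f' g' where "\<forall>x. (f has_derivative f' x) (at x)" "\<forall>b. (\<lambda>x. f' x b) \<in> elementary"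
    "\<forall>x. (g has_derivative g' x) (at x)" "\<forall>b. (\<lambda>x. g' x b) \<in> elementary" by auto
  then show ?case
    by (intro exI[of _ "\<lambda>x h. f' x h + g' x h"])
      (auto intro!: derivative_eq_intros elementary.elementary_add)
next
  case (elementary_mult f g)
  then obtain f' g' where "\<forall>x. (f has_derivative f' x) (at x)" "\<forall>b. (\<lambda>x. f' x b) \<in> elementary"
    "\<forall>x. (g has_derivative g' x) (at x)" "\<forall>b. (\<lambda>x. g' x b) \<in> elementary" by auto
  with elementary_mult.hyps show ?case
    by (intro exI[of _ "\<lambda>x h. f x * g' x h + f' x h * g x"])
      (auto intro!: has_derivative_mult elementary.elementary_add elementary.elementary_mult)
next
  case (elementary_comp g f)
  then obtain f' where f': "\<forall>x. (f has_derivative f' x) (at x)" "\<forall>b. (\<lambda>x. f' x b) \<in> elementary" by auto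
  obtain c g' where g': "g' \<in> outer_fun" "\<forall>t. (g has_real_derivative c * g' t) (at t)"
    using outer_fun_deriv[OF elementary_comp.hyps(1)] by blast
  have "((\<lambda>x. g (f x)) has_derivative (\<lambda>h. c * (g' (f x) * f' x h))) (at x)" for x
  proof -
    have "(g has_derivative (\<lambda>h. c * g' (f x) * h)) (at (f x))"
      using g'(2) by (auto simp: has_field_derivative_def)
    from has_derivative_compose[OF f'(1)[rule_format] this] show ?thesis by (simp add: mult_ac)
  qed
  moreover have "(\<lambda>x. c * (g' (f x) * f' x b)) \<in> elementary" for b
    using f'(2) g'(1) elementary_comp.hyps
    by (auto intro!: elementary.intros(4) elementary.intros(1) intro: elementary.intros(5))
  ultimately show ?case
    by (intro exI[of _ "\<lambda>x h. c * (g' (f x) * f' x h)"]) auto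
qed

lemma partial_eq: "(f has_derivative f') (at x) \<Longrightarrow> partial b f x = f' b"
  by (simp add: partial_def frechet_derivative_at[symmetric])

lemma elementary_differentiable: "f \<in> elementary \<Longrightarrow> f differentiable (at x)"
  using elementary_derivative differentiable_def by blast

lemma elementary_partial: "f \<in> elementary \<Longrightarrow> partial b f \<in> elementary"
proof -
  assume "f \<in> elementary"
  then obtain f' where "\<forall>x. (f has_derivative f' x) (at x)" "\<forall>b. (\<lambda>x. f' x b) \<in> elementary"
    using elementary_derivative by blast
  then have "partial b f = (\<lambda>x. f' x b)" by (auto simp: partial_eq)
  then show ?thesis using \<open>\<forall>b. (\<lambda>x. f' x b) \<in> elementary\<close> by simp
qed

lemma smooth_elementary: "f \<in> elementary \<Longrightarrow> smooth f"
proof -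
  have "f \<in> elementary \<Longrightarrow> fold partial bs f \<in> elementary" for bs :: "'a list" and f
    by (induction bs arbitrary: f) (auto simp: elementary_partial)
  then show "f \<in> elementary \<Longrightarrow> smooth f"
    by (auto simp: smooth_def elementary_differentiable)
qed

lemma smooth_differentiable: "smooth f \<Longrightarrow> f differentiable (at x)"
  unfolding smooth_def by (metis empty_set empty_subsetI fold_simps(1))

lemma smooth_continuous: "smooth f \<Longrightarrow> continuous_on S f"
  by (auto intro!: continuous_at_imp_continuous_on differentiable_imp_continuous_within smooth_differentiable)

lemma smooth_partial: "smooth f \<Longrightarrow> b \<in> Basis \<Longrightarrow> smooth (partial b f)"
  unfolding smooth_def by (metis fold_simps(2) insert_subset list.simps(15))

lemma partial_diff:
  assumes "f differentiable (at x)" "g differentiable (at x)"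
  shows "partial b (\<lambda>x. f x - g x) x = partial b f x - partial b g x"
proof -
  have "((\<lambda>x. f x - g x) has_derivative
      (\<lambda>h. frechet_derivative f (at x) h - frechet_derivative g (at x) h)) (at x)"
    using assms by (auto intro: has_derivative_diff simp: frechet_derivative_works[symmetric])
  then show ?thesis by (simp add: partial_eq) (simp add: partial_def)
qed

lemma partial_cmult: "f differentiable (at x) \<Longrightarrow> partial b (\<lambda>x. c * f x) x = c * partial b f x"
proof -
  assume "f differentiable (at x)"
  then have "(f has_derivative frechet_derivative f (at x)) (at x)"
    using frechet_derivative_works by blast
  from has_derivative_mult_right[OF this, of c] show ?thesis
    by (simp add: partial_eq) (simp add: partial_def)
qed

lemma partial_mult:
  assumes "f differentiable (at x)" "g differentiable (at x)"
  shows "partial b (\<lambda>x. f x * g x) x = f x * partial b g x + partial b f x * g x"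
proof -
  have "((\<lambda>x. f x * g x) has_derivative
      (\<lambda>h. f x * frechet_derivative g (at x) h + frechet_derivative f (at x) h * g x)) (at x)"
    using assms by (intro has_derivative_mult) (auto simp: frechet_derivative_works[symmetric])
  then show ?thesis by (simp add: partial_eq) (simp add: partial_def)
qed

lemma smooth_diff:
  assumes "smooth f" "smooth g"
  shows "smooth (\<lambda>x. f x - g x)"
proof -
  have "fold partial bs (\<lambda>x. f x - g x) = (\<lambda>x. fold partial bs f x - fold partial bs g x)"
    if "smooth f" "smooth g" "set bs \<subseteq> Basis" for bs and f g :: "'a \<Rightarrow> real"
    using that
  proof (induction bs arbitrary: f g)
    case (Cons b bs)
    have "partial b (\<lambda>x. f x - g x) = (\<lambda>x. partial b f x - partial b g x)"
      using Cons.prems by (auto simp: partial_diff smooth_differentiable)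
    then show ?case using Cons by (simp add: smooth_partial)
  qed simp
  then show ?thesis using assms unfolding smooth_def
    by (auto intro!: differentiable_diff)
qed

lemma partial_real:
  assumes "(f has_real_derivative d) (at x)"
  shows "partial 1 f x = d"
  using assms by (simp add: has_field_derivative_def partial_eq)

lemma smooth_has_real_derivative:
  "smooth f \<Longrightarrow> (f has_real_derivative partial 1 f x) (at x)" for f :: "real \<Rightarrow> real"
  using smooth_differentiable[of f x] partial_real
  by (auto simp: real_differentiable_def)

lemma smooth_has_derivative_axis:
  fixes f :: "real ^ 2 \<Rightarrow> real"
  assumes "smooth f" "(\<gamma> has_vector_derivative axis j 1) (at t within S)"
  shows "((\<lambda>t. f (\<gamma> t)) has_real_derivative partial (axis j 1) f (\<gamma> t)) (at t within S)"
proof -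
  have "(f has_derivative frechet_derivative f (at (\<gamma> t))) (at (\<gamma> t))"
    using smooth_differentiable[OF assms(1)] frechet_derivative_works by blast
  from vector_derivative_diff_chain_within[OF assms(2) has_derivative_at_withinI[OF this]]
  show ?thesis by (simp add: has_real_derivative_iff_has_vector_derivative partial_def o_def)
qed

section \<open>Weak derivatives on a box\<close>

text \<open>
  Boxes generate the Borel sets, so test functions that approximate the indicators of boxes boundedly
  suffice to detect an integrable function.
\<close>

definition separating :: "'a::euclidean_space set \<Rightarrow> ('a \<Rightarrow> real) set \<Rightarrow> bool" where
  "separating D T \<longleftrightarrow> (\<forall>a b. box a b \<subseteq> D \<longrightarrow>
     (\<exists>\<Phi>::nat \<Rightarrow> 'a \<Rightarrow> real. (\<forall>n. \<Phi> n \<in> T) \<and> (\<forall>n. \<forall>x\<in>D. \<bar>\<Phi> n x\<bar> \<le> 1) \<and>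
        (\<forall>x\<in>D. (\<lambda>n. \<Phi> n x) \<longlonglongrightarrow> indicator (box a b) x)))"

lemma set_integrable_continuous_box:
  fixes f :: "'a::euclidean_space \<Rightarrow> real"
  assumes "continuous_on (cbox l u) f"
  shows "set_integrable lborel (box l u) f"
proof -
  have "set_integrable lborel (cbox l u) f"
    unfolding set_integrable_def
    by (rule borel_integrable_compact) (auto intro: assms)
  then show ?thesis
    by (rule set_integrable_subset) (auto simp: box_subset_cbox)
qed

lemma L2_continuous:
  fixes f :: "'a::euclidean_space \<Rightarrow> real"
  assumes "continuous_on (cbox l u) f"
  shows "f \<in> L2 (box l u)"
proof -
  have "continuous_on (box l u) f"
    using assms box_subset_cbox continuous_on_subset by blast
  then have "(\<lambda>x. indicator (box l u) x *\<^sub>R f x) \<in> borel_measurable borel"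
    by (intro borel_measurable_continuous_on_indicator) auto
  then show ?thesis unfolding L2_def set_borel_measurable_def
    using set_integrable_continuous_box[of l u "\<lambda>x. (f x)\<^sup>2"] assms
    by (auto intro!: continuous_intros)
qed

lemma L2_measurable: "f \<in> L2 D \<Longrightarrow> (\<lambda>x. indicator D x * f x) \<in> borel_measurable lborel"
  by (simp add: L2_def set_borel_measurable_def)

lemma L2_mult:
  assumes "f \<in> L2 D" "g \<in> L2 D"
  shows "set_integrable lborel D (\<lambda>x. f x * g x)"
proof -
  have [measurable]: "(\<lambda>x. indicator D x * f x) \<in> borel_measurable lborel"
    "(\<lambda>x. indicator D x * g x) \<in> borel_measurable lborel"
    using assms by (auto dest: L2_measurable)
  have "(\<lambda>x. (indicator D x * f x) * (indicator D x * g x)) \<in> borel_measurable lborel"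
    by measurable
  moreover have "(\<lambda>x. (indicator D x * f x) * (indicator D x * g x)) = (\<lambda>x. indicator D x *\<^sub>R (f x * g x))"
    by (auto simp: indicator_def)
  ultimately have m: "(\<lambda>x. indicator D x *\<^sub>R (f x * g x)) \<in> borel_measurable lborel" by simp
  have "set_integrable lborel D (\<lambda>x. (f x)\<^sup>2 + (g x)\<^sup>2)"
    using assms by (intro set_integral_add) (auto simp: L2_def)
  then show ?thesis
    unfolding set_integrable_def
  proof (rule Bochner_Integration.integrable_bound[OF _ m], intro AE_I2)
    fix x
    have "2 * (\<bar>f x\<bar> * \<bar>g x\<bar>) \<le> (f x)\<^sup>2 + (g x)\<^sup>2"
      using sum_squares_bound[of "\<bar>f x\<bar>" "\<bar>g x\<bar>"] by (simp add: mult_ac)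
    then have "\<bar>f x\<bar> * \<bar>g x\<bar> \<le> (f x)\<^sup>2 + (g x)\<^sup>2"
      using mult_nonneg_nonneg[of "\<bar>f x\<bar>" "\<bar>g x\<bar>"] by linarith
    then show "norm (indicat_real D x *\<^sub>R (f x * g x)) \<le> norm (indicat_real D x *\<^sub>R ((f x)\<^sup>2 + (g x)\<^sup>2))"
      by (auto simp: indicator_def abs_mult)
  qed
qed

lemma L2_add:
  assumes "f \<in> L2 D" "g \<in> L2 D"
  shows "(\<lambda>x. f x + g x) \<in> L2 D"
proof -
  have "set_borel_measurable lborel D (\<lambda>x. f x + g x)"
    using borel_measurable_add[OF L2_measurable[OF assms(1)] L2_measurable[OF assms(2)]]
    by (simp add: set_borel_measurable_def distrib_left)
  moreover have "set_integrable lborel D (\<lambda>x. (f x)\<^sup>2 + (g x)\<^sup>2 + 2 * (f x * g x))"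
    using assms L2_mult[OF assms] by (intro set_integral_add) (auto simp: L2_def)
  then have "set_integrable lborel D (\<lambda>x. (f x + g x)\<^sup>2)"
    by (simp add: power2_sum mult.assoc)
  ultimately show ?thesis by (simp add: L2_def)
qed

lemma L2_cmult:
  assumes "f \<in> L2 D"
  shows "(\<lambda>x. c * f x) \<in> L2 D"
proof -
  have "set_borel_measurable lborel D (\<lambda>x. c * f x)"
    using borel_measurable_times[OF borel_measurable_const[of c] L2_measurable[OF assms]]
    by (simp add: set_borel_measurable_def mult_ac)
  then show ?thesis using assms by (auto simp: L2_def power_mult_distrib)
qed

lemma L2_diff: "f \<in> L2 D \<Longrightarrow> g \<in> L2 D \<Longrightarrow> (\<lambda>x. f x - g x) \<in> L2 D"
  using L2_add[OF _ L2_cmult[of g D "-1"]] by simp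

lemma set_integral_cong_AE_L2:
  assumes "f \<in> L2 D" "f' \<in> L2 D" "g \<in> L2 D" "g' \<in> L2 D"
    and "AE x in lborel. x \<in> D \<longrightarrow> f x = f' x" "AE x in lborel. x \<in> D \<longrightarrow> g x = g' x"
  shows "(LINT x:D|lborel. f x * g x) = (LINT x:D|lborel. f' x * g' x)"
proof -
  have "set_integrable lborel D (\<lambda>x. f x * g x)" "set_integrable lborel D (\<lambda>x. f' x * g' x)"
    using assms by (auto intro: L2_mult)
  moreover have "AE x in lborel. indicator D x *\<^sub>R (f x * g x) = indicator D x *\<^sub>R (f' x * g' x)"
    using assms(5,6) by eventually_elim (auto simp: indicator_def)
  ultimately show ?thesis
    unfolding set_lebesgue_integral_def set_integrable_def
    by (intro integral_cong_AE borel_measurable_integrable)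
qed

text \<open>
  Dominated convergence turns the hypothesis into vanishing integrals of \<open>g\<close> over all boxes. Hence
  the finite measures whose densities are the positive and the negative part of \<open>g\<close> agree on a
  generator of the Borel sets.
\<close>

lemma fundamental_lemma:
  fixes g :: "'a::euclidean_space \<Rightarrow> real"
  assumes D: "D = box l u" and sep: "separating D T"
    and g: "set_integrable lborel D g"
    and T: "\<And>\<phi>. \<phi> \<in> T \<Longrightarrow> continuous_on UNIV \<phi>"
    and zero: "\<And>\<phi>. \<phi> \<in> T \<Longrightarrow> (LINT x:D|lborel. g x * \<phi> x) = 0"
  shows "AE x in lborel. x \<in> D \<longrightarrow> g x = 0"
proof -
  let ?G = "\<lambda>x. indicator D x * g x"
  have G: "integrable lborel ?G" using g by (simp add: set_integrable_def)
  then have [measurable]: "?G \<in> borel_measurable borel" by auto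
  have box0: "integrable lborel (\<lambda>x. indicator (box a b) x * ?G x) \<and>
      (\<integral>x. indicator (box a b) x * ?G x \<partial>lborel) = 0" for a b
  proof -
    define a' b' where "a' = (\<Sum>i\<in>Basis. max (a \<bullet> i) (l \<bullet> i) *\<^sub>R i)"
      "b' = (\<Sum>i\<in>Basis. min (b \<bullet> i) (u \<bullet> i) *\<^sub>R i)"
    have eq: "box a b \<inter> D = box a' b'"
      unfolding D box_Int_box a'_b'_def by simp
    then have "box a' b' \<subseteq> D" by auto
    with sep obtain \<Phi> :: "nat \<Rightarrow> 'a \<Rightarrow> real" where \<Phi>: "\<And>n. \<Phi> n \<in> T"
      "\<And>n x. x \<in> D \<Longrightarrow> \<bar>\<Phi> n x\<bar> \<le> 1"
      "\<And>x. x \<in> D \<Longrightarrow> (\<lambda>n. \<Phi> n x) \<longlonglongrightarrow> indicator (box a' b') x"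
      unfolding separating_def by blast
    have [measurable]: "\<Phi> n \<in> borel_measurable borel" for n
      using T[OF \<Phi>(1)] by (simp add: borel_measurable_continuous_onI)
    have "(\<lambda>n. \<integral>x. ?G x * \<Phi> n x \<partial>lborel) \<longlonglongrightarrow> (\<integral>x. indicator (box a b) x * ?G x \<partial>lborel)"
    proof (rule integral_dominated_convergence)
      show "integrable lborel (\<lambda>x. \<bar>?G x\<bar>)" using G by auto
      show "AE x in lborel. (\<lambda>n. ?G x * \<Phi> n x) \<longlonglongrightarrow> indicator (box a b) x * ?G x"
      proof (intro AE_I2)
        fix x
        show "(\<lambda>n. ?G x * \<Phi> n x) \<longlonglongrightarrow> indicator (box a b) x * ?G x"
        proof (cases "x \<in> D")
          case True
          then have "(indicator (box a' b') x :: real) = indicator (box a b) x"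
            using eq by (auto simp: indicator_def)
          with tendsto_mult[OF tendsto_const \<Phi>(3)[OF True], of "?G x"]
          show ?thesis by (simp add: mult_ac)
        qed auto
      qed
      show "AE x in lborel. norm (?G x * \<Phi> n x) \<le> \<bar>?G x\<bar>" for n
        using \<Phi>(2)[of _ n] by (intro AE_I2) (auto simp: indicator_def abs_mult mult_left_le)
    qed measurable
    moreover have "(\<integral>x. ?G x * \<Phi> n x \<partial>lborel) = 0" for n
      using zero[OF \<Phi>(1)[of n]] by (simp add: set_lebesgue_integral_def mult.assoc)
    ultimately have "(\<integral>x. indicator (box a b) x * ?G x \<partial>lborel) = 0"
      by (simp add: LIMSEQ_const_iff)
    moreover have "integrable lborel (\<lambda>x. indicator (box a b) x * ?G x)"
      using integrable_mult_indicator[OF _ G, of "box a b"] by simp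
    ultimately show ?thesis by simp
  qed
  let ?P = "density lborel (\<lambda>x. ennreal (?G x))" and ?N = "density lborel (\<lambda>x. ennreal (- ?G x))"
  have fin: "(\<integral>\<^sup>+x. ennreal (?G x) * indicator A x \<partial>lborel) < \<infinity>"
    "(\<integral>\<^sup>+x. ennreal (- ?G x) * indicator A x \<partial>lborel) < \<infinity>" for A
  proof -
    have "(\<integral>\<^sup>+x. ennreal (norm (?G x)) \<partial>lborel) < \<infinity>"
      using G by (simp add: integrable_iff_bounded)
    moreover have "(\<integral>\<^sup>+x. ennreal (?G x) * indicator A x \<partial>lborel) \<le> (\<integral>\<^sup>+x. ennreal (norm (?G x)) \<partial>lborel)"
      "(\<integral>\<^sup>+x. ennreal (- ?G x) * indicator A x \<partial>lborel) \<le> (\<integral>\<^sup>+x. ennreal (norm (?G x)) \<partial>lborel)"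
      by (intro nn_integral_mono; auto simp: indicator_def intro!: ennreal_leI)+
    ultimately show "(\<integral>\<^sup>+x. ennreal (?G x) * indicator A x \<partial>lborel) < \<infinity>"
      "(\<integral>\<^sup>+x. ennreal (- ?G x) * indicator A x \<partial>lborel) < \<infinity>"
      by (auto intro: le_less_trans)
  qed
  have eqbox: "emeasure ?P (box a b) = emeasure ?N (box a b)" for a b
  proof -
    let ?I = "indicator (box a b) :: 'a \<Rightarrow> real"
    have i: "(\<integral>\<^sup>+x. ennreal (?G x) * indicator (box a b) x \<partial>lborel) = (\<integral>\<^sup>+x. ennreal (?I x * ?G x) \<partial>lborel)"
      "(\<integral>\<^sup>+x. ennreal (- ?G x) * indicator (box a b) x \<partial>lborel) = (\<integral>\<^sup>+x. ennreal (- (?I x * ?G x)) \<partial>lborel)"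
      by (intro nn_integral_cong; auto simp: indicator_def)+
    have "enn2real (\<integral>\<^sup>+x. ennreal (?I x * ?G x) \<partial>lborel) = enn2real (\<integral>\<^sup>+x. ennreal (- (?I x * ?G x)) \<partial>lborel)"
      using box0[of a b] real_lebesgue_integral_def[OF conjunct1[OF box0[of a b]]] by linarith
    with fin[of "box a b"] have "(\<integral>\<^sup>+x. ennreal (?I x * ?G x) \<partial>lborel) = (\<integral>\<^sup>+x. ennreal (- (?I x * ?G x)) \<partial>lborel)"
      unfolding i by (metis ennreal_enn2real infinity_ennreal_def)
    then show ?thesis by (simp add: emeasure_density i[symmetric])
  qed
  have "?P = ?N"
  proof (rule measure_eqI_generator_eq)
    let ?E = "range (\<lambda>(a, b). box a b::'a set)"
    let ?A = "\<lambda>n::nat. box (- (real n *\<^sub>R One)) (real n *\<^sub>R One) :: 'a set"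
    show "Int_stable ?E"
      by (auto simp: Int_stable_def box_Int_box)
    show "?E \<subseteq> Pow UNIV" "sets ?P = sigma_sets UNIV ?E" "sets ?N = sigma_sets UNIV ?E"
      by (simp_all add: borel_eq_box)
    show "range ?A \<subseteq> ?E" "(\<Union>i. ?A i) = UNIV"
      unfolding UN_box_eq_UNIV by auto
    show "emeasure ?P (?A i) \<noteq> \<infinity>" for i
      using fin(1)[of "?A i"] by (simp add: emeasure_density)
    show "\<And>X. X \<in> ?E \<Longrightarrow> emeasure ?P X = emeasure ?N X" using eqbox by auto
  qed
  then have "AE x in lborel. ennreal (?G x) = ennreal (- ?G x)"
    by (rule sigma_finite_measure.density_unique[OF lborel.sigma_finite_measure_axioms, rotated -1]) auto
  then show ?thesis
  proof (rule AE_mp, intro AE_I2 impI)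
    fix x assume "ennreal (?G x) = ennreal (- ?G x)" "x \<in> D"
    then show "g x = 0" by (cases "g x \<ge> 0") (auto simp: ennreal_neg ennreal_eq_0_iff)
  qed
qed

text \<open>
  The regular functions \<open>R\<close> are closed under differentiation, and classical differentiation is weak
  differentiation for them. On the interval these are all smooth functions, on the slab the periodic
  ones: a jump across the sides of the cell would contribute to the weak derivative.
\<close>

locale sobolev_domain =
  fixes D :: "'a::euclidean_space set" and T R :: "('a \<Rightarrow> real) set"
  assumes D_box: "\<exists>l u. D = box l u"
    and T_smooth: "\<phi> \<in> T \<Longrightarrow> smooth \<phi>"
    and sep: "separating D T"
    and R_smooth: "f \<in> R \<Longrightarrow> smooth f"
    and R_partial: "f \<in> R \<Longrightarrow> b \<in> Basis \<Longrightarrow> partial b f \<in> R"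
    and R_weak: "f \<in> R \<Longrightarrow> b \<in> Basis \<Longrightarrow> weak_partial D T b f (partial b f)"
begin

lemma smooth_L2: "smooth f \<Longrightarrow> f \<in> L2 D"
  using D_box L2_continuous smooth_continuous by blast

lemma L2_set_integrable: "f \<in> L2 D \<Longrightarrow> set_integrable lborel D f"
proof -
  obtain l u where "D = box l u" using D_box by blast
  then have "(\<lambda>x. 1) \<in> L2 D" by (auto intro: L2_continuous)
  then show "f \<in> L2 D \<Longrightarrow> set_integrable lborel D f"
    using L2_mult by fastforce
qed

lemma weak_partial_unique:
  assumes "weak_partial D T b f g" "weak_partial D T b f h" "g \<in> L2 D" "h \<in> L2 D"
  shows "AE x in lborel. x \<in> D \<longrightarrow> g x = h x"
proof -
  obtain l u where D: "D = box l u" using D_box by blast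
  have "(LINT x:D|lborel. (g x - h x) * \<phi> x) = 0" if "\<phi> \<in> T" for \<phi>
  proof -
    have \<phi>: "\<phi> \<in> L2 D" using T_smooth[OF that] smooth_L2 by blast
    have "(LINT x:D|lborel. (g x - h x) * \<phi> x) = (LINT x:D|lborel. g x * \<phi> x) - (LINT x:D|lborel. h x * \<phi> x)"
      by (simp add: left_diff_distrib set_integral_diff(2)[OF L2_mult[OF assms(3) \<phi>] L2_mult[OF assms(4) \<phi>]])
    then show ?thesis using assms(1,2) that unfolding weak_partial_def by simp
  qed
  then have "AE x in lborel. x \<in> D \<longrightarrow> g x - h x = 0"
    using assms(3,4) T_smooth smooth_continuous
    by (intro fundamental_lemma[OF D sep] L2_set_integrable L2_diff) auto
  then show ?thesis by auto
qed

lemma weak_partial_cong: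
  assumes "AE x in lborel. x \<in> D \<longrightarrow> f x = f' x" "f \<in> L2 D" "f' \<in> L2 D" "b \<in> Basis"
  shows "weak_partial D T b f g = weak_partial D T b f' g"
proof -
  have "(LINT x:D|lborel. f x * partial b \<phi> x) = (LINT x:D|lborel. f' x * partial b \<phi> x)" if "\<phi> \<in> T" for \<phi>
    using smooth_L2[OF smooth_partial[OF T_smooth[OF that] assms(4)]] assms
    by (intro set_integral_cong_AE_L2) auto
  then show ?thesis unfolding weak_partial_def by auto
qed

text \<open>
  The choice in the definition of \<open>wpartial\<close> depends only on the set of weak derivatives, so functions
  that agree almost everywhere have literally the same chosen derivative.
\<close>

lemma wpartial_cong:
  assumes "AE x in lborel. x \<in> D \<longrightarrow> f x = f' x" "f \<in> L2 D" "f' \<in> L2 D" "b \<in> Basis"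
  shows "wpartial D T b f = wpartial D T b f'"
  unfolding wpartial_def weak_partial_cong[OF assms] ..

text \<open>
  By uniqueness, the derivative that \<open>wpartial\<close> chooses agrees almost everywhere with any known one.
\<close>

lemma wpartial:
  assumes "weak_partial D T b f g" "g \<in> L2 D"
  shows "wpartial D T b f \<in> L2 D" "weak_partial D T b f (wpartial D T b f)"
    "AE x in lborel. x \<in> D \<longrightarrow> wpartial D T b f x = g x"
proof -
  have "wpartial D T b f \<in> L2 D \<and> weak_partial D T b f (wpartial D T b f)"
    unfolding wpartial_def using assms by (intro someI[of "\<lambda>g. g \<in> L2 D \<and> weak_partial D T b f g" g]) auto
  then show "wpartial D T b f \<in> L2 D" "weak_partial D T b f (wpartial D T b f)"
    "AE x in lborel. x \<in> D \<longrightarrow> wpartial D T b f x = g x"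
    using weak_partial_unique assms by blast+
qed

text \<open>
  Iterated weak derivatives of a regular function are known only up to null sets. This relation is
  preserved by weak differentiation, and norms and traces depend on the represented function only.
\<close>

definition represents :: "('a \<Rightarrow> real) \<Rightarrow> ('a \<Rightarrow> real) \<Rightarrow> bool" where
  "represents f' f \<longleftrightarrow> f \<in> R \<and> f' \<in> L2 D \<and> (AE x in lborel. x \<in> D \<longrightarrow> f' x = f x)"

lemma represents_self: "f \<in> R \<Longrightarrow> represents f f"
  by (simp add: represents_def R_smooth smooth_L2)

lemma represents_wpartial:
  assumes "represents f' f" "b \<in> Basis"
  shows "represents (wpartial D T b f') (partial b f)"
proof -
  have f: "f \<in> R" "f' \<in> L2 D" "AE x in lborel. x \<in> D \<longrightarrow> f' x = f x"
    using assms by (auto simp: represents_def)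
  have L2: "partial b f \<in> L2 D" "f \<in> L2 D"
    using R_partial[OF f(1) assms(2)] f(1) R_smooth smooth_L2 by auto
  have "wpartial D T b f' = wpartial D T b f" by (rule wpartial_cong) (use f L2 assms in auto)
  then show ?thesis
    using wpartial[OF R_weak[OF f(1) assms(2)] L2(1)] R_partial[OF f(1) assms(2)]
    by (simp add: represents_def)
qed

lemma represents_sobolev: "represents f' f \<Longrightarrow> f' \<in> sobolev D T k"
proof (induction k arbitrary: f' f)
  case (Suc k)
  have "\<exists>g\<in>sobolev D T k. weak_partial D T b f' g" if "b \<in> Basis" for b
  proof (intro bexI)
    show "partial b f \<in> sobolev D T k"
      using Suc that by (auto simp: represents_def intro!: Suc.IH represents_self R_partial)
    show "weak_partial D T b f' (partial b f)"
      using Suc.prems R_weak[OF _ that] smooth_L2 R_smooth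
      by (subst weak_partial_cong[OF _ _ _ that, of f' f]) (auto simp: represents_def)
  qed
  then show ?case using Suc.prems by (auto simp: represents_def)
qed (auto simp: represents_def)

primrec classical_sq :: "nat \<Rightarrow> ('a \<Rightarrow> real) \<Rightarrow> real" where
  "classical_sq 0 f = (LINT x:D|lborel. (f x)\<^sup>2)"
| "classical_sq (Suc k) f = (LINT x:D|lborel. (f x)\<^sup>2) + (\<Sum>b\<in>Basis. classical_sq k (partial b f))"

lemma represents_integral_sq:
  "represents f' f \<Longrightarrow> (LINT x:D|lborel. (f' x)\<^sup>2) = (LINT x:D|lborel. (f x)\<^sup>2)"
  unfolding power2_eq_square
  by (rule set_integral_cong_AE_L2) (auto simp: represents_def smooth_L2 R_smooth)

lemma represents_sobolev_sq: "represents f' f \<Longrightarrow> sobolev_sq D T k f' = classical_sq k f"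
proof (induction k arbitrary: f' f)
  case (Suc k)
  then show ?case
    using represents_integral_sq[OF Suc.prems] represents_wpartial[OF Suc.prems]
    by (auto intro!: sum.cong)
qed (simp add: represents_integral_sq)

lemma classical_sq_nonneg: "classical_sq k f \<ge> 0"
  by (induction k arbitrary: f)
    (auto simp: set_lebesgue_integral_def intro!: add_nonneg_nonneg sum_nonneg integral_nonneg_AE)

lemma classical_sq_cmult: "f \<in> R \<Longrightarrow> classical_sq k (\<lambda>x. c * f x) = c\<^sup>2 * classical_sq k f"
proof (induction k arbitrary: f)
  case (Suc k)
  have "partial b (\<lambda>x. c * f x) = (\<lambda>x. c * partial b f x)" for b
    using R_smooth[OF Suc.prems] by (auto simp: partial_cmult smooth_differentiable)
  then show ?case using Suc
    by (simp add: power_mult_distrib sum_distrib_left distrib_left R_partial)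
qed (simp add: power_mult_distrib)

end

section \<open>Cutoff functions and the interval\<close>

lemma integral_FTC_open_interval:
  fixes F f :: "real \<Rightarrow> real"
  assumes "a \<le> b" "continuous_on {a..b} f"
    and "\<And>x. x \<in> {a..b} \<Longrightarrow> (F has_real_derivative f x) (at x within {a..b})"
  shows "(LINT x:{a<..<b}|lborel. f x) = F b - F a"
proof -
  have "(LBINT x=a..b. f x) = F b - F a"
    using assms by (intro interval_integral_FTC_finite)
      (auto simp: has_real_derivative_iff_has_vector_derivative)
  then show ?thesis using assms(1) by (simp add: interval_lebesgue_integral_le_eq)
qed

text \<open>
  The argument is scaled by the square of the shift: the function vanishes for
  \<open>y \<le> 1 / (n + 1)\<close> and still tends to \<open>1\<close> at every \<open>y > 0\<close>. The first property keeps the supports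
  of the cutoffs below compactly inside the interval.
\<close>

definition smooth_step :: "nat \<Rightarrow> real \<Rightarrow> real" where
  "smooth_step n y = flat 1 ((real (Suc n))\<^sup>2 * y - real (Suc n))"

lemma smooth_step_bounds: "0 \<le> smooth_step n y" "smooth_step n y \<le> 1"
  by (auto simp: smooth_step_def flat_def)

lemma smooth_step_eq_0: "y \<le> 1 / real (Suc n) \<Longrightarrow> smooth_step n y = 0"
proof -
  assume "y \<le> 1 / real (Suc n)"
  then have "real (Suc n) * y \<le> 1" by (simp add: field_simps)
  from mult_left_mono[OF this, of "real (Suc n)"]
  have "(real (Suc n))\<^sup>2 * y \<le> real (Suc n)" by (simp add: power2_eq_square mult.assoc)
  then show ?thesis by (simp add: smooth_step_def flat_def)
qed

lemma smooth_step_tendsto: "(\<lambda>n. smooth_step n y) \<longlonglongrightarrow> (if y > 0 then 1 else 0)"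
proof (cases "y > 0")
  case True
  let ?a = "\<lambda>n. (real (Suc n))\<^sup>2 * y - real (Suc n)"
  have inf: "filterlim ?a at_top sequentially"
  proof (rule filterlim_compose[of "\<lambda>t. t\<^sup>2 * y - t" _ at_top])
    have "filterlim (\<lambda>t::real. t * (t * y - 1)) at_top at_top"
      by (intro filterlim_at_top_mult_at_top filterlim_ident
          filterlim_tendsto_add_at_top[OF tendsto_const[of "-1"], simplified]
          filterlim_at_top_mult_tendsto_pos[OF tendsto_const True])
    then show "filterlim (\<lambda>t. t\<^sup>2 * y - t) at_top at_top"
      by (simp add: power2_eq_square algebra_simps)
    show "filterlim (\<lambda>n. real (Suc n)) at_top sequentially"
      by (rule filterlim_compose[OF filterlim_real_sequentially filterlim_Suc])
  qed
  then have "(\<lambda>n. exp (- inverse (?a n))) \<longlonglongrightarrow> exp (- 0)"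
    by (intro tendsto_exp tendsto_minus filterlim_compose[OF tendsto_inverse_0_at_top[OF filterlim_ident]])
  then have lim: "(\<lambda>n. exp (- inverse (?a n))) \<longlonglongrightarrow> 1" by simp
  have ev: "eventually (\<lambda>n. smooth_step n y = exp (- inverse (?a n))) sequentially"
    using filterlim_at_top_dense[THEN iffD1, OF inf, rule_format, of 0]
    by eventually_elim (simp add: smooth_step_def flat_def del: of_nat_Suc)
  show ?thesis using True lim tendsto_cong[OF ev] by simp
next
  case False
  then have "smooth_step n y = 0" for n
    by (intro smooth_step_eq_0) (meson divide_nonneg_nonneg dual_order.trans not_less of_nat_0_le_iff zero_le_one)
  then show ?thesis using False by simp
qed

lemma smooth_step_elementary: "f \<in> elementary \<Longrightarrow> (\<lambda>x. smooth_step n (f x)) \<in> elementary"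
  unfolding smooth_step_def
  by (rule elementary_comp[OF outer_fun.intros(5)]) (intro elementary_diff elementary_mult elementary_const)

lemma smooth_step_has_derivative:
  "\<exists>d. \<forall>y. (smooth_step n has_real_derivative d y) (at y) \<and> d y \<ge> 0"
proof -
  let ?a = "\<lambda>y. (real (Suc n))\<^sup>2 * y - real (Suc n)"
  have "((\<lambda>y. flat 1 (?a y)) has_real_derivative flat (flat_poly_deriv 1) (?a y) * (real (Suc n))\<^sup>2) (at y)" for y
    by (rule DERIV_chain2[OF has_real_derivative_flat]) (auto intro!: derivative_eq_intros)
  moreover have "flat (flat_poly_deriv 1) t \<ge> 0" for t
    by (simp add: flat_def flat_poly_deriv_def)
  ultimately show ?thesis unfolding smooth_step_def
    by (intro exI[of _ "\<lambda>y. flat (flat_poly_deriv 1) (?a y) * (real (Suc n))\<^sup>2"]) auto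
qed

definition interval_cutoff :: "real \<Rightarrow> real \<Rightarrow> nat \<Rightarrow> real \<Rightarrow> real" where
  "interval_cutoff a b n x = smooth_step n (x - a) * smooth_step n (b - x)"

lemma interval_cutoff_bounds: "0 \<le> interval_cutoff a b n x" "interval_cutoff a b n x \<le> 1"
  by (auto simp: interval_cutoff_def smooth_step_bounds intro: mult_le_one)

lemma interval_cutoff_tendsto: "(\<lambda>n. interval_cutoff a b n x) \<longlonglongrightarrow> indicator {a<..<b} x"
  using tendsto_mult[OF smooth_step_tendsto[of "x - a"] smooth_step_tendsto[of "b - x"]]
  by (auto simp: interval_cutoff_def indicator_def split: if_splits)

lemma interval_cutoff_support:
  "interval_cutoff a b n x \<noteq> 0 \<Longrightarrow> a + 1 / real (Suc n) < x \<and> x < b - 1 / real (Suc n)"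
  using smooth_step_eq_0[of "x - a" n] smooth_step_eq_0[of "b - x" n]
  unfolding interval_cutoff_def mult_eq_0_iff de_Morgan_disj by linarith

lemma interval_cutoff_vanishes:
  assumes "{a<..<b} \<subseteq> {-1<..<1}" "\<bar>x\<bar> > 1 - 1 / real (Suc n)"
  shows "interval_cutoff a b n x = 0"
proof (rule ccontr)
  assume "interval_cutoff a b n x \<noteq> 0"
  note s = interval_cutoff_support[OF this]
  have "1 / real (Suc n) > 0" by simp
  with s have "a < b" by linarith
  with assms(1) have "-1 \<le> a" "b \<le> 1" by (auto simp: greaterThanLessThan_subseteq_greaterThanLessThan)
  with s assms(2) show False by linarith
qed

lemma interval_cutoff_elementary:
  "f \<in> elementary \<Longrightarrow> (\<lambda>x. interval_cutoff a b n (f x)) \<in> elementary"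
  unfolding interval_cutoff_def by (intro elementary_mult smooth_step_elementary elementary_diff elementary_const)

lemma elementary_id: "(\<lambda>x::real. x) \<in> elementary"
  using elementary_inner[of "1::real"] by simp

lemma test_interval_cutoff:
  assumes "{a<..<b} \<subseteq> {-1<..<1}" "h \<in> elementary"
  shows "(\<lambda>x. h x * interval_cutoff a b n x) \<in> test_interval"
  unfolding test_interval_def
  using assms interval_cutoff_vanishes[OF assms(1), of n]
  by (auto intro!: smooth_elementary elementary_mult interval_cutoff_elementary elementary_id exI[of _ "1 / real (Suc n)"])

lemma box_interval: "{-1<..<1} = box (-1::real) 1"
  by (simp add: box_real)

lemma separating_interval: "separating {-1<..<1} test_interval"
  unfolding separating_def box_real
proof (intro allI impI)
  fix a b :: real assume "{a<..<b} \<subseteq> {-1<..<1}"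
  then show "\<exists>\<Phi>::nat \<Rightarrow> real \<Rightarrow> real. (\<forall>n. \<Phi> n \<in> test_interval) \<and>
      (\<forall>n. \<forall>x\<in>{-1<..<1}. \<bar>\<Phi> n x\<bar> \<le> 1) \<and>
      (\<forall>x\<in>{-1<..<1}. (\<lambda>n. \<Phi> n x) \<longlonglongrightarrow> indicator {a<..<b} x)"
    using test_interval_cutoff[OF _ elementary_const[of 1], of a b]
    by (intro exI[of _ "interval_cutoff a b"])
      (auto simp: interval_cutoff_bounds intro: interval_cutoff_tendsto)
qed

lemma test_interval_smooth: "\<phi> \<in> test_interval \<Longrightarrow> smooth \<phi>"
  by (simp add: test_interval_def)

lemma smooth_continuous_partial: "smooth f \<Longrightarrow> continuous_on S (partial 1 f)" for f :: "real \<Rightarrow> real"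
  using smooth_continuous[OF smooth_partial[of f 1]] by simp

lemma test_interval_boundary: "\<phi> \<in> test_interval \<Longrightarrow> \<phi> 1 = 0 \<and> \<phi> (-1) = 0"
  by (auto simp: test_interval_def)

lemma L2_interval: "continuous_on {-1..1} f \<Longrightarrow> f \<in> L2 {-1<..<(1::real)}"
  using L2_continuous[of "-1" "1::real" f] by (simp add: box_real)

lemma integrable_interval: "continuous_on {-1..1} f \<Longrightarrow> set_integrable lborel {-1<..<(1::real)} f" for f :: "real \<Rightarrow> real"
  using set_integrable_continuous_box[of "-1" "1::real" f] by (simp add: box_real)

lemma weak_partial_classical:
  assumes v: "\<And>x. x \<in> {-1..1} \<Longrightarrow> (v has_real_derivative v' x) (at x within {-1..1})"
    and v': "continuous_on {-1..1} v'"
  shows "weak_partial {-1<..<1} test_interval 1 v v'"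
  unfolding weak_partial_def
proof
  fix \<phi> assume \<phi>: "\<phi> \<in> test_interval"
  have c: "continuous_on {-1..1} v" "continuous_on {-1..1} \<phi>" "continuous_on {-1..1} (partial 1 \<phi>)"
    using DERIV_continuous_on[OF v] test_interval_smooth[OF \<phi>]
    by (auto intro: smooth_continuous smooth_continuous_partial)
  have "(LINT x:{-1<..<1}|lborel. v x * partial 1 \<phi> x + v' x * \<phi> x) = v 1 * \<phi> 1 - v (-1) * \<phi> (-1)"
  proof (rule integral_FTC_open_interval)
    fix x :: real assume x: "x \<in> {-1..1}"
    show "((\<lambda>x. v x * \<phi> x) has_real_derivative v x * partial 1 \<phi> x + v' x * \<phi> x) (at x within {-1..1})"
      using v[OF x] smooth_has_real_derivative[OF test_interval_smooth[OF \<phi>], of x]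
      by (auto intro!: derivative_eq_intros intro: has_field_derivative_at_within)
  qed (auto intro!: continuous_intros c v')
  moreover have "(LINT x:{-1<..<1}|lborel. v x * partial 1 \<phi> x + v' x * \<phi> x)
      = (LINT x:{-1<..<1}|lborel. v x * partial 1 \<phi> x) + (LINT x:{-1<..<1}|lborel. v' x * \<phi> x)"
    by (intro set_integral_add(2) integrable_interval continuous_intros c v')
  ultimately show "(LINT x:{-1<..<1}|lborel. v x * partial 1 \<phi> x) = - (LINT x:{-1<..<1}|lborel. v' x * \<phi> x)"
    using test_interval_boundary[OF \<phi>] by simp
qed

interpretation interval: sobolev_domain "{-1<..<1}" test_interval "Collect smooth :: (real \<Rightarrow> real) set"
proof
  show "\<exists>l u. {-1<..<1} = box (l::real) u" using box_interval by blast
  show "weak_partial {-1<..<1} test_interval b f (partial b f)"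
    if "f \<in> Collect smooth" "b \<in> Basis" for f and b :: real
    using that
    by (auto intro!: weak_partial_classical has_field_derivative_at_within smooth_has_real_derivative
        smooth_continuous smooth_partial)
qed (auto simp: test_interval_smooth separating_interval smooth_partial)

lemma integral_times_cutoff_tendsto:
  assumes "set_integrable lborel {-1<..<1} f"
  shows "(\<lambda>n. LINT x:{-1<..<1}|lborel. f x * interval_cutoff (-1) 1 n x) \<longlonglongrightarrow> (LINT x:{-1<..<1}|lborel. f x)"
  unfolding set_lebesgue_integral_def
proof (rule integral_dominated_convergence)
  let ?G = "\<lambda>x. indicator {-1<..<1} x *\<^sub>R f x"
  have G: "integrable lborel ?G" using assms by (simp add: set_integrable_def)
  then show "integrable lborel (\<lambda>x. \<bar>?G x\<bar>)" by auto
  from G show [measurable]: "?G \<in> borel_measurable lborel" by auto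
  have [measurable]: "interval_cutoff (-1) 1 n \<in> borel_measurable borel" for n
    using smooth_continuous[OF smooth_elementary[OF interval_cutoff_elementary[OF elementary_id]]]
    by (rule borel_measurable_continuous_onI)
  have "(\<lambda>x. ?G x * interval_cutoff (-1) 1 n x) \<in> borel_measurable lborel" for n by measurable
  then show "(\<lambda>x. indicator {-1<..<1} x *\<^sub>R (f x * interval_cutoff (-1) 1 n x)) \<in> borel_measurable lborel" for n
    by (simp add: mult.assoc)
  show "AE x in lborel. norm (indicator {-1<..<1} x *\<^sub>R (f x * interval_cutoff (-1) 1 n x)) \<le> \<bar>?G x\<bar>" for n
    using interval_cutoff_bounds[of "-1" 1 n]
    by (intro AE_I2) (auto simp: indicator_def abs_mult mult_left_le)
  show "AE x in lborel. (\<lambda>n. indicator {-1<..<1} x *\<^sub>R (f x * interval_cutoff (-1) 1 n x)) \<longlonglongrightarrow> ?G x"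
  proof (intro AE_I2)
    fix x :: real
    show "(\<lambda>n. indicator {-1<..<1} x *\<^sub>R (f x * interval_cutoff (-1) 1 n x)) \<longlonglongrightarrow> ?G x"
      using tendsto_mult[OF tendsto_const interval_cutoff_tendsto, of "?G x" "-1" 1 x]
      by (cases "x \<in> {-1<..<1}") auto
  qed
qed

lemma abs_set_integral_le:
  fixes f g :: "'a::euclidean_space \<Rightarrow> real"
  assumes "set_integrable lborel D f" "set_integrable lborel D g" "\<And>x. x \<in> D \<Longrightarrow> \<bar>f x\<bar> \<le> g x"
  shows "\<bar>LINT x:D|lborel. f x\<bar> \<le> (LINT x:D|lborel. g x)"
proof -
  have "\<bar>LINT x:D|lborel. f x\<bar> \<le> (LINT x|lborel. \<bar>indicator D x *\<^sub>R f x\<bar>)"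
    unfolding set_lebesgue_integral_def by (rule integral_abs_bound)
  also have "\<dots> \<le> (LINT x:D|lborel. g x)"
    unfolding set_lebesgue_integral_def
    using assms by (intro integral_mono) (auto simp: set_integrable_def indicator_def)
  finally show ?thesis .
qed

text \<open>
  The derivatives of the cutoffs tend to \<open>\<delta>\<^sub>-\<^sub>1 - \<delta>\<^sub>1\<close> on continuous functions. For polynomials this is
  an integration by parts. The general case follows by uniform approximation, since the
  total variations of the cutoffs are bounded.
\<close>

lemma cutoff_derivative_tendsto:
  assumes \<omega>: "continuous_on {-1..1} \<omega>"
  shows "(\<lambda>n. LINT x:{-1<..<1}|lborel. \<omega> x * partial 1 (interval_cutoff (-1) 1 n) x) \<longlonglongrightarrow> \<omega> (-1) - \<omega> 1"
proof (rule LIMSEQ_I)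
  fix r :: real assume r: "0 < r"
  let ?\<psi> = "interval_cutoff (-1) 1"
  let ?I = "\<lambda>f. LINT x:{-1<..<1}|lborel. f x :: real"
  have sm: "smooth (?\<psi> n)" for n
    by (intro smooth_elementary interval_cutoff_elementary elementary_id)
  have c: "continuous_on {-1..1} (?\<psi> n)" "continuous_on {-1..1} (partial 1 (?\<psi> n))" for n
    using sm by (auto intro: smooth_continuous smooth_continuous_partial)
  obtain P where P: "real_polynomial_function P" "\<And>x. x \<in> {-1..1} \<Longrightarrow> \<bar>\<omega> x - P x\<bar> < r / 8"
    using Stone_Weierstrass_real_polynomial_function[OF compact_Icc \<omega>, of "r / 8"] r by auto
  obtain P' where P': "real_polynomial_function P'" "\<And>x. (P has_real_derivative P' x) (at x)"
    using has_real_derivative_polynomial_function[OF P(1)] by blast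
  have cP: "continuous_on {-1..1} P" "continuous_on {-1..1} P'"
    using P(1) P'(1) by (auto intro!: continuous_on_polymonial_function simp: real_polynomial_function_eq)
  \<comment> \<open>The total variation of a cutoff is at most 2, because each of its two factors is monotone.\<close>
  have tv: "?I (\<lambda>x. \<bar>partial 1 (?\<psi> n) x\<bar>) \<le> 2" for n
  proof -
    obtain d where d: "\<And>y. (smooth_step n has_real_derivative d y) (at y)" "\<And>y. d y \<ge> 0"
      using smooth_step_has_derivative by blast
    have d0: "((\<lambda>x. smooth_step n (x + 1)) has_real_derivative d (x + 1) * 1) (at x)"
      "((\<lambda>x. smooth_step n (1 - x)) has_real_derivative d (1 - x) * (-1)) (at x)" for x
      by (rule DERIV_chain2[OF d(1)], force intro!: derivative_eq_intros)+
    have d1: "((\<lambda>x. smooth_step n (x + 1)) has_real_derivative d (x + 1)) (at x)"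
      "((\<lambda>x. smooth_step n (1 - x)) has_real_derivative - d (1 - x)) (at x)" for x
      using d0(1)[of x] d0(2)[of x] by simp_all
    have "(?\<psi> n has_real_derivative (smooth_step n (x + 1) * (- d (1 - x)) + d (x + 1) * smooth_step n (1 - x))) (at x)" for x
      using DERIV_mult'[OF d1] unfolding interval_cutoff_def[abs_def] by simp
    then have pe: "partial 1 (?\<psi> n) x = d (x + 1) * smooth_step n (1 - x) - smooth_step n (x + 1) * d (1 - x)" for x
      using partial_real by fastforce
    have bd: "\<bar>partial 1 (?\<psi> n) x\<bar> \<le> d (x + 1) + d (1 - x)" for x
    proof -
      have "0 \<le> d (x + 1) * smooth_step n (1 - x)" "d (x + 1) * smooth_step n (1 - x) \<le> d (x + 1)"
        "0 \<le> smooth_step n (x + 1) * d (1 - x)" "smooth_step n (x + 1) * d (1 - x) \<le> d (1 - x)"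
        by (intro mult_nonneg_nonneg mult_left_le mult_left_le_one_le d(2) smooth_step_bounds)+
      then show ?thesis unfolding pe by linarith
    qed
    have dc: "continuous_on UNIV d"
    proof -
      have "smooth (smooth_step n)" using smooth_elementary[OF smooth_step_elementary[OF elementary_id]] .
      then have "continuous_on UNIV (partial 1 (smooth_step n))" by (rule smooth_continuous_partial)
      moreover have "partial 1 (smooth_step n) = d" using partial_real[OF d(1)] by auto
      ultimately show ?thesis by simp
    qed
    have cd: "continuous_on {-1..1} (\<lambda>x. d (x + 1) + d (1 - x))"
      by (intro continuous_intros continuous_on_compose2[OF dc]) auto
    have "?I (\<lambda>x. \<bar>partial 1 (?\<psi> n) x\<bar>) \<le> ?I (\<lambda>x. d (x + 1) + d (1 - x))"
      using bd by (intro set_integral_mono integrable_interval cd continuous_intros c) auto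
    also have "\<dots> = (smooth_step n (1 + 1) - smooth_step n (1 - 1)) - (smooth_step n (-1 + 1) - smooth_step n (1 - (-1)))"
    proof (rule integral_FTC_open_interval[OF _ cd, where F = "\<lambda>x. smooth_step n (x + 1) - smooth_step n (1 - x)"])
      show "((\<lambda>x. smooth_step n (x + 1) - smooth_step n (1 - x)) has_real_derivative d (x + 1) + d (1 - x))
          (at x within {-1..1})" for x
        using DERIV_diff[OF d1(1)[of x] d1(2)[of x]] by (simp add: has_field_derivative_at_within)
    qed simp
    also have "\<dots> \<le> 2" using smooth_step_bounds[of n 2] smooth_step_bounds[of n 0] by simp
    finally show ?thesis .
  qed
  have PI: "?I (\<lambda>x. P x * partial 1 (?\<psi> n) x) = - ?I (\<lambda>x. P' x * ?\<psi> n x)" for n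
  proof -
    have "?\<psi> n \<in> test_interval" using test_interval_cutoff[OF _ elementary_const[of 1], of "-1" 1 n] by simp
    then show ?thesis using weak_partial_classical[of P P'] P'(2) cP
      unfolding weak_partial_def by (auto intro: has_field_derivative_at_within)
  qed
  have "(\<lambda>n. - ?I (\<lambda>x. P' x * ?\<psi> n x)) \<longlonglongrightarrow> - ?I P'"
    by (intro tendsto_minus integral_times_cutoff_tendsto integrable_interval cP)
  moreover have "- ?I P' = P (-1) - P 1"
    using integral_FTC_open_interval[OF _ cP(2) has_field_derivative_at_within[OF P'(2)]] by simp
  ultimately have "(\<lambda>n. ?I (\<lambda>x. P x * partial 1 (?\<psi> n) x)) \<longlonglongrightarrow> P (-1) - P 1"
    by (simp add: PI)
  from LIMSEQ_D[OF this, of "r / 4"] r obtain N where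
    N: "\<And>n. n \<ge> N \<Longrightarrow> \<bar>?I (\<lambda>x. P x * partial 1 (?\<psi> n) x) - (P (-1) - P 1)\<bar> < r / 4" by auto
  show "\<exists>N. \<forall>n\<ge>N. norm (?I (\<lambda>x. \<omega> x * partial 1 (?\<psi> n) x) - (\<omega> (-1) - \<omega> 1)) < r"
  proof (intro exI allI impI)
    fix n assume "n \<ge> N"
    have "?I (\<lambda>x. \<omega> x * partial 1 (?\<psi> n) x) - ?I (\<lambda>x. P x * partial 1 (?\<psi> n) x)
        = ?I (\<lambda>x. (\<omega> x - P x) * partial 1 (?\<psi> n) x)"
      by (subst set_integral_diff(2)[symmetric])
        (auto simp: left_diff_distrib intro!: integrable_interval continuous_intros c cP \<omega>)
    moreover have "\<bar>?I (\<lambda>x. (\<omega> x - P x) * partial 1 (?\<psi> n) x)\<bar> \<le> ?I (\<lambda>x. r / 8 * \<bar>partial 1 (?\<psi> n) x\<bar>)"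
    proof (intro abs_set_integral_le integrable_interval continuous_intros c cP \<omega>)
      fix x :: real assume "x \<in> {-1<..<1}"
      then have "\<bar>\<omega> x - P x\<bar> \<le> r / 8" using P(2)[of x] by auto
      then show "\<bar>(\<omega> x - P x) * partial 1 (?\<psi> n) x\<bar> \<le> r / 8 * \<bar>partial 1 (?\<psi> n) x\<bar>"
        unfolding abs_mult by (rule mult_right_mono) simp
    qed
    moreover have "?I (\<lambda>x. r / 8 * \<bar>partial 1 (?\<psi> n) x\<bar>) \<le> r / 4"
      using tv[of n] r mult_left_mono[OF tv[of n], of "r / 8"] by simp
    moreover have "\<bar>\<omega> (-1) - P (-1)\<bar> < r / 8" "\<bar>\<omega> 1 - P 1\<bar> < r / 8" using P(2) by auto
    ultimately show "norm (?I (\<lambda>x. \<omega> x * partial 1 (?\<psi> n) x) - (\<omega> (-1) - \<omega> 1)) < r"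
      using N[OF \<open>n \<ge> N\<close>] unfolding real_norm_def by linarith
  qed
qed

text \<open>
  Test functions vanish near the end points and do not see boundary terms. Testing with \<open>h\<close> times a
  cutoff and passing to the limit recovers them from the derivative of the cutoff.
\<close>

lemma weak_integration_by_parts:
  assumes v: "continuous_on {-1..1} v" and g: "g \<in> L2 {-1<..<1}"
    and w: "weak_partial {-1<..<1} test_interval 1 v g" and h: "h \<in> elementary"
  shows "(LINT x:{-1<..<1}|lborel. g x * h x)
    = v 1 * h 1 - v (-1) * h (-1) - (LINT x:{-1<..<1}|lborel. v x * partial 1 h x)"
proof -
  let ?\<psi> = "interval_cutoff (-1) 1"
  let ?I = "\<lambda>f. LINT x:{-1<..<1}|lborel. f x :: real"
  have sm: "smooth (?\<psi> n)" "smooth h" for n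
    by (intro smooth_elementary interval_cutoff_elementary elementary_id h)+
  have c: "continuous_on {-1..1} (?\<psi> n)" "continuous_on {-1..1} (partial 1 (?\<psi> n))"
    "continuous_on {-1..1} h" "continuous_on {-1..1} (partial 1 h)" for n
    using sm by (auto intro: smooth_continuous smooth_continuous_partial)
  have "?I (\<lambda>x. v x * h x * partial 1 (?\<psi> n) x)
      = - ?I (\<lambda>x. g x * h x * ?\<psi> n x) - ?I (\<lambda>x. v x * partial 1 h x * ?\<psi> n x)" for n
  proof -
    have "(\<lambda>x. h x * ?\<psi> n x) \<in> test_interval" using h by (intro test_interval_cutoff) auto
    then have "?I (\<lambda>x. v x * partial 1 (\<lambda>x. h x * ?\<psi> n x) x) = - ?I (\<lambda>x. g x * (h x * ?\<psi> n x))"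
      using w unfolding weak_partial_def by blast
    moreover have "partial 1 (\<lambda>x. h x * ?\<psi> n x) = (\<lambda>x. h x * partial 1 (?\<psi> n) x + partial 1 h x * ?\<psi> n x)"
      using sm by (auto simp: partial_mult smooth_differentiable)
    moreover have "?I (\<lambda>x. v x * h x * partial 1 (?\<psi> n) x + v x * partial 1 h x * ?\<psi> n x)
        = ?I (\<lambda>x. v x * h x * partial 1 (?\<psi> n) x) + ?I (\<lambda>x. v x * partial 1 h x * ?\<psi> n x)"
      by (intro set_integral_add integrable_interval continuous_intros c v)
    ultimately show ?thesis by (simp add: distrib_left mult.assoc)
  qed
  moreover have "(\<lambda>n. - ?I (\<lambda>x. g x * h x * ?\<psi> n x) - ?I (\<lambda>x. v x * partial 1 h x * ?\<psi> n x))
      \<longlonglongrightarrow> - ?I (\<lambda>x. g x * h x) - ?I (\<lambda>x. v x * partial 1 h x)"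
    by (intro tendsto_diff tendsto_minus integral_times_cutoff_tendsto L2_mult g L2_interval
        integrable_interval continuous_intros c v)
  ultimately have "(\<lambda>n. ?I (\<lambda>x. v x * h x * partial 1 (?\<psi> n) x))
      \<longlonglongrightarrow> - ?I (\<lambda>x. g x * h x) - ?I (\<lambda>x. v x * partial 1 h x)" by simp
  moreover have "(\<lambda>n. ?I (\<lambda>x. v x * h x * partial 1 (?\<psi> n) x)) \<longlonglongrightarrow> v (-1) * h (-1) - v 1 * h 1"
    by (rule cutoff_derivative_tendsto) (intro continuous_intros c v)
  ultimately show ?thesis using LIMSEQ_unique by fastforce
qed

section \<open>The critical viscosity\<close>

definition energy :: "real \<Rightarrow> (real \<Rightarrow> real) \<Rightarrow> real" where
  "energy k \<phi> = (LINT x:{-1<..<1}|lborel. (D2 \<phi> x)\<^sup>2 + 2 * k\<^sup>2 * (D1 \<phi> x)\<^sup>2 + k ^ 4 * (\<phi> x)\<^sup>2)"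

text \<open>
  The classical derivative is a weak one, so by uniqueness it inherits a weak derivative from \<open>\<phi>\<close>;
  this makes the chosen function \<open>D2 \<phi>\<close> meaningful.
\<close>

lemma H2_tilde_facts:
  assumes "\<phi> \<in> H2_tilde"
  shows "\<And>x. x \<in> {-1..1} \<Longrightarrow> (\<phi> has_real_derivative D1 \<phi> x) (at x within {-1..1})"
    "continuous_on {-1..1} \<phi>" "continuous_on {-1..1} (D1 \<phi>)" "\<phi> 1 = 0" "\<phi> (-1) = 0"
    "D2 \<phi> \<in> L2 {-1<..<1}" "weak_partial {-1<..<1} test_interval 1 (D1 \<phi>) (D2 \<phi>)"
    "weak_partial {-1<..<1} test_interval 1 \<phi> (D1 \<phi>)"
proof -
  show d: "(\<phi> has_real_derivative D1 \<phi> x) (at x within {-1..1})" if "x \<in> {-1..1}" for x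
  proof -
    have "\<phi> differentiable (at x within {-1..1})"
      using assms that by (auto simp: H2_tilde_def differentiable_on_def)
    then show ?thesis
      by (simp add: D1_def has_real_derivative_iff_has_vector_derivative vector_derivative_works)
  qed
  show c: "continuous_on {-1..1} \<phi>" using d by (rule DERIV_continuous_on)
  show c1: "continuous_on {-1..1} (D1 \<phi>)" and "\<phi> 1 = 0" "\<phi> (-1) = 0"
    using assms by (auto simp: H2_tilde_def)
  show w1: "weak_partial {-1<..<1} test_interval 1 \<phi> (D1 \<phi>)"
    using d c1 by (rule weak_partial_classical)
  obtain g g' where g: "g \<in> L2 {-1<..<1}" "weak_partial {-1<..<1} test_interval 1 \<phi> g"
    "g' \<in> L2 {-1<..<1}" "weak_partial {-1<..<1} test_interval 1 g g'"
    using assms by (auto simp: H2_tilde_def numeral_2_eq_2)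
  have "AE x in lborel. x \<in> {-1<..<1} \<longrightarrow> D1 \<phi> x = g x"
    using interval.weak_partial_unique[OF w1 g(2) L2_interval[OF c1] g(1)] .
  then have "weak_partial {-1<..<1} test_interval 1 (D1 \<phi>) g'"
    using g(4) interval.weak_partial_cong[OF _ L2_interval[OF c1] g(1)] by simp
  from interval.wpartial[OF this g(3)]
  show "D2 \<phi> \<in> L2 {-1<..<1}" "weak_partial {-1<..<1} test_interval 1 (D1 \<phi>) (D2 \<phi>)"
    by (auto simp: D2_def)
qed

lemma elementary_H2_tilde:
  assumes "\<eta> \<in> elementary" "\<eta> 1 = 0" "\<eta> (-1) = 0"
  shows "\<eta> \<in> H2_tilde" "\<And>x. x \<in> {-1..1} \<Longrightarrow> D1 \<eta> x = partial 1 \<eta> x"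
    "AE x in lborel. x \<in> {-1<..<1} \<longrightarrow> D2 \<eta> x = partial 1 (partial 1 \<eta>) x"
proof -
  have s: "smooth \<eta>" "smooth (partial 1 \<eta>)" using assms(1) by (auto intro: smooth_elementary elementary_partial)
  have D1: "D1 \<eta> x = partial 1 \<eta> x" if "x \<in> {-1..1}" for x
    unfolding D1_def using that smooth_has_real_derivative[OF s(1), of x]
    by (intro vector_derivative_at_within_ivl) (auto simp: has_real_derivative_iff_has_vector_derivative)
  then show "\<And>x. x \<in> {-1..1} \<Longrightarrow> D1 \<eta> x = partial 1 \<eta> x" .
  have c: "continuous_on {-1..1} (D1 \<eta>)"
    by (rule continuous_on_cong[OF refl D1, THEN iffD2, OF _ smooth_continuous[OF s(2)]])
  show "\<eta> \<in> H2_tilde"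
    unfolding H2_tilde_def using s c assms interval.represents_sobolev[OF interval.represents_self]
    by (auto intro!: differentiable_at_imp_differentiable_on smooth_differentiable simp del: sobolev.simps)
  have "interval.represents (D1 \<eta>) (partial 1 \<eta>)"
    unfolding interval.represents_def using s D1 c by (auto intro: L2_interval)
  from interval.represents_wpartial[OF this, of 1]
  show "AE x in lborel. x \<in> {-1<..<1} \<longrightarrow> D2 \<eta> x = partial 1 (partial 1 \<eta>) x"
    by (auto simp: interval.represents_def D2_def)
qed

lemma integral_D2_times:
  assumes "\<phi> \<in> H2_tilde" "h \<in> elementary"
  shows "(LINT x:{-1<..<1}|lborel. D2 \<phi> x * h x)
    = D1 \<phi> 1 * h 1 - D1 \<phi> (-1) * h (-1) - (LINT x:{-1<..<1}|lborel. D1 \<phi> x * partial 1 h x)"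
  using weak_integration_by_parts[OF _ _ _ assms(2)] H2_tilde_facts[OF assms(1)] by blast

lemma integral_D1_times:
  assumes "\<phi> \<in> H2_tilde" "h \<in> elementary"
  shows "(LINT x:{-1<..<1}|lborel. D1 \<phi> x * h x) = - (LINT x:{-1<..<1}|lborel. \<phi> x * partial 1 h x)"
  using weak_integration_by_parts[OF _ _ _ assms(2), of \<phi> "D1 \<phi>"] H2_tilde_facts[OF assms(1)]
  by (simp add: L2_interval)

text \<open>
  This is \<open>\<integral> (f - h)\<^sup>2 \<ge> 0\<close>. With \<open>h\<close> at hand explicitly it replaces the Cauchy-Schwarz inequality and
  projections.
\<close>

lemma integral_sq_ge_linear:
  assumes "f \<in> L2 D" "h \<in> L2 D"
  shows "(LINT x:D|lborel. (f x)\<^sup>2) \<ge> 2 * (LINT x:D|lborel. f x * h x) - (LINT x:D|lborel. (h x)\<^sup>2)"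
proof -
  have i: "set_integrable lborel D (\<lambda>x. (f x)\<^sup>2)" "set_integrable lborel D (\<lambda>x. (h x)\<^sup>2)"
    "set_integrable lborel D (\<lambda>x. f x * h x)" using assms L2_mult[OF assms] by (auto simp: L2_def)
  have "2 * (LINT x:D|lborel. f x * h x) - (LINT x:D|lborel. (h x)\<^sup>2)
      = (LINT x:D|lborel. 2 * (f x * h x) - (h x)\<^sup>2)"
    using i by (subst set_integral_diff(2)) auto
  also have "\<dots> \<le> (LINT x:D|lborel. (f x)\<^sup>2)"
  proof (rule set_integral_mono)
    show "2 * (f x * h x) - (h x)\<^sup>2 \<le> (f x)\<^sup>2" for x
      using zero_le_power2[of "f x - h x"] by (simp add: power2_diff)
  qed (use i in auto)
  finally show ?thesis .
qed

lemma energy_split: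
  assumes "\<phi> \<in> H2_tilde"
  shows "energy k \<phi> = (LINT x:{-1<..<1}|lborel. (D2 \<phi> x)\<^sup>2)
    + 2 * k\<^sup>2 * (LINT x:{-1<..<1}|lborel. (D1 \<phi> x)\<^sup>2) + k ^ 4 * (LINT x:{-1<..<1}|lborel. (\<phi> x)\<^sup>2)"
proof -
  note f = H2_tilde_facts[OF assms]
  have i: "set_integrable lborel {-1<..<1} (\<lambda>x. (D2 \<phi> x)\<^sup>2)"
    "set_integrable lborel {-1<..<1} (\<lambda>x. (D1 \<phi> x)\<^sup>2)"
    "set_integrable lborel {-1<..<1} (\<lambda>x. (\<phi> x)\<^sup>2)"
    using f(6) L2_interval[OF f(3)] L2_interval[OF f(2)] by (auto simp: L2_def)
  then show ?thesis unfolding energy_def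
    by (simp add: set_integral_add(2) set_integral_add(1))
qed

lemma set_integral_sq_nonneg: "0 \<le> (LINT x:D|lborel. (f x :: real)\<^sup>2)"
  unfolding set_lebesgue_integral_def by (rule integral_nonneg_AE) auto

lemma integral_D2_sq_le_energy:
  "\<phi> \<in> H2_tilde \<Longrightarrow> (LINT x:{-1<..<1}|lborel. (D2 \<phi> x)\<^sup>2) \<le> energy k \<phi>"
  by (simp add: energy_split set_integral_sq_nonneg)

lemma partial_affine: "partial 1 (\<lambda>x::real. a + b * x) = (\<lambda>x. b)"
  by (intro ext partial_real) (auto intro!: derivative_eq_intros)

text \<open>
  Since \<open>\<integral> \<phi>' = 0\<close>, pairing \<open>\<phi>''\<close> with an affine function leaves only the boundary derivatives. This
  converts the \<open>L\<^sup>2\<close> norm of \<open>\<phi>''\<close> into bounds on them.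
\<close>

lemma integral_D2_affine_bound:
  assumes "\<phi> \<in> H2_tilde"
  shows "(LINT x:{-1<..<1}|lborel. (D2 \<phi> x)\<^sup>2)
    \<ge> 2 * (D1 \<phi> 1 * (a + b) - D1 \<phi> (-1) * (a - b)) - (2 * a\<^sup>2 + 2 / 3 * b\<^sup>2)"
proof -
  note f = H2_tilde_facts[OF assms]
  have e: "(\<lambda>x. a + b * x) \<in> elementary" "(\<lambda>x. b) \<in> elementary" for a b :: real
    by (intro elementary_add elementary_mult elementary_const elementary_id)+
  have "(LINT x:{-1<..<1}|lborel. D1 \<phi> x) = 0"
    using integral_FTC_open_interval[OF _ f(3) f(1)] f(4,5) by simp
  then have "(LINT x:{-1<..<1}|lborel. D2 \<phi> x * (a + b * x)) = D1 \<phi> 1 * (a + b) - D1 \<phi> (-1) * (a - b)"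
    using integral_D2_times[OF assms e(1), of a b] by (simp add: partial_affine)
  moreover have "(LINT x:{-1<..<1}|lborel. (a + b * x)\<^sup>2) = 2 * a\<^sup>2 + 2 / 3 * b\<^sup>2"
  proof -
    have "(LINT x:{-1<..<1}|lborel. (a + b * x)\<^sup>2)
        = (a\<^sup>2 * 1 + a * b * 1\<^sup>2 + b\<^sup>2 / 3 * 1^3) - (a\<^sup>2 * (-1) + a * b * (-1)\<^sup>2 + b\<^sup>2 / 3 * (-1)^3)"
      by (rule integral_FTC_open_interval[where F = "\<lambda>x. a\<^sup>2 * x + a * b * x\<^sup>2 + b\<^sup>2 / 3 * x^3"])
        (auto intro!: derivative_eq_intros continuous_intros simp: power2_eq_square algebra_simps)
    then show ?thesis by (simp add: power3_eq_cube)
  qed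
  ultimately show ?thesis
    using integral_sq_ge_linear[OF f(6) L2_interval, of "\<lambda>x. a + b * x"]
    by (simp add: continuous_intros)
qed

text \<open>
  The affine functions used are proportional to \<open>1 + x\<close>, \<open>1 - x\<close> and \<open>1\<close>, with the factors that
  optimise the preceding bound.
\<close>

lemma boundary_derivative_bounds:
  assumes "\<phi> \<in> H2_tilde"
  shows "(D1 \<phi> 1)\<^sup>2 \<le> (LINT x:{-1<..<1}|lborel. (D2 \<phi> x)\<^sup>2)"
    "(D1 \<phi> (-1))\<^sup>2 \<le> (LINT x:{-1<..<1}|lborel. (D2 \<phi> x)\<^sup>2)"
    "(D1 \<phi> 1 - D1 \<phi> (-1))\<^sup>2 / 2 \<le> (LINT x:{-1<..<1}|lborel. (D2 \<phi> x)\<^sup>2)"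
proof -
  let ?p = "D1 \<phi> 1" and ?m = "D1 \<phi> (-1)"
  have "2 * (?p * (3 / 4 * ?p + 3 / 4 * ?p) - ?m * (3 / 4 * ?p - 3 / 4 * ?p))
      - (2 * (3 / 4 * ?p)\<^sup>2 + 2 / 3 * (3 / 4 * ?p)\<^sup>2) = 3 / 2 * ?p\<^sup>2"
    by (simp add: power2_eq_square)
  then show "?p\<^sup>2 \<le> (LINT x:{-1<..<1}|lborel. (D2 \<phi> x)\<^sup>2)"
    using integral_D2_affine_bound[OF assms, of "3 / 4 * ?p" "3 / 4 * ?p"] zero_le_power2[of ?p] by linarith
  have "2 * (?p * (- 3 / 4 * ?m + 3 / 4 * ?m) - ?m * (- 3 / 4 * ?m - 3 / 4 * ?m))
      - (2 * (- 3 / 4 * ?m)\<^sup>2 + 2 / 3 * (3 / 4 * ?m)\<^sup>2) = 3 / 2 * ?m\<^sup>2"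
    by (simp add: power2_eq_square)
  then show "?m\<^sup>2 \<le> (LINT x:{-1<..<1}|lborel. (D2 \<phi> x)\<^sup>2)"
    using integral_D2_affine_bound[OF assms, of "- 3 / 4 * ?m" "3 / 4 * ?m"] zero_le_power2[of ?m] by linarith
  have "2 * (?p * ((?p - ?m) / 2 + 0) - ?m * ((?p - ?m) / 2 - 0))
      - (2 * ((?p - ?m) / 2)\<^sup>2 + 2 / 3 * 0\<^sup>2) = (?p - ?m)\<^sup>2 / 2"
    by (simp add: power2_eq_square field_simps)
  then show "(?p - ?m)\<^sup>2 / 2 \<le> (LINT x:{-1<..<1}|lborel. (D2 \<phi> x)\<^sup>2)"
    using integral_D2_affine_bound[OF assms, of "(?p - ?m) / 2" 0] by linarith
qed

text \<open>
  For \<open>k \<noteq> 0\<close> these are the solutions of \<open>(d\<^sup>2/dx\<^sup>2 - k\<^sup>2)\<^sup>2 \<eta> = 0\<close>, the Euler-Lagrange equation of the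
  energy. With \<open>c = d = 0\<close> they solve \<open>U'' = k\<^sup>2 U\<close>, which is how the profiles of growing shear flows
  arise.
\<close>

definition hyperbolic :: "real \<Rightarrow> real \<Rightarrow> real \<Rightarrow> real \<Rightarrow> real \<Rightarrow> real \<Rightarrow> real" where
  "hyperbolic k a b c d x = a * cosh (k * x) + b * sinh (k * x) + c * (x * sinh (k * x)) + d * (x * cosh (k * x))"

lemma hyperbolic_derivative:
  "(hyperbolic k a b c d has_real_derivative hyperbolic k (k * b + d) (k * a + c) (k * d) (k * c) x) (at x)"
  unfolding hyperbolic_def by (auto intro!: derivative_eq_intros simp: algebra_simps)

lemma partial_hyperbolic: "partial 1 (hyperbolic k a b c d) = hyperbolic k (k * b + d) (k * a + c) (k * d) (k * c)"
  using hyperbolic_derivative by (intro ext partial_real)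

lemma hyperbolic_elementary: "f \<in> elementary \<Longrightarrow> (\<lambda>x. hyperbolic k a b c d (f x)) \<in> elementary"
proof -
  assume f: "f \<in> elementary"
  then have "(\<lambda>x. k * f x) \<in> elementary" by (intro elementary_mult elementary_const)
  with outer_fun.intros have "(\<lambda>x. cosh (k * f x)) \<in> elementary" "(\<lambda>x. sinh (k * f x)) \<in> elementary"
    by (auto intro: elementary_comp[of cosh] elementary_comp[of sinh])
  then show ?thesis
    unfolding hyperbolic_def by (intro elementary_add elementary_mult elementary_const f)
qed

lemma hyperbolic_biharmonic:
  assumes "\<eta> = hyperbolic k a b c d"
  shows "partial 1 (partial 1 (partial 1 (partial 1 \<eta>))) x - 2 * k\<^sup>2 * partial 1 (partial 1 \<eta>) x + k ^ 4 * \<eta> x = 0"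
  unfolding assms partial_hyperbolic hyperbolic_def by algebra

text \<open>
  The bilinear form of the energy reduces to boundary terms when one argument solves the
  Euler-Lagrange equation, by integrating twice by parts.
\<close>

lemma biharmonic_pairing:
  assumes \<phi>: "\<phi> \<in> H2_tilde" and \<eta>: "\<eta> = hyperbolic k a b c d"
  shows "(LINT x:{-1<..<1}|lborel. D2 \<phi> x * partial 1 (partial 1 \<eta>) x)
      + 2 * k\<^sup>2 * (LINT x:{-1<..<1}|lborel. D1 \<phi> x * partial 1 \<eta> x)
      + k ^ 4 * (LINT x:{-1<..<1}|lborel. \<phi> x * \<eta> x)
    = D1 \<phi> 1 * partial 1 (partial 1 \<eta>) 1 - D1 \<phi> (-1) * partial 1 (partial 1 \<eta>) (-1)"
proof -
  let ?I = "\<lambda>f. LINT x:{-1<..<1}|lborel. f x :: real"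
  let ?d = "partial (1::real)"
  note f = H2_tilde_facts[OF \<phi>]
  have e: "\<eta> \<in> elementary" unfolding \<eta> using hyperbolic_elementary[OF elementary_id] .
  have c: "continuous_on {-1..1} g" if "g \<in> elementary" for g :: "real \<Rightarrow> real"
    using that by (intro smooth_continuous smooth_elementary)
  have "?I (\<lambda>x. \<phi> x * ?d (?d (?d (?d \<eta>))) x) - 2 * k\<^sup>2 * ?I (\<lambda>x. \<phi> x * ?d (?d \<eta>) x) + k ^ 4 * ?I (\<lambda>x. \<phi> x * \<eta> x)
      = ?I (\<lambda>x. \<phi> x * ?d (?d (?d (?d \<eta>))) x - 2 * k\<^sup>2 * (\<phi> x * ?d (?d \<eta>) x) + k ^ 4 * (\<phi> x * \<eta> x))"
    by (subst set_integral_add(2) set_integral_diff(2);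
        (intro integrable_interval continuous_intros f c elementary_partial e)?; simp?)+
  also have "\<dots> = ?I (\<lambda>x. \<phi> x * (?d (?d (?d (?d \<eta>))) x - 2 * k\<^sup>2 * ?d (?d \<eta>) x + k ^ 4 * \<eta> x))"
    by (simp add: algebra_simps)
  also have "\<dots> = 0" by (simp add: hyperbolic_biharmonic[OF \<eta>])
  finally show ?thesis
    using integral_D2_times[OF \<phi> elementary_partial[OF elementary_partial[OF e]], of 1 1]
      integral_D1_times[OF \<phi> elementary_partial[OF elementary_partial[OF elementary_partial[OF e]]], of 1 1 1]
      integral_D1_times[OF \<phi> elementary_partial[OF e], of 1]
    by simp
qed

lemma energy_hyperbolic:
  assumes \<eta>: "\<eta> = hyperbolic k a b c d" "\<eta> 1 = 0" "\<eta> (-1) = 0"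
  shows "energy k \<eta> = partial 1 \<eta> 1 * partial 1 (partial 1 \<eta>) 1 - partial 1 \<eta> (-1) * partial 1 (partial 1 \<eta>) (-1)"
    and "(LINT x:{-1<..<1}|lborel. (partial 1 (partial 1 \<eta>) x)\<^sup>2)
      + 2 * k\<^sup>2 * (LINT x:{-1<..<1}|lborel. (partial 1 \<eta> x)\<^sup>2)
      + k ^ 4 * (LINT x:{-1<..<1}|lborel. (\<eta> x)\<^sup>2) = energy k \<eta>"
proof -
  have e: "\<eta> \<in> elementary" unfolding \<eta>(1) using hyperbolic_elementary[OF elementary_id] .
  note h = elementary_H2_tilde[OF e \<eta>(2,3)]
  have c: "g \<in> L2 {-1<..<1}" if "g \<in> elementary" for g :: "real \<Rightarrow> real"
    using that by (intro L2_interval smooth_continuous smooth_elementary)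
  have d1: "(LINT x:{-1<..<1}|lborel. D1 \<eta> x * g x) = (LINT x:{-1<..<1}|lborel. partial 1 \<eta> x * g x)" for g
    by (rule set_lebesgue_integral_cong) (auto simp: h(2))
  have d1': "(LINT x:{-1<..<1}|lborel. (D1 \<eta> x)\<^sup>2) = (LINT x:{-1<..<1}|lborel. (partial 1 \<eta> x)\<^sup>2)"
    by (rule set_lebesgue_integral_cong) (auto simp: h(2))
  have d2: "(LINT x:{-1<..<1}|lborel. D2 \<eta> x * partial 1 (partial 1 \<eta>) x) = (LINT x:{-1<..<1}|lborel. (partial 1 (partial 1 \<eta>) x)\<^sup>2)"
    "(LINT x:{-1<..<1}|lborel. (D2 \<eta> x)\<^sup>2) = (LINT x:{-1<..<1}|lborel. (partial 1 (partial 1 \<eta>) x)\<^sup>2)"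
    unfolding power2_eq_square
    by (rule set_integral_cong_AE_L2; (rule h(3) c elementary_partial e H2_tilde_facts[OF h(1)])?; simp?; intro elementary_partial e)+
  show e2: "(LINT x:{-1<..<1}|lborel. (partial 1 (partial 1 \<eta>) x)\<^sup>2)
      + 2 * k\<^sup>2 * (LINT x:{-1<..<1}|lborel. (partial 1 \<eta> x)\<^sup>2)
      + k ^ 4 * (LINT x:{-1<..<1}|lborel. (\<eta> x)\<^sup>2) = energy k \<eta>"
    unfolding energy_split[OF h(1)] d2 d1' ..
  show "energy k \<eta> = partial 1 \<eta> 1 * partial 1 (partial 1 \<eta>) 1 - partial 1 \<eta> (-1) * partial 1 (partial 1 \<eta>) (-1)"
    using biharmonic_pairing[OF h(1) \<eta>(1)] unfolding e2[symmetric] d2 d1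
    by (simp add: power2_eq_square h(2))
qed

text \<open>
  In the expansion of the energy of \<open>\<phi> - \<eta>\<close> the mixed term depends on the boundary derivatives
  alone, and these agree for \<open>\<phi>\<close> and \<open>\<eta>\<close>.
\<close>

lemma energy_minimal:
  assumes \<phi>: "\<phi> \<in> H2_tilde" and \<eta>: "\<eta> = hyperbolic k a b c d" "\<eta> 1 = 0" "\<eta> (-1) = 0"
    and bc: "D1 \<phi> 1 = partial 1 \<eta> 1" "D1 \<phi> (-1) = partial 1 \<eta> (-1)"
  shows "energy k \<eta> \<le> energy k \<phi>"
proof -
  let ?I = "\<lambda>f. LINT x:{-1<..<1}|lborel. f x :: real"
  note f = H2_tilde_facts[OF \<phi>]
  have e: "\<eta> \<in> elementary" unfolding \<eta>(1) using hyperbolic_elementary[OF elementary_id] .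
  have c: "g \<in> L2 {-1<..<1}" if "g \<in> elementary" for g :: "real \<Rightarrow> real"
    using that by (intro L2_interval smooth_continuous smooth_elementary)
  let ?d = "partial (1::real)"
  have i2: "?I (\<lambda>x. (D2 \<phi> x)\<^sup>2) \<ge> 2 * ?I (\<lambda>x. D2 \<phi> x * ?d (?d \<eta>) x) - ?I (\<lambda>x. (?d (?d \<eta>) x)\<^sup>2)"
    by (intro integral_sq_ge_linear f c elementary_partial e)
  have "?I (\<lambda>x. (D1 \<phi> x)\<^sup>2) \<ge> 2 * ?I (\<lambda>x. D1 \<phi> x * ?d \<eta> x) - ?I (\<lambda>x. (?d \<eta> x)\<^sup>2)"
    by (intro integral_sq_ge_linear L2_interval[OF f(3)] c elementary_partial e)
  then have i1: "2 * k\<^sup>2 * ?I (\<lambda>x. (D1 \<phi> x)\<^sup>2) \<ge> 2 * (2 * k\<^sup>2 * ?I (\<lambda>x. D1 \<phi> x * ?d \<eta> x)) - 2 * k\<^sup>2 * ?I (\<lambda>x. (?d \<eta> x)\<^sup>2)"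
    using mult_left_mono[of _ _ "2 * k\<^sup>2"] by (fastforce simp: algebra_simps)
  have "?I (\<lambda>x. (\<phi> x)\<^sup>2) \<ge> 2 * ?I (\<lambda>x. \<phi> x * \<eta> x) - ?I (\<lambda>x. (\<eta> x)\<^sup>2)"
    by (intro integral_sq_ge_linear L2_interval[OF f(2)] c e)
  then have i0: "k ^ 4 * ?I (\<lambda>x. (\<phi> x)\<^sup>2) \<ge> 2 * (k ^ 4 * ?I (\<lambda>x. \<phi> x * \<eta> x)) - k ^ 4 * ?I (\<lambda>x. (\<eta> x)\<^sup>2)"
    using mult_left_mono[of _ _ "k ^ 4"] by (fastforce simp: algebra_simps)
  show ?thesis
    using i2 i1 i0 biharmonic_pairing[OF \<phi> \<eta>(1)] energy_hyperbolic[OF \<eta>] energy_split[OF \<phi>, of k]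
    unfolding bc by linarith
qed

text \<open>
  The mean value theorem in this form shows below that \<open>sinh k cosh k \<noteq> k\<close>.
\<close>

lemma sinh_mean_value: "\<exists>z. sinh k = k * cosh z" for k :: real
proof -
  have pos: "\<exists>z. sinh k = k * cosh z" if "k > 0" for k :: real
    using MVT2[of 0 k sinh cosh] that by (force intro!: derivative_eq_intros)
  show ?thesis
    using pos[of k] pos[of "- k"] by (cases "k = 0"; cases "k > 0") auto
qed

text \<open>
  Every pair of boundary derivatives is attained by a biharmonic function: the even and the odd
  solution that vanish at the end points have linearly independent boundary derivatives. By parity the
  minimal energy has no mixed term in \<open>p - m\<close> and \<open>p + m\<close>.
\<close>

lemma minimizer_exists:
  assumes "k \<noteq> 0"
  shows "\<exists>A B. \<forall>p m. \<exists>\<eta>\<in>H2_tilde. D1 \<eta> 1 = p \<and> D1 \<eta> (-1) = m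
    \<and> energy k \<eta> = A * (p - m)\<^sup>2 + B * (p + m)\<^sup>2
    \<and> (\<forall>\<phi>\<in>H2_tilde. D1 \<phi> 1 = p \<longrightarrow> D1 \<phi> (-1) = m \<longrightarrow> energy k \<eta> \<le> energy k \<phi>)"
proof -
  define ck sk where "ck = cosh k" "sk = sinh k"
  have id: "ck\<^sup>2 = 1 + sk\<^sup>2" by (simp add: ck_sk_def cosh_square_eq)
  \<comment> \<open>Here \<open>\<alpha>\<close> multiplies the even and \<open>\<beta>\<close> the odd solution that vanishes at both end points.\<close>
  define e where "e \<alpha> \<beta> = hyperbolic k (- \<alpha> * sk) (- \<beta> * ck) (\<alpha> * ck) (\<beta> * sk)" for \<alpha> \<beta>
  define E1 O1 where "E1 = sk * ck + k" "O1 = sk * ck - k"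
  define E2 O2 where "E2 = partial 1 (partial 1 (e 1 0)) 1" "O2 = partial 1 (partial 1 (e 0 1)) 1"
  have bd: "e \<alpha> \<beta> 1 = 0" "e \<alpha> \<beta> (-1) = 0" for \<alpha> \<beta>
    by (simp_all add: e_def hyperbolic_def ck_sk_def[symmetric] algebra_simps)
  have d1: "partial 1 (e \<alpha> \<beta>) 1 = \<alpha> * E1 + \<beta> * O1" "partial 1 (e \<alpha> \<beta>) (-1) = - \<alpha> * E1 + \<beta> * O1" for \<alpha> \<beta>
    using id unfolding e_def partial_hyperbolic
    by (simp_all add: hyperbolic_def ck_sk_def[symmetric] E1_O1_def power2_eq_square) algebra+
  have d2: "partial 1 (partial 1 (e \<alpha> \<beta>)) 1 = \<alpha> * E2 + \<beta> * O2"
    "partial 1 (partial 1 (e \<alpha> \<beta>)) (-1) = \<alpha> * E2 - \<beta> * O2" for \<alpha> \<beta>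
    unfolding e_def partial_hyperbolic E2_O2_def
    by (simp_all add: hyperbolic_def ck_sk_def[symmetric] algebra_simps)
  obtain z where z: "sk = k * cosh z" using sinh_mean_value unfolding ck_sk_def by blast
  have "cosh k > 1" using assms by (simp add: cosh_real_ge_1 order_le_neq_trans)
  then have "cosh z * cosh k > 1" using cosh_real_ge_1[of z] by (smt (verit) mult_le_cancel_right1)
  moreover have "E1 = k * (cosh z * cosh k + 1)" "O1 = k * (cosh z * cosh k - 1)"
    by (simp_all add: E1_O1_def z ck_sk_def(1) algebra_simps)
  ultimately have nz: "E1 \<noteq> 0" "O1 \<noteq> 0" using assms by auto
  show ?thesis
  proof (intro exI allI)
    fix p m :: real
    define \<alpha> \<beta> where "\<alpha> = (p - m) / (2 * E1)" "\<beta> = (p + m) / (2 * O1)"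
    let ?\<eta> = "e \<alpha> \<beta>"
    have el: "?\<eta> \<in> elementary" unfolding e_def using hyperbolic_elementary[OF elementary_id] .
    note h = elementary_H2_tilde[OF el bd(1)[of \<alpha> \<beta>] bd(2)[of \<alpha> \<beta>]]
    have "\<alpha> * E1 = (p - m) / 2" "\<beta> * O1 = (p + m) / 2" using nz by (simp_all add: \<alpha>_\<beta>_def)
    then have pm: "partial 1 ?\<eta> 1 = p" "partial 1 ?\<eta> (-1) = m" unfolding d1 by (simp_all add: field_simps)
    have "energy k ?\<eta> = p * (\<alpha> * E2 + \<beta> * O2) - m * (\<alpha> * E2 - \<beta> * O2)"
      using energy_hyperbolic(1)[OF e_def[of \<alpha> \<beta>] bd(1)[of \<alpha> \<beta>] bd(2)[of \<alpha> \<beta>]] unfolding pm d2 .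
    also have "\<dots> = (p - m) * (\<alpha> * E2) + (p + m) * (\<beta> * O2)" by (simp add: algebra_simps)
    also have "\<dots> = E2 / (2 * E1) * (p - m)\<^sup>2 + O2 / (2 * O1) * (p + m)\<^sup>2"
      by (simp add: \<alpha>_\<beta>_def power2_eq_square mult_ac)
    finally have en: "energy k ?\<eta> = E2 / (2 * E1) * (p - m)\<^sup>2 + O2 / (2 * O1) * (p + m)\<^sup>2" .
    show "\<exists>\<eta>\<in>H2_tilde. D1 \<eta> 1 = p \<and> D1 \<eta> (-1) = m
      \<and> energy k \<eta> = E2 / (2 * E1) * (p - m)\<^sup>2 + O2 / (2 * O1) * (p + m)\<^sup>2
      \<and> (\<forall>\<phi>\<in>H2_tilde. D1 \<phi> 1 = p \<longrightarrow> D1 \<phi> (-1) = m \<longrightarrow> energy k \<eta> \<le> energy k \<phi>)"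
      using h(1) h(2)[of 1] h(2)[of "-1"] pm en energy_minimal[OF _ e_def[of \<alpha> \<beta>] bd(1)[of \<alpha> \<beta>] bd(2)[of \<alpha> \<beta>]] by (intro bexI[of _ ?\<eta>]) auto
  qed
qed

lemma rayleigh_energy:
  "rayleigh \<xi>m \<xi>p k \<phi> = (\<xi>m * (D1 \<phi> (-1))\<^sup>2 + \<xi>p * (D1 \<phi> 1)\<^sup>2) / energy k \<phi>"
  by (simp add: rayleigh_def energy_def)

text \<open>
  The quotient is at most the larger of \<open>0\<close> and its value at the energy minimiser with the same
  boundary derivatives \<open>(p, m)\<close>. That value is continuous and homogeneous of degree zero in \<open>(p, m)\<close>, so
  compactness of the unit circle yields the maximum.
\<close>

lemma rayleigh_attains_maximum:
  assumes k: "k \<noteq> 0"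
  shows "\<exists>\<phi>\<in>H2_tilde. (\<exists>x\<in>{-1..1}. \<phi> x \<noteq> 0) \<and> (\<forall>\<psi>\<in>H2_tilde. rayleigh \<xi>m \<xi>p k \<psi> \<le> rayleigh \<xi>m \<xi>p k \<phi>)"
proof -
  obtain A B where AB: "\<And>p m. \<exists>\<eta>\<in>H2_tilde. D1 \<eta> 1 = p \<and> D1 \<eta> (-1) = m
    \<and> energy k \<eta> = A * (p - m)\<^sup>2 + B * (p + m)\<^sup>2
    \<and> (\<forall>\<phi>\<in>H2_tilde. D1 \<phi> 1 = p \<longrightarrow> D1 \<phi> (-1) = m \<longrightarrow> energy k \<eta> \<le> energy k \<phi>)"
    using minimizer_exists[OF k] by blast
  define N where "N p m = \<xi>m * m\<^sup>2 + \<xi>p * p\<^sup>2" for p m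
  define Q where "Q p m = A * (p - m)\<^sup>2 + B * (p + m)\<^sup>2" for p m
  have Qpos: "Q p m > 0" if "(p, m) \<noteq> (0, 0)" for p m
  proof -
    obtain \<eta> where "\<eta> \<in> H2_tilde" "D1 \<eta> 1 = p" "D1 \<eta> (-1) = m" "energy k \<eta> = Q p m"
      using AB[of p m] unfolding Q_def by blast
    then have "p\<^sup>2 \<le> Q p m" "m\<^sup>2 \<le> Q p m"
      using boundary_derivative_bounds(1,2)[of \<eta>] integral_D2_sq_le_energy[of \<eta> k] by auto
    moreover have "p\<^sup>2 > 0 \<or> m\<^sup>2 > 0" using that by auto
    ultimately show ?thesis by linarith
  qed
  \<comment> \<open>With a negative numerator the quotient increases with the energy, and only the bound \<open>0\<close> remains.\<close>
  have NQ: "rayleigh \<xi>m \<xi>p k \<psi> \<le> max 0 (N (D1 \<psi> 1) (D1 \<psi> (-1)) / Q (D1 \<psi> 1) (D1 \<psi> (-1)))"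
    if \<psi>: "\<psi> \<in> H2_tilde" for \<psi>
  proof -
    let ?p = "D1 \<psi> 1" and ?m = "D1 \<psi> (-1)"
    have "Q ?p ?m \<le> energy k \<psi>" using AB[of ?p ?m] \<psi> unfolding Q_def by auto
    show ?thesis
    proof (cases "(?p, ?m) \<noteq> (0, 0) \<and> N ?p ?m \<ge> 0")
      case True
      then have "N ?p ?m / energy k \<psi> \<le> N ?p ?m / Q ?p ?m"
        using Qpos[of ?p ?m] \<open>Q ?p ?m \<le> energy k \<psi>\<close> by (intro divide_left_mono mult_pos_pos) auto
      then show ?thesis by (simp add: rayleigh_energy N_def)
    next
      case False
      moreover have "energy k \<psi> \<ge> 0"
        using integral_D2_sq_le_energy[OF \<psi>, of k] set_integral_sq_nonneg order_trans by blast
      ultimately have "N ?p ?m / energy k \<psi> \<le> 0"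
        by (auto simp: N_def divide_nonpos_nonneg)
      then show ?thesis by (simp add: rayleigh_energy N_def)
    qed
  qed
  have circle: "(cos t, sin t) \<noteq> (0, 0)" for t :: real
    using sin_zero_abs_cos_one[of t] by auto
  have cont: "continuous_on {0..2 * pi} (\<lambda>t. N (cos t) (sin t) / Q (cos t) (sin t))"
  proof (intro continuous_on_divide)
    show "\<forall>t\<in>{0..2 * pi}. Q (cos t) (sin t) \<noteq> 0"
      using Qpos[OF circle] by (auto simp: less_le)
  qed (unfold N_def Q_def, auto intro!: continuous_intros)
  have "{0..2 * pi} \<noteq> {}" by simp
  from continuous_attains_sup[OF compact_Icc this cont] obtain s where s: "s \<in> {0..2 * pi}"
    "\<And>t. t \<in> {0..2 * pi} \<Longrightarrow> N (cos t) (sin t) / Q (cos t) (sin t) \<le> N (cos s) (sin s) / Q (cos s) (sin s)"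
    by blast
  have hom: "N p m / Q p m \<le> N (cos s) (sin s) / Q (cos s) (sin s)" if "(p, m) \<noteq> (0, 0)" for p m
  proof -
    define r where "r = sqrt (p\<^sup>2 + m\<^sup>2)"
    have r: "r > 0" using that by (auto simp: r_def sum_power2_gt_zero_iff)
    have "(p / r)\<^sup>2 + (m / r)\<^sup>2 = 1"
      using r by (simp add: power_divide add_divide_distrib[symmetric]) (simp add: r_def)
    then obtain t where t: "0 \<le> t" "t < 2 * pi" "p / r = cos t" "m / r = sin t"
      using sincos_total_2pi by metis
    then have pm: "p = r * cos t" "m = r * sin t" using r by (auto simp: field_simps)
    have "N (r * c) (r * d) = r\<^sup>2 * N c d" "Q (r * c) (r * d) = r\<^sup>2 * Q c d" for c d
      unfolding N_def Q_def by (simp_all add: power2_eq_square algebra_simps)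
    then show ?thesis unfolding pm using s(2)[of t] t(1,2) r by simp
  qed
  have le: "rayleigh \<xi>m \<xi>p k \<psi> \<le> max 0 (N (cos s) (sin s) / Q (cos s) (sin s))" if "\<psi> \<in> H2_tilde" for \<psi>
  proof -
    let ?p = "D1 \<psi> 1" and ?m = "D1 \<psi> (-1)"
    have "N ?p ?m / Q ?p ?m \<le> max 0 (N (cos s) (sin s) / Q (cos s) (sin s))"
    proof (cases "(?p, ?m) = (0, 0)")
      case True
      then show ?thesis by (simp add: N_def)
    qed (intro max.coboundedI2 hom)
    then show ?thesis using NQ[OF that] by linarith
  qed
  show ?thesis
  proof (cases "N (cos s) (sin s) \<ge> 0")
    case True
    obtain \<eta> where \<eta>: "\<eta> \<in> H2_tilde" "D1 \<eta> 1 = cos s" "D1 \<eta> (-1) = sin s" "energy k \<eta> = Q (cos s) (sin s)"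
      using AB[of "cos s" "sin s"] unfolding Q_def by blast
    note ne = circle[of s]
    have re: "rayleigh \<xi>m \<xi>p k \<eta> = N (cos s) (sin s) / Q (cos s) (sin s)"
      using \<eta> by (simp add: rayleigh_energy N_def)
    have re0: "0 \<le> N (cos s) (sin s) / Q (cos s) (sin s)" using True Qpos[OF ne] by simp
    have "\<exists>x\<in>{-1..1}. \<eta> x \<noteq> 0"
    proof (rule ccontr)
      assume z: "\<not> (\<exists>x\<in>{-1..1}. \<eta> x \<noteq> 0)"
      have "D1 \<eta> x = 0" if "x \<in> {-1..1}" for x
      proof -
        have "(\<eta> has_real_derivative 0) (at x within {-1..1})"
          by (rule has_field_derivative_transform_within[of "\<lambda>x. 0" _ _ _ 1]) (use z that in auto)
        then show ?thesis using that unfolding D1_def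
          by (intro vector_derivative_within_closed_interval) (auto simp: has_real_derivative_iff_has_vector_derivative)
      qed
      then show False using \<eta>(2,3) ne by auto
    qed
    moreover have "rayleigh \<xi>m \<xi>p k \<psi> \<le> rayleigh \<xi>m \<xi>p k \<eta>" if "\<psi> \<in> H2_tilde" for \<psi>
      unfolding re using le[OF that] re0 by linarith
    ultimately show ?thesis using \<eta>(1) by blast
  next
    case False
    \<comment> \<open>Both slip coefficients push the quotient below zero, so functions in \<open>H\<^sup>2\<^sub>0\<close> are the maximisers.\<close>
    let ?\<eta> = "\<lambda>x::real. (1 - x * x) * (1 - x * x)"
    have el: "?\<eta> \<in> elementary" by (intro elementary_mult elementary_diff elementary_const elementary_id)
    have "partial 1 ?\<eta> x = - 4 * x * (1 - x * x)" for x
      by (rule partial_real) (auto intro!: derivative_eq_intros simp: algebra_simps)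
    then have D1: "D1 ?\<eta> 1 = 0" "D1 ?\<eta> (-1) = 0"
      using elementary_H2_tilde(2)[OF el, of 1] elementary_H2_tilde(2)[OF el, of "-1"] by auto
    have "Q (cos s) (sin s) > 0" using Qpos[OF circle] .
    then have neg: "N (cos s) (sin s) / Q (cos s) (sin s) \<le> 0" using False by (simp add: divide_le_0_iff)
    have "rayleigh \<xi>m \<xi>p k ?\<eta> = 0" unfolding rayleigh_energy D1 by simp
    then have "rayleigh \<xi>m \<xi>p k \<psi> \<le> rayleigh \<xi>m \<xi>p k ?\<eta>" if "\<psi> \<in> H2_tilde" for \<psi>
      using le[OF that] neg by linarith
    moreover have "?\<eta> \<in> H2_tilde" by (rule elementary_H2_tilde[OF el]) auto
    moreover have "\<exists>x\<in>{-1..1}. ?\<eta> x \<noteq> 0" by (intro bexI[of _ 0]) auto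
    ultimately show ?thesis by (intro bexI[of _ ?\<eta>] conjI ballI)
  qed
qed

lemma mu_c_at_attained:
  assumes "k \<noteq> 0"
  shows "\<exists>\<phi>\<in>H2_tilde. mu_c_at \<xi>m \<xi>p k = rayleigh \<xi>m \<xi>p k \<phi>"
proof -
  obtain \<phi> where \<phi>: "\<phi> \<in> H2_tilde" "\<exists>x\<in>{-1..1}. \<phi> x \<noteq> 0"
    "\<And>\<psi>. \<psi> \<in> H2_tilde \<Longrightarrow> rayleigh \<xi>m \<xi>p k \<psi> \<le> rayleigh \<xi>m \<xi>p k \<phi>"
    using rayleigh_attains_maximum[OF assms] by blast
  have "mu_c_at \<xi>m \<xi>p k = rayleigh \<xi>m \<xi>p k \<phi>"
    unfolding mu_c_at_def by (rule Greatest_equality) (use \<phi> in auto)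
  then show ?thesis using \<phi>(1) by blast
qed

lemma rayleigh_le:
  assumes "\<phi> \<in> H2_tilde"
  shows "rayleigh \<xi>m \<xi>p k \<phi> \<le> \<bar>\<xi>m\<bar> + \<bar>\<xi>p\<bar>"
proof -
  have b: "(D1 \<phi> 1)\<^sup>2 \<le> energy k \<phi>" "(D1 \<phi> (-1))\<^sup>2 \<le> energy k \<phi>"
    using boundary_derivative_bounds[OF assms] integral_D2_sq_le_energy[OF assms, of k] by auto
  have e: "0 \<le> energy k \<phi>" using b(1) zero_le_power2 order_trans by blast
  have "\<xi>m * (D1 \<phi> (-1))\<^sup>2 \<le> \<bar>\<xi>m\<bar> * energy k \<phi>" "\<xi>p * (D1 \<phi> 1)\<^sup>2 \<le> \<bar>\<xi>p\<bar> * energy k \<phi>"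
    using b by (auto intro: mult_mono)
  then have "\<xi>m * (D1 \<phi> (-1))\<^sup>2 + \<xi>p * (D1 \<phi> 1)\<^sup>2 \<le> (\<bar>\<xi>m\<bar> + \<bar>\<xi>p\<bar>) * energy k \<phi>"
    by (simp add: algebra_simps)
  then show ?thesis
    using e unfolding rayleigh_energy by (cases "energy k \<phi> = 0") (simp_all add: divide_le_eq)
qed

text \<open>
  The maxima and the supremum in \<open>mu_c\<close> are genuine, so some function has a quotient above \<open>\<mu>\<close>.
  Without the terms that contain \<open>k\<close>, its energy is the Dirichlet integral of \<open>\<phi>'\<close>, and
  \<open>(p - m)\<^sup>2 / 2\<close> is the smallest Dirichlet integral for the boundary values \<open>p\<close> and \<open>m\<close>.
\<close>

lemma below_mu_c:
  assumes L: "L > 0" and \<mu>: "\<mu> > 0" "\<mu> < mu_c L \<xi>m \<xi>p"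
  shows "\<exists>p m. \<xi>p * p\<^sup>2 + \<xi>m * m\<^sup>2 > \<mu> * (p - m)\<^sup>2 / 2"
proof -
  let ?K = "{of_int n / L | n :: int. n \<noteq> 0}"
  have K: "k \<noteq> 0" if "k \<in> ?K" for k using that L by auto
  have ne: "?K \<noteq> {}" by (auto intro: exI[of _ 1])
  have bdd: "bdd_above (mu_c_at \<xi>m \<xi>p ` ?K)"
  proof (rule bdd_aboveI2)
    fix k assume "k \<in> ?K"
    then obtain \<phi> where "\<phi> \<in> H2_tilde" "mu_c_at \<xi>m \<xi>p k = rayleigh \<xi>m \<xi>p k \<phi>"
      using mu_c_at_attained[OF K] by blast
    then show "mu_c_at \<xi>m \<xi>p k \<le> \<bar>\<xi>m\<bar> + \<bar>\<xi>p\<bar>" using rayleigh_le by simp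
  qed
  obtain k where k: "k \<in> ?K" "\<mu> < mu_c_at \<xi>m \<xi>p k"
    using less_cSUP_iff[OF ne bdd, of \<mu>] \<mu>(2) unfolding mu_c_def by blast
  obtain \<phi> where \<phi>: "\<phi> \<in> H2_tilde" "\<mu> < rayleigh \<xi>m \<xi>p k \<phi>"
    using mu_c_at_attained[OF K[OF k(1)], of \<xi>m \<xi>p] k(2) by auto
  have e: "(D1 \<phi> 1 - D1 \<phi> (-1))\<^sup>2 / 2 \<le> energy k \<phi>"
    using boundary_derivative_bounds(3)[OF \<phi>(1)] integral_D2_sq_le_energy[OF \<phi>(1), of k] by linarith
  then have "0 \<le> energy k \<phi>" using zero_le_power2[of "D1 \<phi> 1 - D1 \<phi> (-1)"] by linarith
  moreover have "energy k \<phi> \<noteq> 0" using \<phi>(2) \<mu>(1) by (auto simp: rayleigh_energy)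
  ultimately have "\<mu> * energy k \<phi> < \<xi>m * (D1 \<phi> (-1))\<^sup>2 + \<xi>p * (D1 \<phi> 1)\<^sup>2"
    using \<phi>(2) by (simp add: rayleigh_energy less_divide_eq)
  moreover have "\<mu> * ((D1 \<phi> 1 - D1 \<phi> (-1))\<^sup>2 / 2) \<le> \<mu> * energy k \<phi>"
    using e \<mu>(1) by (intro mult_left_mono) auto
  ultimately show ?thesis by (intro exI[of _ "D1 \<phi> 1"] exI[of _ "D1 \<phi> (-1)"]) simp
qed

section \<open>Growth rate of a shear flow\<close>

text \<open>
  For \<open>U y = A cosh (x y) + B sinh (x y)\<close> the conditions \<open>U'(1) = a U(1)\<close> and \<open>U'(-1) = -b U(-1)\<close> are a
  linear system for \<open>(A, B)\<close>. Its determinant is \<open>- secular a b x\<close>.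
\<close>

definition secular :: "real \<Rightarrow> real \<Rightarrow> real \<Rightarrow> real" where
  "secular a b x = (x * sinh x - a * cosh x) * (x * cosh x - b * sinh x)
     + (x * cosh x - a * sinh x) * (x * sinh x - b * cosh x)"

lemma secular_at_top: "filterlim (secular a b) at_top at_top"
  unfolding secular_def sinh_field_def cosh_field_def by real_asymp

lemma secular_near_0: "((\<lambda>x. secular a b x / x) \<longlongrightarrow> 2 * a * b - a - b) (at_right 0)"
  unfolding secular_def sinh_field_def cosh_field_def by (real_asymp simp: algebra_simps)

lemma secular_commute: "secular a b = secular b a"
  by (auto simp: secular_def algebra_simps)

lemma secular_root_above:
  assumes "0 < x0" "secular a b x0 \<le> 0"
  shows "\<exists>x>0. secular a b x = 0"
proof -
  have "eventually (\<lambda>x. secular a b x > 0 \<and> x > x0) at_top"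
    using filterlim_at_top_dense[THEN iffD1, OF secular_at_top, rule_format, of 0]
      eventually_gt_at_top[of x0] by (rule eventually_conj)
  then obtain x1 where "secular a b x1 > 0" "x1 > x0"
    using eventually_happens'[OF trivial_limit_at_top_linorder] by blast
  moreover have "continuous_on {x0..x1} (secular a b)"
    unfolding secular_def by (intro continuous_intros)
  ultimately obtain x where "x0 \<le> x" "secular a b x = 0"
    using IVT'[of "secular a b" x0 0 x1] assms(2) by auto
  then show ?thesis using assms(1) by (intro exI[of _ x]) auto
qed

text \<open>
  At the solution of \<open>x tanh x = a\<close> the first product in \<open>secular\<close> vanishes and the second has the sign
  of \<open>a - b\<close>.
\<close>

lemma secular_root_positive:
  assumes "0 < a" "a \<le> b"
  shows "\<exists>x>0. secular a b x = 0"
proof -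
  let ?g = "\<lambda>x. x * sinh x - a * cosh x"
  have "filterlim ?g at_top at_top"
    unfolding sinh_field_def cosh_field_def by real_asymp
  then have "eventually (\<lambda>x. ?g x > 0 \<and> x > 0) at_top"
    using filterlim_at_top_dense[THEN iffD1, rule_format, of ?g at_top 0] eventually_gt_at_top[of 0]
    by (intro eventually_conj)
  then obtain x1 where x1: "?g x1 > 0" "x1 > 0"
    using eventually_happens'[OF trivial_limit_at_top_linorder] by blast
  have "continuous_on {0..x1} ?g" by (intro continuous_intros)
  then obtain x where x: "0 \<le> x" "?g x = 0"
    using IVT'[of ?g 0 0 x1] x1 assms(1) by auto
  with assms(1) have "x \<noteq> 0" by auto
  with x have pos: "x > 0" by simp
  have C: "cosh x > 0" by simp
  have "cosh x * (x * cosh x - a * sinh x) = x * ((cosh x)\<^sup>2 - (sinh x)\<^sup>2)"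
    using x(2) by (simp add: power2_eq_square algebra_simps)
  also have "\<dots> = x" by (simp add: cosh_square_eq)
  finally have "x * cosh x - a * sinh x > 0"
    using pos C by (metis zero_less_mult_pos)
  moreover have "x * sinh x - b * cosh x = (a - b) * cosh x" using x(2) by (simp add: algebra_simps)
  then have "x * sinh x - b * cosh x \<le> 0" using assms(2) C by (simp add: mult_nonpos_nonneg)
  ultimately have "secular a b x \<le> 0" unfolding secular_def x(2) by (simp add: mult_nonneg_nonpos)
  then show ?thesis using secular_root_above[OF pos] by blast
qed

text \<open>
  The determinant of the quadratic form \<open>a p\<^sup>2 + b m\<^sup>2 - (p - m)\<^sup>2 / 2\<close> is \<open>(2 a b - a - b) / 2\<close>. For
  \<open>b \<le> 0\<close> the form has a negative diagonal entry, so it can take positive values only if this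
  determinant is negative, and then \<open>secular\<close> is negative near the origin.
\<close>

lemma secular_root_nonpositive:
  assumes "b \<le> 0" "a * p\<^sup>2 + b * m\<^sup>2 > (p - m)\<^sup>2 / 2"
  shows "\<exists>x>0. secular a b x = 0"
proof -
  have "2 * a * b - a - b < 0"
  proof (rule ccontr)
    assume "\<not> 2 * a * b - a - b < 0"
    \<comment> \<open>Completion of the square in \<open>m\<close>, with the determinant as coefficient of \<open>p\<^sup>2\<close>.\<close>
    then have "0 \<le> ((b - 1 / 2) * m + p / 2)\<^sup>2 + (2 * a * b - a - b) / 2 * p\<^sup>2" by simp
    also have "\<dots> = (b - 1 / 2) * (a * p\<^sup>2 + b * m\<^sup>2 - (p - m)\<^sup>2 / 2)"
      by (simp add: power2_eq_square field_simps)
    finally show False using assms by (simp add: zero_le_mult_iff)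
  qed
  then have "eventually (\<lambda>x. secular a b x / x < 0) (at_right 0)"
    using secular_near_0 order_tendstoD(2) by blast
  then obtain d where d: "d > 0" "\<And>x. 0 < x \<Longrightarrow> x < d \<Longrightarrow> secular a b x / x < 0"
    unfolding eventually_at_right_field by auto
  from d(1) d(2)[of "d / 2"] have "secular a b (d / 2) / (d / 2) < 0" by simp
  with d(1) have "0 < d / 2" "secular a b (d / 2) \<le> 0"
    by (auto simp: divide_less_0_iff)
  then show ?thesis by (rule secular_root_above)
qed

lemma secular_root:
  assumes "a * p\<^sup>2 + b * m\<^sup>2 > (p - m)\<^sup>2 / 2"
  shows "\<exists>x>0. secular a b x = 0"
proof -
  consider "b \<le> 0" | "a \<le> 0" | "0 < a" "a \<le> b" | "0 < b" "b \<le> a" by linarith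
  then show ?thesis
  proof cases
    case 1
    then show ?thesis using secular_root_nonpositive assms by blast
  next
    case 2
    have "b * m\<^sup>2 + a * p\<^sup>2 > (m - p)\<^sup>2 / 2" using assms by (simp add: power2_commute[of m p] add.commute)
    then show ?thesis using secular_root_nonpositive[OF 2] secular_commute[of a b] by metis
  next
    case 3
    then show ?thesis by (rule secular_root_positive)
  next
    case 4
    then show ?thesis using secular_root_positive secular_commute[of a b] by metis
  qed
qed

lemma singular_2x2_kernel:
  fixes a b c d :: real
  assumes "a * d = b * c"
  shows "\<exists>x y. (x, y) \<noteq> (0, 0) \<and> a * x + b * y = 0 \<and> c * x + d * y = 0"
proof (cases "a = 0 \<and> b = 0")
  case True
  show ?thesis
  proof (cases "c = 0 \<and> d = 0")
    case True
    then show ?thesis using \<open>a = 0 \<and> b = 0\<close> by (intro exI[of _ 1]) auto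
  next
    case False
    then show ?thesis using True by (intro exI[of _ d] exI[of _ "- c"]) auto
  qed
next
  case False
  then show ?thesis using assms
    by (intro exI[of _ b] exI[of _ "- a"]) (auto simp: algebra_simps)
qed

lemma unstable_profile:
  assumes "\<mu> > 0" "\<xi>p * p\<^sup>2 + \<xi>m * m\<^sup>2 > \<mu> * (p - m)\<^sup>2 / 2"
  shows "\<exists>x>0. \<exists>A B. (A, B) \<noteq> (0, 0)
    \<and> \<mu> * hyperbolic x (x * B) (x * A) 0 0 1 = \<xi>p * hyperbolic x A B 0 0 1
    \<and> \<mu> * hyperbolic x (x * B) (x * A) 0 0 (-1) = - \<xi>m * hyperbolic x A B 0 0 (-1)"
proof -
  have "\<xi>p / \<mu> * p\<^sup>2 + \<xi>m / \<mu> * m\<^sup>2 > (p - m)\<^sup>2 / 2"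
    using assms by (simp add: field_simps)
  then obtain x where x: "x > 0" "secular (\<xi>p / \<mu>) (\<xi>m / \<mu>) x = 0" using secular_root by blast
  define a b where "a = \<xi>p / \<mu>" "b = \<xi>m / \<mu>"
  have "(x * sinh x - a * cosh x) * (b * sinh x - x * cosh x) = (x * cosh x - a * sinh x) * (x * sinh x - b * cosh x)"
    using x(2) unfolding secular_def a_b_def[symmetric] by (simp add: algebra_simps)
  from singular_2x2_kernel[OF this] obtain A B where AB: "(A, B) \<noteq> (0, 0)"
    "(x * sinh x - a * cosh x) * A + (x * cosh x - a * sinh x) * B = 0"
    "(x * sinh x - b * cosh x) * A + (b * sinh x - x * cosh x) * B = 0" by blast
  have "hyperbolic x (x * B) (x * A) 0 0 1 = a * hyperbolic x A B 0 0 1" "hyperbolic x (x * B) (x * A) 0 0 (-1) = - b * hyperbolic x A B 0 0 (-1)"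
    using AB(2,3) by (simp_all add: hyperbolic_def algebra_simps)
  then have "\<mu> * hyperbolic x (x * B) (x * A) 0 0 1 = \<xi>p * hyperbolic x A B 0 0 1"
    "\<mu> * hyperbolic x (x * B) (x * A) 0 0 (-1) = - \<xi>m * hyperbolic x A B 0 0 (-1)"
    using assms(1) by (simp_all add: a_b_def)
  then show ?thesis using x(1) AB(1) by blast
qed

section \<open>The periodic slab\<close>

definition point :: "real \<Rightarrow> real \<Rightarrow> real ^ 2" where
  "point a b = a *\<^sub>R axis 1 1 + b *\<^sub>R axis 2 1"

lemma point_nth [simp]: "point a b $ 1 = a" "point a b $ 2 = b"
  by (simp_all add: point_def axis_def)

lemma vector_eq_point: "(vector [a, b] :: real ^ 2) = point a b"
  by (simp add: vec_eq_iff forall_2 vector_2)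

lemma continuous_point: "continuous_on UNIV (\<lambda>p. point (fst p) (snd p))"
  unfolding point_def by (intro continuous_intros)

lemma point_measurable: "(\<lambda>p. point (fst p) (snd p)) \<in> borel_measurable (lborel \<Otimes>\<^sub>M lborel)"
proof -
  have "(\<lambda>p. point (fst p) (snd p)) \<in> borel_measurable borel"
    using continuous_point by (rule borel_measurable_continuous_onI)
  then show ?thesis by (simp add: lborel_prod)
qed

lemma point_vector_derivative:
  "((\<lambda>a. point a b) has_vector_derivative axis 1 1) (at a within S)"
  "((\<lambda>b. point a b) has_vector_derivative axis 2 1) (at b within S)"
  unfolding point_def by (auto intro!: derivative_eq_intros)

lemma Basis_plane: "(Basis :: (real ^ 2) set) = {axis 1 1, axis 2 1}"
  by (auto simp: Basis_vec_def UNIV_2)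

lemma axis_1_neq_2: "axis (1::2) (1::real) \<noteq> axis 2 1"
  by (simp add: axis_eq_axis)

lemma lborel_plane: "lborel = distr (lborel \<Otimes>\<^sub>M lborel) borel (\<lambda>p. point (fst p) (snd p))"
proof (rule lborel_eqI)
  fix l u :: "real ^ 2" assume le: "\<And>b. b \<in> Basis \<Longrightarrow> l \<bullet> b \<le> u \<bullet> b"
  have le': "l $ 1 \<le> u $ 1" "l $ 2 \<le> u $ 2"
    using le[of "axis 1 1"] le[of "axis 2 1"] by (auto simp: Basis_plane inner_axis)
  have "(\<lambda>p. point (fst p) (snd p)) -` box l u \<inter> space (lborel \<Otimes>\<^sub>M lborel)
      = {l $ 1<..<u $ 1} \<times> {l $ 2<..<u $ 2}"
    by (auto simp: mem_box_cart forall_2 space_pair_measure)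
  then have "emeasure (distr (lborel \<Otimes>\<^sub>M lborel) borel (\<lambda>p. point (fst p) (snd p))) (box l u)
      = emeasure lborel {l $ 1<..<u $ 1} * emeasure lborel {l $ 2<..<u $ 2}"
    using point_measurable by (simp add: emeasure_distr lborel.emeasure_pair_measure_Times)
  also have "\<dots> = (\<Prod>b\<in>Basis. (u - l) \<bullet> b)"
    using le' by (simp add: Basis_plane axis_1_neq_2 inner_axis ennreal_mult')
  finally show "emeasure (distr (lborel \<Otimes>\<^sub>M lborel) borel (\<lambda>p. point (fst p) (snd p))) (box l u)
    = (\<Prod>b\<in>Basis. (u - l) \<bullet> b)" .
qed simp

lemma cell_box: "cell L = box (point 0 (-1)) (point (2 * pi * L) 1)"
  by (auto simp: cell_def mem_box_cart forall_2)

lemma cell_Fubini: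
  fixes f :: "real ^ 2 \<Rightarrow> real"
  assumes f: "continuous_on UNIV f"
  shows "(LINT x:cell L|lborel. f x)
      = (LINT a:{0<..<2 * pi * L}|lborel. LINT b:{-1<..<1}|lborel. f (point a b))"
    and "(LINT x:cell L|lborel. f x)
      = (LINT b:{-1<..<1}|lborel. LINT a:{0<..<2 * pi * L}|lborel. f (point a b))"
    and "set_integrable lborel {0<..<2 * pi * L} (\<lambda>a. LINT b:{-1<..<1}|lborel. f (point a b))"
proof -
  let ?G = "\<lambda>x. indicator (cell L) x *\<^sub>R f x"
  let ?H = "\<lambda>p. ?G (point (fst p) (snd p))"
  have "set_integrable lborel (cell L) f"
    unfolding cell_box using f continuous_on_subset by (blast intro: set_integrable_continuous_box)
  then have G: "integrable lborel ?G" by (simp add: set_integrable_def)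
  then have Gm: "?G \<in> borel_measurable borel" by auto
  have H: "integrable (lborel \<Otimes>\<^sub>M lborel) ?H"
  proof -
    have "integrable (distr (lborel \<Otimes>\<^sub>M lborel) borel (\<lambda>p. point (fst p) (snd p))) ?G"
      by (subst lborel_plane[symmetric]) (rule G)
    then show ?thesis unfolding integrable_distr_eq[OF point_measurable Gm] .
  qed
  have GH: "integral\<^sup>L lborel ?G = integral\<^sup>L (lborel \<Otimes>\<^sub>M lborel) ?H"
    by (subst lborel_plane) (rule integral_distr[OF point_measurable Gm])
  have split: "indicator (cell L) (point a b) * f (point a b) = indicator {0<..<2 * pi * L} a * (indicator {-1<..<1} b * f (point a b))" for a b
    by (auto simp: indicator_def cell_def)
  show "(LINT x:cell L|lborel. f x)
      = (LINT a:{0<..<2 * pi * L}|lborel. LINT b:{-1<..<1}|lborel. f (point a b))"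
    using GH lborel_pair.integral_fst'[OF H]
    by (simp add: set_lebesgue_integral_def split)
  show "(LINT x:cell L|lborel. f x)
      = (LINT b:{-1<..<1}|lborel. LINT a:{0<..<2 * pi * L}|lborel. f (point a b))"
    using GH lborel_pair.integral_snd[of "\<lambda>a b. ?G (point a b)", unfolded case_prod_unfold, OF H]
    by (simp add: set_lebesgue_integral_def split mult.left_commute[of "indicator {0<..<2 * pi * L} _"])
  show "set_integrable lborel {0<..<2 * pi * L} (\<lambda>a. LINT b:{-1<..<1}|lborel. f (point a b))"
    using lborel_pair.integrable_fst'[OF H]
    by (simp add: set_lebesgue_integral_def set_integrable_def split)
qed

definition smooth_slab :: "real \<Rightarrow> (real ^ 2 \<Rightarrow> real) set" where
  "smooth_slab L = {f. smooth f \<and> periodic1 L f}"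

lemma periodic1_partial:
  assumes "smooth f" "periodic1 L f"
  shows "periodic1 L (partial b f)"
  unfolding periodic1_def
proof
  fix x
  let ?c = "axis 1 (2 * pi * L) :: real ^ 2"
  have "(f has_derivative frechet_derivative f (at (x + ?c))) (at (x + ?c))"
    using smooth_differentiable[OF assms(1)] frechet_derivative_works by blast
  moreover have "((\<lambda>y. y + ?c) has_derivative (\<lambda>h. h)) (at x)"
    by (auto intro!: derivative_eq_intros)
  ultimately have "((\<lambda>y. f (y + ?c)) has_derivative frechet_derivative f (at (x + ?c))) (at x)"
    using has_derivative_compose[of "\<lambda>y. y + ?c" "\<lambda>h. h" x UNIV f] by blast
  moreover have "(\<lambda>y. f (y + ?c)) = f" using assms(2) by (auto simp: periodic1_def)
  ultimately have "(f has_derivative frechet_derivative f (at (x + ?c))) (at x)" by simp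
  from partial_eq[OF this] show "partial b f (x + ?c) = partial b f x" by (simp add: partial_def)
qed

locale slab =
  fixes L :: real
  assumes L_pos: "L > 0"
begin

text \<open>
  In \<open>x\<^sub>1\<close> the boundary terms cancel by periodicity, in \<open>x\<^sub>2\<close> they vanish by the support of the test
  function.
\<close>

lemma weak_partial_slab:
  assumes f: "f \<in> smooth_slab L" and b: "b \<in> Basis"
  shows "weak_partial (cell L) (test_slab L) b f (partial b f)"
  unfolding weak_partial_def
proof
  fix \<phi> assume \<phi>: "\<phi> \<in> test_slab L"
  have s: "smooth f" "smooth \<phi>" "smooth (partial b f)" "smooth (partial b \<phi>)"
    and per: "periodic1 L f" "periodic1 L \<phi>"
    using f \<phi> b by (auto simp: smooth_slab_def test_slab_def intro: smooth_partial)
  note c = s[THEN smooth_continuous]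
  let ?F = "\<lambda>x. f x * partial b \<phi> x + partial b f x * \<phi> x"
  have cF: "continuous_on UNIV ?F" by (intro continuous_intros c)
  have cp: "continuous_on S (\<lambda>a. ?F (point a y))" "continuous_on S (\<lambda>y. ?F (point a y))" for S a y
    by (intro continuous_on_compose2[OF cF]; auto simp: point_def intro!: continuous_intros)+
  have "(LINT x:cell L|lborel. ?F x) = 0"
  proof (cases "b = axis 1 1")
    case True
    have "(LINT a:{0<..<2 * pi * L}|lborel. ?F (point a y)) = 0" for y
    proof -
      have "(LINT a:{0<..<2 * pi * L}|lborel. ?F (point a y))
          = f (point (2 * pi * L) y) * \<phi> (point (2 * pi * L) y) - f (point 0 y) * \<phi> (point 0 y)"
      proof (rule integral_FTC_open_interval[OF _ cp(1)])
        show "((\<lambda>a. f (point a y) * \<phi> (point a y)) has_real_derivative ?F (point a y)) (at a within {0..2 * pi * L})" for a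
          using DERIV_mult'[OF smooth_has_derivative_axis[OF s(1) point_vector_derivative(1)]
              smooth_has_derivative_axis[OF s(2) point_vector_derivative(1)]]
          by (simp add: True)
      qed (use L_pos in auto)
      moreover have "point (2 * pi * L) y = point 0 y + axis 1 (2 * pi * L)"
        by (simp add: vec_eq_iff forall_2 axis_def)
      ultimately show ?thesis using per by (simp add: periodic1_def)
    qed
    then show ?thesis unfolding cell_Fubini(2)[OF cF] by simp
  next
    case False
    with b have b2: "b = axis 2 1" by (simp add: Basis_plane)
    have "(LINT y:{-1<..<1}|lborel. ?F (point a y)) = 0" for a
    proof -
      have "(LINT y:{-1<..<1}|lborel. ?F (point a y))
          = f (point a 1) * \<phi> (point a 1) - f (point a (-1)) * \<phi> (point a (-1))"
      proof (rule integral_FTC_open_interval[OF _ cp(2)])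
        show "((\<lambda>y. f (point a y) * \<phi> (point a y)) has_real_derivative ?F (point a y)) (at y within {-1..1})" for y
          using DERIV_mult'[OF smooth_has_derivative_axis[OF s(1) point_vector_derivative(2)]
              smooth_has_derivative_axis[OF s(2) point_vector_derivative(2)]]
          by (simp add: b2)
      qed simp
      moreover have "\<phi> (point a 1) = 0" "\<phi> (point a (-1)) = 0"
        using \<phi> by (auto simp: test_slab_def)
      ultimately show ?thesis by simp
    qed
    then show ?thesis unfolding cell_Fubini(1)[OF cF] by simp
  qed
  moreover have "(LINT x:cell L|lborel. ?F x)
      = (LINT x:cell L|lborel. f x * partial b \<phi> x) + (LINT x:cell L|lborel. partial b f x * \<phi> x)"
    unfolding cell_box
    by (intro set_integral_add(2) set_integrable_continuous_box continuous_intros c)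
  ultimately show "(LINT x:cell L|lborel. f x * partial b \<phi> x) = - (LINT x:cell L|lborel. partial b f x * \<phi> x)"
    by simp
qed

text \<open>
  Composing \<open>smooth_step\<close> with this difference of cosines gives a periodic cutoff in the first
  variable that needs no gluing at the sides of the cell. An interval \<open>(a, d)\<close> that fills the whole
  period is included.
\<close>

lemma cos_positive_iff:
  assumes "0 \<le> a" "a < d" "d \<le> 2 * pi * L" "0 < x" "x < 2 * pi * L"
  shows "cos ((x - (a + d) / 2) / L) - cos ((d - a) / 2 / L) > 0 \<longleftrightarrow> a < x \<and> x < d"
proof -
  define t r where "t = (x - (a + d) / 2) / L" "r = (d - a) / 2 / L"
  have r: "0 < r" "r \<le> pi" using assms L_pos by (auto simp: t_r_def field_simps)
  have t: "\<bar>t\<bar> < 2 * pi - r"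
    using assms L_pos by (auto simp: t_r_def abs_less_iff field_simps)
  have iff: "a < x \<and> x < d \<longleftrightarrow> \<bar>t\<bar> < r"
    using L_pos by (auto simp: t_r_def abs_less_iff field_simps)
  have "cos t > cos r \<longleftrightarrow> \<bar>t\<bar> < r"
  proof (cases "\<bar>t\<bar> \<le> pi")
    case True
    then show ?thesis using cos_mono_less_eq[of r "\<bar>t\<bar>"] r by simp
  next
    case False
    have "cos \<bar>t\<bar> = cos (2 * pi - \<bar>t\<bar>)" by (simp add: cos_diff)
    moreover have "cos (2 * pi - \<bar>t\<bar>) \<le> cos r"
      using False t r by (intro cos_monotone_0_pi_le) auto
    ultimately show ?thesis using False r by auto
  qed
  then show ?thesis unfolding iff by (simp add: t_r_def)
qed

lemma test_slab_product:
  assumes g: "\<And>x. g (x + 2 * pi * L) = g x" "(\<lambda>x::real ^ 2. g (x $ 1)) \<in> elementary"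
    and cd: "{c<..<d} \<subseteq> {-1<..<1}"
  shows "(\<lambda>x. g (x $ 1) * interval_cutoff c d n (x $ 2)) \<in> test_slab L"
proof -
  have "(\<lambda>x::real ^ 2. x $ 2) \<in> elementary" using elementary_inner[of "axis 2 1 :: real ^ 2"] by (simp add: inner_axis)
  then have "smooth (\<lambda>x::real ^ 2. g (x $ 1) * interval_cutoff c d n (x $ 2))"
    by (intro smooth_elementary elementary_mult g interval_cutoff_elementary)
  moreover have "periodic1 L (\<lambda>x. g (x $ 1) * interval_cutoff c d n (x $ 2))"
    using g(1) by (simp add: periodic1_def axis_def)
  ultimately show ?thesis
    unfolding test_slab_def using interval_cutoff_vanishes[OF cd, of n]
    by (auto intro!: exI[of _ "1 / real (Suc n)"])
qed

lemma separating_slab: "separating (cell L) (test_slab L)"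
  unfolding separating_def
proof (intro allI impI)
  fix a b :: "real ^ 2" assume sub: "box a b \<subseteq> cell L"
  show "\<exists>\<Phi>::nat \<Rightarrow> real ^ 2 \<Rightarrow> real. (\<forall>n. \<Phi> n \<in> test_slab L) \<and> (\<forall>n. \<forall>x\<in>cell L. \<bar>\<Phi> n x\<bar> \<le> 1) \<and>
    (\<forall>x\<in>cell L. (\<lambda>n. \<Phi> n x) \<longlonglongrightarrow> indicator (box a b) x)"
  proof (cases "box a b = {}")
    case True
    have "(\<lambda>x. 0) \<in> test_slab L"
      using smooth_elementary[OF elementary_const[of 0]] by (auto simp: test_slab_def periodic1_def intro: exI[of _ 1])
    with True show ?thesis by (intro exI[of _ "\<lambda>n x. 0"]) auto
  next
    case False
    then have ab: "a $ 1 < b $ 1" "a $ 2 < b $ 2" by (auto simp: box_ne_empty Basis_plane inner_axis)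
    have bd: "0 \<le> a $ 1" "b $ 1 \<le> 2 * pi * L" "-1 \<le> a $ 2" "b $ 2 \<le> 1"
      using sub ab unfolding cell_box subset_box by (auto simp: Basis_plane inner_axis)
    define g where "g n x = smooth_step n (cos ((x - (a $ 1 + b $ 1) / 2) / L) - cos ((b $ 1 - a $ 1) / 2 / L))" for n x
    have per: "g n (x + 2 * pi * L) = g n x" for n x
    proof -
      have "(x + 2 * pi * L - (a $ 1 + b $ 1) / 2) / L = (x - (a $ 1 + b $ 1) / 2) / L + 2 * pi"
        using L_pos by (simp add: field_simps)
      then show ?thesis unfolding g_def by (simp only: cos_periodic)
    qed
    have el: "(\<lambda>x::real ^ 2. g n (x $ 1)) \<in> elementary" for n
    proof -
      have x1: "(\<lambda>x::real ^ 2. x $ 1) \<in> elementary" using elementary_inner[of "axis 1 1 :: real ^ 2"] by (simp add: inner_axis)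
      then have "(\<lambda>x::real ^ 2. (x $ 1 - (a $ 1 + b $ 1) / 2) * (1 / L)) \<in> elementary"
        by (intro elementary_mult elementary_diff elementary_const)
      from elementary_comp[OF outer_fun.intros(2) this] show ?thesis
        unfolding g_def by (intro smooth_step_elementary elementary_diff elementary_const) simp
    qed
    let ?\<Phi> = "\<lambda>n x. g n (x $ 1) * interval_cutoff (a $ 2) (b $ 2) n (x $ 2)"
    have "?\<Phi> n \<in> test_slab L" for n
      using bd by (intro test_slab_product per el) auto
    moreover have "\<bar>?\<Phi> n x\<bar> \<le> 1" for n x
      using smooth_step_bounds interval_cutoff_bounds
      by (auto simp: g_def abs_mult intro!: mult_le_one)
    moreover have "(\<lambda>n. ?\<Phi> n x) \<longlonglongrightarrow> indicator (box a b) x" if "x \<in> cell L" for x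
    proof -
      have x: "0 < x $ 1" "x $ 1 < 2 * pi * L" using that by (auto simp: cell_def)
      have "(\<lambda>n. g n (x $ 1)) \<longlonglongrightarrow> indicator {a $ 1<..<b $ 1} (x $ 1)"
        unfolding g_def using smooth_step_tendsto[of "cos ((x $ 1 - (a $ 1 + b $ 1) / 2) / L) - cos ((b $ 1 - a $ 1) / 2 / L)"]
        unfolding cos_positive_iff[OF bd(1) ab(1) bd(2) x] by (auto simp: indicator_def)
      from tendsto_mult[OF this interval_cutoff_tendsto, of "a $ 2" "b $ 2" "x $ 2"]
      show ?thesis by (auto simp: indicator_def mem_box_cart forall_2 split: if_splits)
    qed
    ultimately show ?thesis by (intro exI[of _ ?\<Phi>]) auto
  qed
qed

sublocale sobolev_domain "cell L" "test_slab L" "smooth_slab L"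
proof
  show "\<exists>l u. cell L = box l u" using cell_box by blast
  show "separating (cell L) (test_slab L)" by (rule separating_slab)
  show "smooth \<phi>" if "\<phi> \<in> test_slab L" for \<phi> using that by (simp add: test_slab_def)
  show "smooth f" if "f \<in> smooth_slab L" for f using that by (simp add: smooth_slab_def)
  show "partial b f \<in> smooth_slab L" if "f \<in> smooth_slab L" "b \<in> Basis" for f b
    using that by (simp add: smooth_slab_def smooth_partial periodic1_partial)
  show "weak_partial (cell L) (test_slab L) b f (partial b f)" if "f \<in> smooth_slab L" "b \<in> Basis" for f b
    using that by (rule weak_partial_slab)
qed

lemma zero_smooth_slab: "(\<lambda>x. 0) \<in> smooth_slab L"
  using smooth_elementary[OF elementary_const[of 0]] by (simp add: smooth_slab_def periodic1_def)

lemma Hnorm_represents: "represents f' f \<Longrightarrow> Hnorm L k f' = sqrt (classical_sq k f)"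
  by (simp add: Hnorm_def sobolev_norm_def represents_sobolev_sq)

lemma H_slab_represents: "represents f' f \<Longrightarrow> f' \<in> H_slab L k"
  by (simp add: H_slab_def represents_sobolev)

lemma represents_pd:
  "represents f' f \<Longrightarrow> represents (pd L j f') (partial (axis j 1) f)"
  unfolding pd_def by (rule represents_wpartial) (auto simp: Basis_vec_def)

lemma represents_diff:
  assumes "represents f' f" "g \<in> smooth_slab L"
  shows "represents (\<lambda>x. g x - f' x) (\<lambda>x. g x - f x)"
  using assms smooth_L2[OF R_smooth[OF assms(2)]] unfolding represents_def
  by (auto intro: L2_diff simp: smooth_slab_def smooth_diff periodic1_def)

section \<open>Traces\<close>

text \<open>
  The fundamental theorem of calculus is applied to \<open>(s + b) / 2\<close> times \<open>w\<^sup>2\<close> on vertical lines; the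
  weight vanishes on the opposite side of the slab.
\<close>

lemma trace_inequality:
  assumes w: "w \<in> smooth_slab L" and s: "s = 1 \<or> s = -1"
  shows "(LINT y:{0<..<2 * pi * L}|lborel. (w (point y s))\<^sup>2) \<le> 2 * classical_sq 1 w"
proof -
  have sm: "smooth w" "smooth (partial (axis 2 1) w)"
    using w by (auto simp: smooth_slab_def Basis_plane intro: smooth_partial)
  note c = sm[THEN smooth_continuous]
  let ?d = "partial (axis 2 1) w"
  let ?F = "\<lambda>x. 2 * ((w x)\<^sup>2 + (?d x)\<^sup>2)"
  have cF: "continuous_on UNIV ?F" by (intro continuous_intros c)
  have cp: "continuous_on S (\<lambda>b. h (point a b))" "continuous_on S (\<lambda>a. h (point a b))"
    if "continuous_on UNIV h" for S a b and h :: "real ^ 2 \<Rightarrow> real"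
    by (rule continuous_on_compose2[OF that]; auto simp: point_def intro!: continuous_intros)+
  have pw: "(w (point y s))\<^sup>2 \<le> (LINT b:{-1<..<1}|lborel. ?F (point y b))" for y
  proof -
    let ?w = "\<lambda>b. w (point y b)" and ?w' = "\<lambda>b. ?d (point y b)"
    let ?G = "\<lambda>b. (?w b)\<^sup>2 / 2 + (s + b) * (?w b * ?w' b)"
    have cG: "continuous_on {-1..1} ?G" by (intro continuous_intros cp c) auto
    have "(LINT b:{-1<..<1}|lborel. ?G b) = (s + 1) / 2 * (?w 1)\<^sup>2 - (s + (-1)) / 2 * (?w (-1))\<^sup>2"
    proof (rule integral_FTC_open_interval[OF _ cG])
      fix b :: real
      have "(?w has_real_derivative ?w' b) (at b within {-1..1})"
        by (rule smooth_has_derivative_axis[OF sm(1) point_vector_derivative(2)])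
      then show "((\<lambda>b. (s + b) / 2 * (?w b)\<^sup>2) has_real_derivative ?G b) (at b within {-1..1})"
        by (auto intro!: derivative_eq_intros simp: power2_eq_square field_simps)
    qed simp
    also have "\<dots> = (w (point y s))\<^sup>2" using s by auto
    finally have "(w (point y s))\<^sup>2 = (LINT b:{-1<..<1}|lborel. ?G b)" ..
    also have "\<dots> \<le> (LINT b:{-1<..<1}|lborel. ?F (point y b))"
    proof (intro set_integral_mono integrable_interval cG cp cF)
      fix b :: real assume "b \<in> {-1<..<1}"
      then have "\<bar>s + b\<bar> \<le> 2" using s by auto
      then have "\<bar>s + b\<bar> * \<bar>?w b * ?w' b\<bar> \<le> 2 * \<bar>?w b * ?w' b\<bar>" by (intro mult_right_mono) auto
      then have "(s + b) * (?w b * ?w' b) \<le> 2 * \<bar>?w b\<bar> * \<bar>?w' b\<bar>"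
        by (simp add: abs_mult[symmetric] mult.assoc)
      also have "\<dots> \<le> (?w b)\<^sup>2 + (?w' b)\<^sup>2" using sum_squares_bound[of "\<bar>?w b\<bar>" "\<bar>?w' b\<bar>"] by simp
      finally have "(s + b) * (?w b * ?w' b) \<le> (?w b)\<^sup>2 + (?w' b)\<^sup>2" .
      moreover have "X \<le> A + B \<Longrightarrow> 0 \<le> A \<Longrightarrow> 0 \<le> B \<Longrightarrow> A / 2 + X \<le> 2 * (A + B)" for X A B :: real by simp
      ultimately show "?G b \<le> ?F (point y b)" by (meson zero_le_power2)
    qed
    finally show ?thesis .
  qed
  have "(LINT y:{0<..<2 * pi * L}|lborel. (w (point y s))\<^sup>2)
      \<le> (LINT y:{0<..<2 * pi * L}|lborel. LINT b:{-1<..<1}|lborel. ?F (point y b))"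
  proof (intro set_integral_mono pw)
    show "set_integrable lborel {0<..<2 * pi * L} (\<lambda>y. (w (point y s))\<^sup>2)"
      using set_integrable_continuous_box[of 0 "2 * pi * L" "\<lambda>y. (w (point y s))\<^sup>2"]
      by (simp add: box_real continuous_intros cp c)
    show "set_integrable lborel {0<..<2 * pi * L} (\<lambda>y. LINT b:{-1<..<1}|lborel. ?F (point y b))"
      by (rule cell_Fubini(3)[OF cF])
  qed
  also have "\<dots> = (LINT x:cell L|lborel. ?F x)" by (rule cell_Fubini(1)[OF cF, symmetric])
  also have "\<dots> = 2 * ((LINT x:cell L|lborel. (w x)\<^sup>2) + (LINT x:cell L|lborel. (?d x)\<^sup>2))"
    unfolding set_integral_mult_right cell_box
    by (subst set_integral_add(2))
      (intro set_integrable_continuous_box continuous_intros c | simp)+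
  also have "\<dots> \<le> 2 * classical_sq 1 w"
    using set_integral_sq_nonneg[of "cell L" "partial (axis 1 1) w"]
    by (simp add: Basis_plane axis_1_neq_2)
  finally show ?thesis .
qed

lemma L2_line:
  assumes "smooth f"
  shows "(\<lambda>y. f (point y s)) \<in> L2 {0<..<2 * pi * L}"
proof -
  have "continuous_on {0..2 * pi * L} (\<lambda>y. f (point y s))"
    by (rule continuous_on_compose2[OF smooth_continuous[OF assms, of UNIV]])
      (auto simp: point_def intro!: continuous_intros)
  then show ?thesis using L2_continuous[of 0 "2 * pi * L" "\<lambda>y. f (point y s)"] by (simp add: box_real)
qed

lemma has_trace_represents:
  assumes "represents f' f"
  shows "has_trace L s f' (\<lambda>y. f (point y s))"
  unfolding has_trace_def
proof (intro conjI exI[of _ "\<lambda>n. f"])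
  have f: "f \<in> smooth_slab L" using assms by (simp add: represents_def)
  show "f' \<in> H_slab L 1" using assms by (rule H_slab_represents)
  show "(\<lambda>y. f (point y s)) \<in> L2 {0<..<2 * pi * L}" using f by (intro L2_line R_smooth)
  show "\<forall>n. smooth f \<and> periodic1 L f" using f by (simp add: smooth_slab_def)
  have "Hnorm L 1 (\<lambda>x. f x - f' x) = sqrt (classical_sq 1 (\<lambda>x. 0))"
    using Hnorm_represents[OF represents_diff[OF assms f]] by simp
  also have "classical_sq 1 (\<lambda>x. 0) = 0"
    using classical_sq_cmult[OF zero_smooth_slab, of 1 0] by simp
  finally show "(\<lambda>n. Hnorm L 1 (\<lambda>x. f x - f' x)) \<longlonglongrightarrow> 0" by simp
  show "(\<lambda>n. LINT y:{0<..<2 * pi * L}|lborel. (f (vector [y, s]) - f (point y s))\<^sup>2) \<longlonglongrightarrow> 0"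
    by (simp add: vector_eq_point)
qed

text \<open>
  The trace inequality bounds the distance on the boundary between the approximating smooth functions
  and \<open>f\<close> by their distance in \<open>H\<^sup>1\<close>, which tends to zero.
\<close>

lemma has_trace_unique:
  assumes f: "represents f' f" and s: "s = 1 \<or> s = -1" and g: "has_trace L s f' g"
  shows "AE y in lborel. y \<in> {0<..<2 * pi * L} \<longrightarrow> g y = f (point y s)"
proof -
  let ?D = "{0<..<2 * pi * L}"
  obtain \<Phi> :: "nat \<Rightarrow> real ^ 2 \<Rightarrow> real" where \<Phi>: "\<And>n. \<Phi> n \<in> smooth_slab L"
    "(\<lambda>n. Hnorm L 1 (\<lambda>x. \<Phi> n x - f' x)) \<longlonglongrightarrow> 0"
    "(\<lambda>n. LINT y:?D|lborel. (\<Phi> n (point y s) - g y)\<^sup>2) \<longlonglongrightarrow> 0"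
    using g unfolding has_trace_def vector_eq_point smooth_slab_def by blast
  have gL2: "g \<in> L2 ?D" using g by (simp add: has_trace_def)
  have fR: "f \<in> smooth_slab L" using f by (simp add: represents_def)
  note fL2 = L2_line[OF R_smooth[OF fR], of s]
  define w where "w n = (\<lambda>x. \<Phi> n x - f x)" for n
  have w: "represents (\<lambda>x. \<Phi> n x - f' x) (w n)" for n
    unfolding w_def by (rule represents_diff[OF f \<Phi>(1)])
  then have wR: "w n \<in> smooth_slab L" for n by (simp add: represents_def)
  have "(\<lambda>n. (Hnorm L 1 (\<lambda>x. \<Phi> n x - f' x))\<^sup>2) \<longlonglongrightarrow> 0\<^sup>2" by (intro tendsto_power \<Phi>(2))
  then have "(\<lambda>n. classical_sq 1 (w n)) \<longlonglongrightarrow> 0"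
    using Hnorm_represents[OF w] classical_sq_nonneg by (simp del: classical_sq.simps)
  then have lim: "(\<lambda>n. 2 * (2 * classical_sq 1 (w n)) + 2 * (LINT y:?D|lborel. (\<Phi> n (point y s) - g y)\<^sup>2)) \<longlonglongrightarrow> 2 * (2 * 0) + 2 * 0"
    by (intro tendsto_intros \<Phi>(3))
  have gf: "(\<lambda>y. g y - f (point y s)) \<in> L2 ?D" by (rule L2_diff[OF gL2 fL2])
  have "(LINT y:?D|lborel. (g y - f (point y s))\<^sup>2)
      \<le> 2 * (2 * classical_sq 1 (w n)) + 2 * (LINT y:?D|lborel. (\<Phi> n (point y s) - g y)\<^sup>2)" for n
  proof -
    have i: "set_integrable lborel ?D (\<lambda>y. (w n (point y s))\<^sup>2)"
      "set_integrable lborel ?D (\<lambda>y. (\<Phi> n (point y s) - g y)\<^sup>2)"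
      using L2_line[OF R_smooth[OF wR]] L2_diff[OF L2_line[OF R_smooth[OF \<Phi>(1)]] gL2]
      by (auto simp: L2_def)
    have "(LINT y:?D|lborel. (g y - f (point y s))\<^sup>2)
        \<le> (LINT y:?D|lborel. 2 * (w n (point y s))\<^sup>2 + 2 * (\<Phi> n (point y s) - g y)\<^sup>2)"
    proof (rule set_integral_mono)
      fix y
      have "g y - f (point y s) = w n (point y s) - (\<Phi> n (point y s) - g y)" by (simp add: w_def)
      moreover have "(v - z)\<^sup>2 \<le> 2 * v\<^sup>2 + 2 * z\<^sup>2" for v z :: real
        using zero_le_power2[of "v + z"] by (simp add: power2_sum power2_diff)
      ultimately show "(g y - f (point y s))\<^sup>2 \<le> 2 * (w n (point y s))\<^sup>2 + 2 * (\<Phi> n (point y s) - g y)\<^sup>2"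
        by metis
    qed (use gf i in \<open>auto simp: L2_def\<close>)
    also have "\<dots> = 2 * (LINT y:?D|lborel. (w n (point y s))\<^sup>2) + 2 * (LINT y:?D|lborel. (\<Phi> n (point y s) - g y)\<^sup>2)"
      using i by (subst set_integral_add(2)) auto
    finally show ?thesis using trace_inequality[OF wR s, of n] by simp
  qed
  then have "(LINT y:?D|lborel. (g y - f (point y s))\<^sup>2) \<le> 2 * (2 * 0) + 2 * 0"
    by (intro LIMSEQ_le_const[OF lim] exI[of _ 0] allI impI)
  then have "(LINT y:?D|lborel. (g y - f (point y s))\<^sup>2) = 0"
    using set_integral_sq_nonneg[of ?D "\<lambda>y. g y - f (point y s)"] by linarith
  then have "AE y in lborel. indicator ?D y *\<^sub>R (g y - f (point y s))\<^sup>2 = 0"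
    using gf unfolding set_lebesgue_integral_def L2_def set_integrable_def
    by (subst (asm) integral_nonneg_eq_0_iff_AE) auto
  then show ?thesis by eventually_elim (auto simp: indicator_def split: if_splits)
qed

lemma slab_trace_represents:
  assumes "represents f' f" "s = 1 \<or> s = -1"
  shows "AE y in lborel. y \<in> {0<..<2 * pi * L} \<longrightarrow> slab_trace L s f' y = f (point y s)"
  using has_trace_unique[OF assms] someI[of "has_trace L s f'", OF has_trace_represents[OF assms(1)]]
  by (simp add: slab_trace_def)

section \<open>Growing shear flows\<close>

lemma elementary_cmult: "U \<in> elementary \<Longrightarrow> (\<lambda>x. c * U x) \<in> elementary"
  by (intro elementary_mult elementary_const)

lemma elementary_smooth_slab: "U \<in> elementary \<Longrightarrow> periodic1 L U \<Longrightarrow> U \<in> smooth_slab L"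
  by (simp add: smooth_slab_def smooth_elementary)

lemma represents_cmult:
  assumes "U \<in> elementary" "periodic1 L U"
  shows "represents (\<lambda>x. c * U x) (\<lambda>x. c * U x)"
  using assms by (intro represents_self elementary_smooth_slab elementary_cmult) (auto simp: periodic1_def)

lemma Hnorm_cmult:
  assumes "U \<in> elementary" "periodic1 L U"
  shows "Hnorm L k (\<lambda>x. c * U x) = \<bar>c\<bar> * Hnorm L k U"
  using Hnorm_represents[OF represents_cmult[OF assms]] Hnorm_represents[OF represents_self[OF elementary_smooth_slab[OF assms]]]
    classical_sq_cmult[OF elementary_smooth_slab[OF assms]]
  by (simp add: real_sqrt_mult)

lemma continuous_in_H_separable:
  assumes U: "U \<in> elementary" "periodic1 L U" and e: "continuous_on UNIV e"
  shows "continuous_in_H L k Tmax (\<lambda>t x. e t * U x)"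
  unfolding continuous_in_H_def
proof (intro ballI conjI)
  fix t
  show "(\<lambda>x. e t * U x) \<in> H_slab L k" by (rule H_slab_represents[OF represents_cmult[OF U]])
  have "Hnorm L k (\<lambda>x. e s * U x - e t * U x) = \<bar>e s - e t\<bar> * Hnorm L k U" for s
    using Hnorm_cmult[OF U, of k "e s - e t"] by (simp add: left_diff_distrib)
  moreover have "(e \<longlongrightarrow> e t) (at t within S)" for S
    using e continuous_on_def continuous_on_subset by (metis UNIV_I tendsto_within_subset top_greatest)
  then have "((\<lambda>s. \<bar>e s - e t\<bar> * Hnorm L k U) \<longlongrightarrow> \<bar>e t - e t\<bar> * Hnorm L k U) (at t within S)" for S
    by (intro tendsto_intros)
  ultimately show "((\<lambda>s. Hnorm L k (\<lambda>x. e s * U x - e t * U x)) \<longlongrightarrow> 0) (at t within existence_interval Tmax)"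
    by simp
qed

lemma has_time_derivative_separable:
  assumes U: "U \<in> elementary" "periodic1 L U" and e: "(e has_real_derivative e') (at t)"
  shows "has_time_derivative L Tmax (\<lambda>t x. e t * U x) t (\<lambda>x. e' * U x)"
  unfolding has_time_derivative_def
proof
  show "(\<lambda>x. e' * U x) \<in> L2 (cell L)" using represents_cmult[OF U] by (simp add: represents_def)
  have "Hnorm L 0 (\<lambda>x. (e s * U x - e t * U x) / (s - t) - e' * U x)
      = \<bar>(e s - e t) / (s - t) - e'\<bar> * Hnorm L 0 U" for s
    using Hnorm_cmult[OF U, of 0 "(e s - e t) / (s - t) - e'"]
    by (simp add: left_diff_distrib diff_divide_distrib)
  moreover have "((\<lambda>s. (e s - e t) / (s - t)) \<longlongrightarrow> e') (at t within existence_interval Tmax)"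
    using has_field_derivative_at_within[OF e] by (simp add: has_field_derivative_iff)
  then have "((\<lambda>s. \<bar>(e s - e t) / (s - t) - e'\<bar> * Hnorm L 0 U) \<longlongrightarrow> \<bar>e' - e'\<bar> * Hnorm L 0 U)
      (at t within existence_interval Tmax)"
    by (intro tendsto_intros)
  ultimately show "((\<lambda>s. Hnorm L 0 (\<lambda>x. (e s * U x - e t * U x) / (s - t) - e' * U x)) \<longlongrightarrow> 0)
      (at t within existence_interval Tmax)" by simp
qed

definition profile :: "real \<Rightarrow> real \<Rightarrow> real \<Rightarrow> real ^ 2 \<Rightarrow> real" where
  "profile k A B x = hyperbolic k A B 0 0 (x $ 2)"

lemma profile_elementary: "profile k A B \<in> elementary"
proof -
  have "(\<lambda>x::real ^ 2. x $ 2) \<in> elementary" using elementary_inner[of "axis 2 1 :: real ^ 2"] by (simp add: inner_axis)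
  from hyperbolic_elementary[OF this] show ?thesis by (simp add: profile_def[abs_def])
qed

lemma profile_periodic: "periodic1 L (profile k A B)"
  by (simp add: periodic1_def profile_def axis_def)

lemma profile_cmult: "(\<lambda>x. c * profile k A B x) = profile k (c * A) (c * B)"
  by (auto simp: profile_def hyperbolic_def algebra_simps)

lemma partial_profile:
  "partial (axis 1 1) (profile k A B) = (\<lambda>x. 0)"
  "partial (axis 2 1) (profile k A B) = profile k (k * B) (k * A)"
proof -
  have "(profile k A B has_derivative (\<lambda>h. hyperbolic k (k * B) (k * A) 0 0 (x $ 2) * h $ 2)) (at x)" for x
  proof -
    have "((\<lambda>x::real ^ 2. x $ 2) has_derivative (\<lambda>h. h $ 2)) (at x)"
      by (intro bounded_linear_imp_has_derivative bounded_linear_vec_nth)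
    moreover have "(hyperbolic k A B 0 0 has_derivative (\<lambda>h. hyperbolic k (k * B) (k * A) 0 0 (x $ 2) * h)) (at (x $ 2))"
      using hyperbolic_derivative[of k A B 0 0 "x $ 2"] by (simp add: has_field_derivative_def)
    ultimately show ?thesis
      using has_derivative_compose[of "\<lambda>x. x $ 2" "\<lambda>h. h $ 2" x UNIV "hyperbolic k A B 0 0"]
      by (simp add: profile_def[abs_def])
  qed
  from partial_eq[OF this] show "partial (axis 1 1) (profile k A B) = (\<lambda>x. 0)"
    "partial (axis 2 1) (profile k A B) = profile k (k * B) (k * A)"
    by (auto simp: profile_def axis_def)
qed

definition shear_flow :: "real \<Rightarrow> real \<Rightarrow> real \<Rightarrow> real \<Rightarrow> real \<Rightarrow> real \<Rightarrow> real ^ 2 \<Rightarrow> real ^ 2" where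
  "shear_flow \<mu> k A B c t x = vector [c * exp (\<mu> * k\<^sup>2 * t) * profile k A B x, 0]"

text \<open>
  The transport term vanishes because the velocity is horizontal and independent of \<open>x\<^sub>1\<close>. What remains
  of the momentum equation is the heat equation for the profile, with \<open>U'' = k\<^sup>2 U\<close>.
\<close>

lemma shear_flow_solution:
  assumes bc: "\<mu> * hyperbolic k (k * B) (k * A) 0 0 1 = \<xi>p * hyperbolic k A B 0 0 1"
    "\<mu> * hyperbolic k (k * B) (k * A) 0 0 (-1) = - \<xi>m * hyperbolic k A B 0 0 (-1)"
  shows "strong_solution L \<xi>m \<xi>p \<mu> \<infinity> (shear_flow \<mu> k A B c) (\<lambda>t x. 0)"
proof -
  define e where "e t = c * exp (\<mu> * k\<^sup>2 * t)" for t
  let ?U = "profile k A B" and ?z = "\<lambda>x. 0 :: real"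
  let ?u = "shear_flow \<mu> k A B c"
  note U = profile_elementary[of k A B] profile_periodic[of k A B]
  have Z: "?z \<in> elementary" "periodic1 L ?z" by (auto simp: periodic1_def intro: elementary_const)
  have comp: "(\<lambda>x. ?u t x $ 1) = (\<lambda>x. e t * ?U x)" "(\<lambda>x. ?u t x $ 2) = ?z" for t
    by (auto simp: shear_flow_def e_def vector_2)
  have ce: "continuous_on UNIV e" unfolding e_def by (intro continuous_intros)
  have de: "(e has_real_derivative \<mu> * k\<^sup>2 * e t) (at t)" for t
    unfolding e_def by (auto intro!: derivative_eq_intros)
  have zc: "continuous_in_H L k' Tmax (\<lambda>t. ?z)" for k' Tmax
    using continuous_in_H_separable[OF Z continuous_on_const, of k' Tmax 0] by simp
  have zd: "has_time_derivative L Tmax (\<lambda>t. ?z) t ?z" for t Tmax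
    using has_time_derivative_separable[OF Z DERIV_const, of Tmax 0 t] by simp
  have r0: "represents ?z ?z" by (rule represents_self[OF elementary_smooth_slab[OF Z]])
  have pz: "partial b ?z = ?z" for b :: "real ^ 2" by (auto intro!: partial_eq)
  have rp0: "represents (pd L j f) ?z" if "represents f ?z" for f j
    using represents_pd[OF that, of j] by (simp add: pz)
  have r1: "represents (\<lambda>x. e t * ?U x) (profile k (e t * A) (e t * B))" for t
    using represents_cmult[OF U, of "e t"] by (simp add: profile_cmult)
  have r11: "represents (pd L 1 (\<lambda>x. e t * ?U x)) ?z"
    and r12: "represents (pd L 2 (\<lambda>x. e t * ?U x)) (profile k (k * (e t * B)) (k * (e t * A)))" for t
    using represents_pd[OF r1, of 1 t] represents_pd[OF r1, of 2 t] by (simp_all add: partial_profile)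
  have r122: "represents (pd L 2 (pd L 2 (\<lambda>x. e t * ?U x))) (profile k (k * (k * (e t * A))) (k * (k * (e t * B))))" for t
    using represents_pd[OF r12, of 2 t] by (simp add: partial_profile)
  have ae: "AE x in lborel. x \<in> cell L \<longrightarrow> f' x = f x" if "represents f' f" for f' f
    using that by (simp add: represents_def)
  have "momentum_equation L \<mu> \<infinity> ?u (\<lambda>t x. 0) t" for t
    unfolding momentum_equation_def
  proof (intro exI[of _ "\<lambda>x. vector [\<mu> * k\<^sup>2 * e t * ?U x, 0] :: real ^ 2"], unfold forall_2, intro conjI)
    show "has_time_derivative L \<infinity> (\<lambda>s x. ?u s x $ 1) t (\<lambda>x. (vector [\<mu> * k\<^sup>2 * e t * ?U x, 0] :: real ^ 2) $ 1)"
      using has_time_derivative_separable[OF U de] by (simp add: comp vector_2)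
    show "has_time_derivative L \<infinity> (\<lambda>s x. ?u s x $ 2) t (\<lambda>x. (vector [\<mu> * k\<^sup>2 * e t * ?U x, 0] :: real ^ 2) $ 2)"
      using zd by (simp add: comp vector_2)
    show "AE x in lborel. x \<in> cell L \<longrightarrow>
        (vector [\<mu> * k\<^sup>2 * e t * ?U x, 0] :: real ^ 2) $ 1 + (\<Sum>j\<in>UNIV. ?u t x $ j * pd L j (\<lambda>y. ?u t y $ 1) x) + pd L 1 (\<lambda>x. 0) x
          - \<mu> * (\<Sum>j\<in>UNIV. pd L j (pd L j (\<lambda>y. ?u t y $ 1)) x) = 0"
      unfolding comp sum_2
      using ae[OF r11[of t]] ae[OF rp0[OF r11[of t], of 1]] ae[OF r122[of t]] ae[OF rp0[OF r0, of 1]]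
    proof eventually_elim
      case (elim x)
      have "profile k (k * (k * (e t * A))) (k * (k * (e t * B))) x = k\<^sup>2 * e t * ?U x"
        using fun_cong[OF profile_cmult[of "k\<^sup>2 * e t" k A B], of x] by (simp add: power2_eq_square mult_ac)
      then show ?case using elim by (simp add: shear_flow_def vector_2)
    qed
    show "AE x in lborel. x \<in> cell L \<longrightarrow>
        (vector [\<mu> * k\<^sup>2 * e t * ?U x, 0] :: real ^ 2) $ 2 + (\<Sum>j\<in>UNIV. ?u t x $ j * pd L j (\<lambda>y. ?u t y $ 2) x) + pd L 2 (\<lambda>x. 0) x
          - \<mu> * (\<Sum>j\<in>UNIV. pd L j (pd L j (\<lambda>y. ?u t y $ 2)) x) = 0"
      unfolding comp sum_2
      using ae[OF rp0[OF r0, of 1]] ae[OF rp0[OF r0, of 2]] ae[OF rp0[OF rp0[OF r0, of 1], of 1]]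
        ae[OF rp0[OF rp0[OF r0, of 2], of 2]]
      by eventually_elim (simp add: vector_2)
  qed
  moreover have "divergence_free L (?u t)" for t
    unfolding divergence_free_def sum_2 comp
    using ae[OF r11[of t]] ae[OF rp0[OF r0, of 2]] by eventually_elim simp
  moreover have "boundary_conditions L \<xi>m \<xi>p \<mu> (?u t)" for t
    unfolding boundary_conditions_def comp
    using slab_trace_represents[OF r0 disjI1[OF refl]] slab_trace_represents[OF r0 disjI2[OF refl]]
      slab_trace_represents[OF r1[of t] disjI1[OF refl]] slab_trace_represents[OF r1[of t] disjI2[OF refl]]
      slab_trace_represents[OF r12[of t] disjI1[OF refl]] slab_trace_represents[OF r12[of t] disjI2[OF refl]]
  proof eventually_elim
    case (elim y)
    have "hyperbolic k (k * (e t * B)) (k * (e t * A)) 0 0 b = e t * hyperbolic k (k * B) (k * A) 0 0 b"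
      "hyperbolic k (e t * A) (e t * B) 0 0 b = e t * hyperbolic k A B 0 0 b" for b
      by (simp_all add: hyperbolic_def algebra_simps)
    moreover have "\<mu> * (e t * hyperbolic k (k * B) (k * A) 0 0 1) = \<xi>p * (e t * hyperbolic k A B 0 0 1)"
      "\<mu> * (e t * hyperbolic k (k * B) (k * A) 0 0 (-1)) = - \<xi>m * (e t * hyperbolic k A B 0 0 (-1))"
      using arg_cong[OF bc(1), of "(*) (e t)"] arg_cong[OF bc(2), of "(*) (e t)"]
      by (simp_all only: mult.left_commute[of _ "e t"])
    ultimately show ?case using elim by (simp add: profile_def)
  qed
  moreover have "periodic1 L (?u t)" "periodic1 L (\<lambda>x. 0 :: real)" for t
    using U(2) by (auto simp: periodic1_def shear_flow_def)
  moreover have "continuous_in_H L 2 \<infinity> (\<lambda>t x. ?u t x $ i)" for i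
    using exhaust_2[of i] continuous_in_H_separable[OF U ce] zc by (auto simp: comp)
  ultimately show ?thesis
    unfolding strong_solution_def using zc by simp
qed

lemma vHnorm_shear_flow:
  "vHnorm L j (shear_flow \<mu> k A B c t) = \<bar>c\<bar> * exp (\<mu> * k\<^sup>2 * t) * Hnorm L j (profile k A B)"
proof -
  have z: "Hnorm L j (\<lambda>x. 0) = 0"
    using Hnorm_cmult[OF elementary_const, of 0 j 0] by (simp add: periodic1_def)
  have nn: "Hnorm L j (profile k A B) \<ge> 0"
    using Hnorm_represents[OF represents_self[OF elementary_smooth_slab[OF profile_elementary profile_periodic]]]
    by (simp add: classical_sq_nonneg)
  show ?thesis
    using nn Hnorm_cmult[OF profile_elementary profile_periodic, of j "c * exp (\<mu> * k\<^sup>2 * t)"]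
    by (simp add: vHnorm_def sum_2 shear_flow_def vector_2 z abs_mult)
qed

text \<open>
  A vanishing norm would make the profile zero on the whole cell by continuity. At \<open>x\<^sub>2 = 0\<close> this
  gives \<open>A = 0\<close>, and then at \<open>x\<^sub>2 = 1/2\<close> also \<open>B = 0\<close>.
\<close>

lemma profile_nonzero:
  assumes "(A, B) \<noteq> (0, 0)" "k > 0"
  shows "Hnorm L 0 (profile k A B) > 0"
proof -
  let ?U = "profile k A B"
  have UR: "?U \<in> smooth_slab L" by (rule elementary_smooth_slab[OF profile_elementary profile_periodic])
  have c: "continuous_on S ?U" for S by (intro smooth_continuous smooth_elementary profile_elementary)
  have "(LINT x:cell L|lborel. (?U x)\<^sup>2) \<noteq> 0"
  proof
    assume "(LINT x:cell L|lborel. (?U x)\<^sup>2) = 0"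
    then have "AE x in lborel. indicator (cell L) x *\<^sub>R (?U x)\<^sup>2 = 0"
      using smooth_L2[OF R_smooth[OF UR]] unfolding set_lebesgue_integral_def L2_def set_integrable_def
      by (subst (asm) integral_nonneg_eq_0_iff_AE) auto
    then have ae: "AE x in lborel. x \<notin> {x \<in> cell L. ?U x \<noteq> 0}"
      by eventually_elim (auto simp: indicator_def split: if_splits)
    have op: "open {x \<in> cell L. ?U x \<noteq> 0}"
    proof -
      have "{x \<in> cell L. ?U x \<noteq> 0} = cell L \<inter> {x. ?U x \<noteq> 0}" by auto
      moreover have "open (cell L)" by (simp add: cell_box open_box)
      moreover have "open {x. ?U x \<noteq> 0}" by (intro open_Collect_neq c continuous_on_const)
      ultimately show ?thesis by (simp add: open_Int)
    qed
    from ae have "{x \<in> cell L. ?U x \<noteq> 0} \<in> null_sets lborel"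
      using op by (subst AE_iff_null_sets) auto
    then have "negligible {x \<in> cell L. ?U x \<noteq> 0}"
      by (simp add: negligible_iff_null_sets null_sets_completionI)
    then have zero: "?U x = 0" if "x \<in> cell L" for x
      using open_not_negligible[OF op] that by auto
    have in_cell: "point (pi * L) 0 \<in> cell L" "point (pi * L) (1 / 2) \<in> cell L"
      using L_pos by (auto simp: cell_def)
    have "A = 0" using zero[OF in_cell(1)] by (simp add: profile_def hyperbolic_def)
    moreover have "B * sinh (k * (1 / 2)) = 0"
      using zero[OF in_cell(2)] \<open>A = 0\<close> by (simp add: profile_def hyperbolic_def)
    ultimately show False using assms by auto
  qed
  moreover have "(LINT x:cell L|lborel. (?U x)\<^sup>2) \<ge> 0" by (rule set_integral_sq_nonneg)
  ultimately show ?thesis by (simp add: Hnorm_def sobolev_norm_def)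
qed

end

theorem theorem2p2:
  fixes L \<xi>p \<xi>m \<mu> :: real
  assumes "L > 0" and "\<mu> > 0" and "\<mu> < mu_c L \<xi>m \<xi>p"
  shows "\<exists>\<delta>0 > 0. \<exists>\<epsilon>0 > 0. \<exists>m0 > 0. \<exists>T :: real \<Rightarrow> real.
    T \<in> O[at_right 0](\<lambda>\<delta>. \<bar>ln \<delta>\<bar>) \<and>
    (\<forall>\<delta>. 0 < \<delta> \<and> \<delta> < \<delta>0 \<longrightarrow>
      (\<exists>u1 q1 T1 u2 q2 T2.
         strong_solution L \<xi>m \<xi>p \<mu> T1 u1 q1 \<and> strong_solution L \<xi>m \<xi>p \<mu> T2 u2 q2 \<and>
         vHnorm L 2 (u1 0) + vHnorm L 2 (u2 0) \<le> \<delta> \<and>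
         0 < T \<delta> \<and> T \<delta> \<in> existence_interval T1 \<and> T \<delta> \<in> existence_interval T2 \<and>
         vHnorm L 0 (\<lambda>x. u1 (T \<delta>) x - u2 (T \<delta>) x) \<ge> m0 * \<epsilon>0 \<and>
         m0 * \<epsilon>0 > (0 :: real)))"
proof -
  interpret slab L using assms(1) by unfold_locales
  obtain p m where "\<xi>p * p\<^sup>2 + \<xi>m * m\<^sup>2 > \<mu> * (p - m)\<^sup>2 / 2"
    using below_mu_c[OF assms] by blast
  from unstable_profile[OF assms(2) this] obtain k A B where k: "k > 0" and AB: "(A, B) \<noteq> (0, 0)"
    and bc: "\<mu> * hyperbolic k (k * B) (k * A) 0 0 1 = \<xi>p * hyperbolic k A B 0 0 1"
      "\<mu> * hyperbolic k (k * B) (k * A) 0 0 (-1) = - \<xi>m * hyperbolic k A B 0 0 (-1)" by blast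
  define r where "r = \<mu> * k\<^sup>2"
  have r: "r > 0" using assms(2) k by (simp add: r_def)
  define N0 N2 where "N0 = Hnorm L 0 (profile k A B)" "N2 = Hnorm L 2 (profile k A B)"
  have N0: "N0 > 0" unfolding N0_N2_def using profile_nonzero[OF AB k] .
  have N2: "N2 \<ge> 0" unfolding N0_N2_def
    using Hnorm_represents[OF represents_self[OF elementary_smooth_slab[OF profile_elementary profile_periodic]]]
    by (simp add: classical_sq_nonneg)
  \<comment> \<open>For \<open>\<delta> < 1\<close> this is the time at which the growth factor \<open>e\<^sup>r\<^sup>T\<close> is \<open>1 / \<delta>\<close>.\<close>
  define T where "T \<delta> = \<bar>ln \<delta>\<bar> / r" for \<delta> :: real
  let ?u = "\<lambda>c. shear_flow \<mu> k A B c"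
  have sol: "strong_solution L \<xi>m \<xi>p \<mu> \<infinity> (?u c) (\<lambda>t x. 0)" for c
    using shear_flow_solution[OF bc] .
  have diff: "(\<lambda>x. ?u c t x - ?u 0 t x) = ?u c t" for c t
    by (auto simp: shear_flow_def vec_eq_iff forall_2 vector_2)
  have "T \<in> O[at_right 0](\<lambda>\<delta>. \<bar>ln \<delta>\<bar>)"
    unfolding T_def using r by (intro bigoI[of _ "1 / r"]) auto
  moreover have "\<exists>u1 q1 T1 u2 q2 T2.
         strong_solution L \<xi>m \<xi>p \<mu> T1 u1 q1 \<and> strong_solution L \<xi>m \<xi>p \<mu> T2 u2 q2 \<and>
         vHnorm L 2 (u1 0) + vHnorm L 2 (u2 0) \<le> \<delta> \<and>
         0 < T \<delta> \<and> T \<delta> \<in> existence_interval T1 \<and> T \<delta> \<in> existence_interval T2 \<and>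
         vHnorm L 0 (\<lambda>x. u1 (T \<delta>) x - u2 (T \<delta>) x) \<ge> 1 * (N0 / (N2 + 1)) \<and>
         1 * (N0 / (N2 + 1)) > (0 :: real)" if \<delta>: "0 < \<delta>" "\<delta> < 1" for \<delta>
  proof -
    let ?c = "\<delta> / (N2 + 1)"
    have ln: "ln \<delta> < 0" using \<delta> by simp
    have T: "0 < T \<delta>" unfolding T_def using ln r by (simp add: divide_neg_pos)
    have "exp (r * T \<delta>) = 1 / \<delta>" using r ln \<delta> by (simp add: T_def exp_minus inverse_eq_divide)
    then have "vHnorm L 0 (?u ?c (T \<delta>)) = N0 / (N2 + 1)"
      using \<delta> N2 by (simp add: vHnorm_shear_flow r_def[symmetric] N0_N2_def[symmetric])
    moreover have "vHnorm L 2 (?u ?c 0) + vHnorm L 2 (?u 0 0) \<le> \<delta>"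
      using \<delta> N2 by (simp add: vHnorm_shear_flow N0_N2_def[symmetric] divide_le_eq)
    moreover have "N0 / (N2 + 1) > 0" using N0 N2 by simp
    moreover have "T \<delta> \<in> existence_interval \<infinity>" using T by (simp add: existence_interval_def)
    ultimately show ?thesis
      using sol[of ?c] sol[of 0] T diff[of ?c "T \<delta>"]
      by (intro exI[of _ "?u ?c"] exI[of _ "\<lambda>t x. 0"] exI[of _ \<infinity>] exI[of _ "?u 0"]) simp
  qed
  moreover have "N0 / (N2 + 1) > 0" using N0 N2 by simp
  ultimately show ?thesis
    by (intro exI[of _ "1::real"] exI[of _ "N0 / (N2 + 1)"] exI[of _ T] conjI) auto
qed

end
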